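(* Let $p$ be an odd prime, let $S$ be a $p$-group and let $\mathcal{F}$ be a saturated fusion system on $S$. Let $E\in\mathcal{P}(\mathcal{F})$ be a pearl and let $m$ be such that $[S:E]=p^m$. For every $1\leq i\leq m-1$ let $\mathcal{E}_i$ be the smallest fusion subsystem of $\mathcal{F}$ defined on $N^i(E)$ such that $\mathrm{Aut}_{\mathcal{E}_i}(E)=\mathrm{Aut}_{\mathcal{F}}(E)$ and $\mathrm{Aut}_{\mathcal{E}_i}(N^i(E))=\mathrm{Inn}(N^i(E))\,N_{\mathrm{Aut}_{\mathcal{F}}(N^i(E))}(E)$. Then $\mathcal{E}_i$ is a saturated fusion subsystem of $\mathcal{F}$ and $E\in\mathcal{P}(\mathcal{E}_i)$.
   Context: All groups are finite. A fusion system $\mathcal{F}$ on a $p$-group $S$ is a category whose objects are the subgroups of $S$ and whose morphism sets $\mathrm{Hom}_{\mathcal{F}}(P,Q)$ consist of injective homomorphisms $P\to Q$, contain all restrictions of conjugation maps by elements of $S$ carrying $P$ into $Q$, and such that every morphism is an $\mathcal{F}$-isomorphism onto its image (with inverse in $\mathcal{F}$) followed by an inclusion. It is saturated if it satisfies the usual saturation axioms of Puig / Broto--Levi--Oliver. Morphisms are written on the right. $\mathrm{Aut}_{\mathcal{F}}(P)=\mathrm{Hom}_{\mathcal{F}}(P,P)$, $\mathrm{Out}_{\mathcal{F}}(P)=\mathrm{Aut}_{\mathcal{F}}(P)/\mathrm{Inn}(P)$. For $E\leq P$, $N_{\mathrm{Aut}_{\mathcal{F}}(P)}(E)=\{\alpha\in\mathrm{Aut}_{\mathcal{F}}(P):E\alpha=E\}$.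 A subgroup $E\leq S$ is $\mathcal{F}$-essential if: $C_S(E\alpha)\leq E\alpha$ for all $\alpha\in\mathrm{Hom}_{\mathcal{F}}(E,S)$; $|N_S(E)|\geq |N_S(E\alpha)|$ for all $\alpha\in\mathrm{Hom}_{\mathcal{F}}(E,S)$; and $\mathrm{Out}_{\mathcal{F}}(E)$ contains a strongly $p$-embedded subgroup (a proper subgroup $H$ of $G$ such that $p$ divides $|H|$ and $p$ does not divide $|H\cap H^g|$ for every $g\in G\setminus H$). A pearl is an $\mathcal{F}$-essential subgroup that is either elementary abelian of order $p^2$ or non-abelian of order $p^3$; $\mathcal{P}(\mathcal{F})$ is the set of pearls of $\mathcal{F}$ (and $\mathcal{P}(\mathcal{E}_i)$ is defined likewise for the fusion system $\mathcal{E}_i$ on $N^i(E)$). For $E\leq S$ with $[S:E]=p^m$ put $N^0(E)=E$ and $N^i(E)=N_S(N^{i-1}(E))$ for $1\leq i\leq m$; for a pearl $E$ these satisfy $[N^i(E):N^{i-1}(E)]=p$ for all $1\le i\le m$. *)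

theory Defs
  imports "HOL-Algebra.Sylow" "HOL-Algebra.Group_Action"
begin

section \<open>Groups\<close>

locale p_group = group G for p :: nat and G (structure) +
  assumes prime_p: "Factorial_Ring.prime p"
    and finite_carrier: "finite (carrier G)"
    and order_prime_power: "\<exists>n. order G = p ^ n"

definition centralizer :: "('a, 'b) monoid_scheme \<Rightarrow> 'a set \<Rightarrow> 'a set" where
  "centralizer G P = {g \<in> carrier G. \<forall>x\<in>P. g \<otimes>\<^bsub>G\<^esub> x = x \<otimes>\<^bsub>G\<^esub> g}"

definition sylow_subgroup :: "nat \<Rightarrow> 'a set \<Rightarrow> ('a, 'b) monoid_scheme \<Rightarrow> bool" where
  "sylow_subgroup p H G \<longleftrightarrow> subgroup H G \<and> card H = p ^ multiplicity p (order G)"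

definition strongly_embedded :: "nat \<Rightarrow> 'a set \<Rightarrow> ('a, 'b) monoid_scheme \<Rightarrow> bool" where
  "strongly_embedded p H G \<longleftrightarrow>
     subgroup H G \<and> H \<noteq> carrier G \<and> p dvd card H \<and>
     (\<forall>g \<in> carrier G - H. \<not> p dvd card (H \<inter> (inv\<^bsub>G\<^esub> g <#\<^bsub>G\<^esub> H #>\<^bsub>G\<^esub> g)))"

definition elementary_abelian :: "nat \<Rightarrow> ('a, 'b) monoid_scheme \<Rightarrow> bool" where
  "elementary_abelian p G \<longleftrightarrow>
     comm_group G \<and> (\<forall>x \<in> carrier G. x [^]\<^bsub>G\<^esub> p = \<one>\<^bsub>G\<^esub>)"

primrec iter_normalizer :: "('a, 'b) monoid_scheme \<Rightarrow> 'a set \<Rightarrow> nat \<Rightarrow> 'a set" where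
  "iter_normalizer G E 0 = E"
| "iter_normalizer G E (Suc i) = normalizer G (iter_normalizer G E i)"

definition conj_map :: "('a, 'b) monoid_scheme \<Rightarrow> 'a set \<Rightarrow> 'a \<Rightarrow> 'a \<Rightarrow> 'a" where
  "conj_map G P g = (\<lambda>x\<in>P. inv\<^bsub>G\<^esub> g \<otimes>\<^bsub>G\<^esub> x \<otimes>\<^bsub>G\<^esub> g)"

definition conj_hom :: "('a, 'b) monoid_scheme \<Rightarrow> 'a set \<Rightarrow> 'a set \<Rightarrow> ('a \<Rightarrow> 'a) set" where
  "conj_hom G P Q = {conj_map G P g | g. g \<in> carrier G \<and> conj_map G P g ` P \<subseteq> Q}"

definition Inn :: "('a, 'b) monoid_scheme \<Rightarrow> 'a set \<Rightarrow> ('a \<Rightarrow> 'a) set" where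
  "Inn G P = conj_map G P ` P"


section \<open>Fusion systems\<close>

text \<open>A fusion system is given by its morphism sets: \<open>F P Q\<close> is the set of morphisms from
  \<open>P\<close> to \<open>Q\<close>. Morphisms from \<open>P\<close> are functions that are \<^const>\<open>undefined\<close> outside \<open>P\<close>, and
  \<open>F P Q\<close> is empty unless \<open>P\<close> and \<open>Q\<close> are subgroups, so that two fusion systems are equal as
  functions iff they have the same morphisms, and \<open>\<le>\<close> on functions is the subsystem order.\<close>

type_synonym 'a fusion = "'a set \<Rightarrow> 'a set \<Rightarrow> ('a \<Rightarrow> 'a) set"

text \<open>Identities and inclusions are conjugations by \<open>\<one>\<close>, and so covered by \<open>conj_hom_subset\<close>.\<close>

locale fusion_system = p_group p S for p :: nat and S (structure) +
  fixes F :: "'a fusion"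
  assumes objects: "\<phi> \<in> F P Q \<Longrightarrow> subgroup P S \<and> subgroup Q S"
    and injective_hom: "\<phi> \<in> F P Q \<Longrightarrow> \<phi> \<in> mon (S\<lparr>carrier := P\<rparr>) (S\<lparr>carrier := Q\<rparr>) \<inter> extensional P"
    and compose_closed: "\<phi> \<in> F P Q \<Longrightarrow> \<psi> \<in> F Q R \<Longrightarrow> compose P \<psi> \<phi> \<in> F P R"
    and conj_hom_subset: "subgroup P S \<Longrightarrow> subgroup Q S \<Longrightarrow> conj_hom S P Q \<subseteq> F P Q"
    and onto_image: "\<phi> \<in> F P Q \<Longrightarrow> \<phi> \<in> F P (\<phi> ` P)"
    and inverse_onto_image: "\<phi> \<in> F P Q \<Longrightarrow> restrict (inv_into P \<phi>) (\<phi> ` P) \<in> F (\<phi> ` P) P"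

definition Aut_group :: "('a, 'b) monoid_scheme \<Rightarrow> 'a fusion \<Rightarrow> 'a set \<Rightarrow> ('a \<Rightarrow> 'a) monoid" where
  "Aut_group S F P = (AutoGroup (S\<lparr>carrier := P\<rparr>))\<lparr>carrier := F P P\<rparr>"

definition Out_group :: "('a, 'b) monoid_scheme \<Rightarrow> 'a fusion \<Rightarrow> 'a set \<Rightarrow> ('a \<Rightarrow> 'a) set monoid" where
  "Out_group S F P = Aut_group S F P Mod Inn S P"

definition Aut_normalizer :: "'a fusion \<Rightarrow> 'a set \<Rightarrow> 'a set \<Rightarrow> ('a \<Rightarrow> 'a) set" where
  "Aut_normalizer F P E = {\<alpha> \<in> F P P. \<alpha> ` E = E}"

definition fully_normalized :: "('a, 'b) monoid_scheme \<Rightarrow> 'a fusion \<Rightarrow> 'a set \<Rightarrow> bool" where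
  "fully_normalized S F P \<longleftrightarrow>
     (\<forall>\<phi> \<in> F P (carrier S). card (normalizer S (\<phi> ` P)) \<le> card (normalizer S P))"

definition fully_centralized :: "('a, 'b) monoid_scheme \<Rightarrow> 'a fusion \<Rightarrow> 'a set \<Rightarrow> bool" where
  "fully_centralized S F P \<longleftrightarrow>
     (\<forall>\<phi> \<in> F P (carrier S). card (centralizer S (\<phi> ` P)) \<le> card (centralizer S P))"

definition centric :: "('a, 'b) monoid_scheme \<Rightarrow> 'a fusion \<Rightarrow> 'a set \<Rightarrow> bool" where
  "centric S F P \<longleftrightarrow> (\<forall>\<phi> \<in> F P (carrier S). centralizer S (\<phi> ` P) \<subseteq> \<phi> ` P)"

text \<open>The subgroup \<open>N\<^sub>\<phi>\<close> of all \<open>g \<in> N\<^sub>S(P)\<close> for which conjugation by \<open>g\<close> on \<open>P\<close>, transported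
  along \<open>\<phi>\<close>, lies in \<open>Aut\<^sub>S(P\<phi>)\<close>.\<close>

definition extension_domain :: "('a, 'b) monoid_scheme \<Rightarrow> 'a set \<Rightarrow> ('a \<Rightarrow> 'a) \<Rightarrow> 'a set" where
  "extension_domain S P \<phi> =
     {g \<in> normalizer S P.
        (\<lambda>y \<in> \<phi> ` P. \<phi> (conj_map S P g (inv_into P \<phi> y))) \<in> conj_hom S (\<phi> ` P) (\<phi> ` P)}"

text \<open>The saturation axioms of Broto, Levi and Oliver.\<close>

locale saturated_fusion_system = fusion_system p S F for p and S (structure) and F +
  assumes fully_normalized_imp:
      "subgroup P S \<Longrightarrow> fully_normalized S F P \<Longrightarrow>
       fully_centralized S F P \<and> sylow_subgroup p (conj_hom S P P) (Aut_group S F P)"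
    and extension:
      "\<phi> \<in> F P (carrier S) \<Longrightarrow> fully_centralized S F (\<phi> ` P) \<Longrightarrow>
       \<exists>\<psi> \<in> F (extension_domain S P \<phi>) (carrier S). \<forall>x\<in>P. \<psi> x = \<phi> x"

definition fusion_subsystem ::
    "nat \<Rightarrow> ('a, 'b) monoid_scheme \<Rightarrow> 'a set \<Rightarrow> 'a fusion \<Rightarrow> 'a fusion \<Rightarrow> bool" where
  "fusion_subsystem p S T D F \<longleftrightarrow>
     subgroup T S \<and> fusion_system p (S\<lparr>carrier := T\<rparr>) D \<and> (\<forall>P Q. D P Q \<subseteq> F P Q)"


section \<open>Essential subgroups and pearls\<close>

definition essential :: "nat \<Rightarrow> ('a, 'b) monoid_scheme \<Rightarrow> 'a fusion \<Rightarrow> 'a set \<Rightarrow> bool" where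
  "essential p S F E \<longleftrightarrow>
     subgroup E S \<and> centric S F E \<and> fully_normalized S F E \<and>
     (\<exists>H. strongly_embedded p H (Out_group S F E))"

definition pearls :: "nat \<Rightarrow> ('a, 'b) monoid_scheme \<Rightarrow> 'a fusion \<Rightarrow> 'a set set" where
  "pearls p S F =
     {E. essential p S F E \<and>
         (elementary_abelian p (S\<lparr>carrier := E\<rparr>) \<and> card E = p ^ 2 \<or>
          \<not> comm_group (S\<lparr>carrier := E\<rparr>) \<and> card E = p ^ 3)}"

text \<open>The order underlying \<open>LEAST\<close> is inclusion of all morphism sets. As \<open>LEAST\<close> is a definite
  description, nothing can be inferred about the subsystem before a smallest one is shown to exist.\<close>

definition pearl_subsystem ::
    "nat \<Rightarrow> ('a, 'b) monoid_scheme \<Rightarrow> 'a fusion \<Rightarrow> 'a set \<Rightarrow> nat \<Rightarrow> 'a fusion" where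
  "pearl_subsystem p S F E i =
     (let N = iter_normalizer S E i in
      LEAST D. fusion_subsystem p S N D F \<and>
               D E E = F E E \<and>
               D N N = Inn S N <#>\<^bsub>Aut_group S F N\<^esub> Aut_normalizer F N E)"

end

theory Submission
  imports Defs "HOL-Algebra.Multiplicative_Group"
begin

text \<open>
  Let \<open>Z\<^sub>0\<close> be trivial if \<open>|E| = p\<^sup>2\<close> and \<open>Z(E)\<close> if \<open>|E| = p\<^sup>3\<close>, and let \<open>Z\<^sub>j\<^sub>+\<^sub>1/Z\<^sub>j\<close> be the centre of \<open>S/Z\<^sub>j\<close>.
  Inductively \<open>N\<^sup>j(E)/Z\<^sub>j\<close> is a self-centralizing subgroup of order \<open>p\<^sup>2\<close> of \<open>S/Z\<^sub>j\<close>, and so the normalizer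
  grows by a factor \<open>p\<close> in each step. As this holds for all \<open>\<F>\<close>-conjugates of \<open>E\<close>, each \<open>N\<^sup>j(E)\<close> with \<open>j < m\<close> is
  fully normalized, and \<open>Aut\<^sub>\<F>(N\<^sup>j(E))\<close> (for \<open>j = 0\<close>: the stabilizer of \<open>K = Z\<^sub>1\<close>) acts on a chain of
  subgroups whose factors have order at most \<open>p\<close>. The kernel of this action is a normal \<open>p\<close>-subgroup, hence
  \<open>Aut\<^sub>S(N\<^sup>j(E))\<close>. By the extension axiom every \<open>\<alpha> \<in> Aut\<^sub>\<F>(E)\<close> with \<open>K\<alpha> = K\<close> extends to \<open>T = N\<^sup>i(E)\<close>, and
  the \<open>p\<close>-elements of \<open>Inn(T) N\<close>, where \<open>N\<close> is the normalizer of \<open>E\<close> in \<open>Aut\<^sub>\<F>(T)\<close>, are inner.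

  The smallest subsystem consists of the restrictions of elements of \<open>Inn(T) N\<close> and the composites
  \<open>c\<^sub>t \<alpha> c\<^sub>u\<close> with \<open>\<alpha> \<in> Aut\<^sub>\<F>(E)\<close> and \<open>t, u \<in> T\<close>; they are closed under composition because \<open>Aut\<^sub>\<F>(E)\<close>
  controls the fusion in \<open>T\<close> of subgroups of \<open>E\<close>. For saturation, let \<open>P < E\<close>. If \<open>P\<close> is not contained in
  \<open>K\<close>, then \<open>N\<^sub>T(P) \<le> E\<close> and \<open>\<alpha>\<close> itself is the extension required of \<open>\<alpha>|\<^sub>P\<close>. If \<open>P\<close> and \<open>P\<alpha>\<close> are contained in
  \<open>K\<close>, then \<open>\<alpha>|\<^sub>P\<close> is also the restriction of an automorphism of \<open>E\<close> that preserves \<open>K\<close>, and so extends to \<open>T\<close>.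
  If only \<open>P\<close> is contained in \<open>K\<close>, then \<open>P\<alpha>\<close> is not fully centralized.
\<close>

section \<open>Conjugation and finite groups\<close>

text \<open>The obstacle is \<open>Z\<^sub>1\<close>. In \<open>N\<^sup>j\<close> the groups
  \<open>Z\<^sub>k\<close> with \<open>k \<le> j\<close> are relative centres, so every
  \<F>-automorphism preserves them. But \<open>N\<^sup>j/Z\<^sub>j\<close> has order
  \<open>p\<^sup>2\<close>, and its group structure does not single out the line
  \<open>Z\<^sub>j\<^sub>+\<^sub>1/Z\<^sub>j\<close>. For \<open>j > 0\<close> the fully normalized
  subgroup \<open>N\<^sup>j\<^sup>-\<^sup>1\<close> is what distinguishes it; for
  \<open>j = 0\<close> there is no such subgroup, and so the later case distinctions ask how a
  subgroup of \<open>E\<close> lies relative to \<open>K\<close> and \<open>Z\<^sub>0\<close>.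

  The morphisms of the subsystem pass through \<open>E\<close> at most once. Being given by such
  short formulas, they can be tested against the saturation axioms for each subgroup directly,
  without a reduction to centric or essential subgroups.

  Sections of \<open>S\<close> are mostly treated by commutators taken in \<open>S\<close> rather
  than by quotient groups: that a map is trivial on \<open>Q/Z\<close> is written as
  \<open>inv y \<otimes> \<gamma> y \<in> Z\<close> for \<open>y\<close> in \<open>Q\<close>. So all
  groups and maps of the tower live on one type.\<close>

definition cj :: "('a, 'b) monoid_scheme \<Rightarrow> 'a \<Rightarrow> 'a \<Rightarrow> 'a" where
  "cj G g x = inv\<^bsub>G\<^esub> g \<otimes>\<^bsub>G\<^esub> x \<otimes>\<^bsub>G\<^esub> g"

context group
begin

lemma cj_closed [simp, intro]: "g \<in> carrier G \<Longrightarrow> x \<in> carrier G \<Longrightarrow> cj G g x \<in> carrier G"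
  by (simp add: cj_def)

lemma mult_inv_cancel [simp]:
  "g \<in> carrier G \<Longrightarrow> x \<in> carrier G \<Longrightarrow> inv g \<otimes> (g \<otimes> x) = x"
  "g \<in> carrier G \<Longrightarrow> x \<in> carrier G \<Longrightarrow> g \<otimes> (inv g \<otimes> x) = x"
  by (simp_all flip: m_assoc)

lemma cj_mult:
  "g \<in> carrier G \<Longrightarrow> x \<in> carrier G \<Longrightarrow> y \<in> carrier G \<Longrightarrow>
   cj G g (x \<otimes> y) = cj G g x \<otimes> cj G g y"
  by (simp add: cj_def m_assoc)

lemma cj_cj:
  "g \<in> carrier G \<Longrightarrow> h \<in> carrier G \<Longrightarrow> x \<in> carrier G \<Longrightarrow> cj G h (cj G g x) = cj G (g \<otimes> h) x"
  by (simp add: cj_def m_assoc inv_mult_group)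

lemma cj_one_left [simp]: "x \<in> carrier G \<Longrightarrow> cj G \<one> x = x"
  by (simp add: cj_def)

lemma cj_one_right [simp]: "g \<in> carrier G \<Longrightarrow> cj G g \<one> = \<one>"
  by (simp add: cj_def)

lemma cj_inv_cancel [simp]:
  "g \<in> carrier G \<Longrightarrow> x \<in> carrier G \<Longrightarrow> cj G (inv g) (cj G g x) = x"
  "g \<in> carrier G \<Longrightarrow> x \<in> carrier G \<Longrightarrow> cj G g (cj G (inv g) x) = x"
  by (simp_all add: cj_cj)

lemma cj_eq_self_iff:
  "g \<in> carrier G \<Longrightarrow> x \<in> carrier G \<Longrightarrow> cj G g x = x \<longleftrightarrow> g \<otimes> x = x \<otimes> g"
  by (simp add: cj_def m_assoc inv_solve_left')
    (metis)

lemma inj_on_cj: "g \<in> carrier G \<Longrightarrow> inj_on (cj G g) (carrier G)"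
  by (metis cj_inv_cancel(1) inj_onI)

lemma card_cj_image: "g \<in> carrier G \<Longrightarrow> P \<subseteq> carrier G \<Longrightarrow> card (cj G g ` P) = card P"
  by (meson card_image inj_on_cj inj_on_subset)

lemma cj_cj_image:
  "g \<in> carrier G \<Longrightarrow> h \<in> carrier G \<Longrightarrow> P \<subseteq> carrier G \<Longrightarrow>
   cj G h ` (cj G g ` P) = cj G (g \<otimes> h) ` P"
  by (auto simp: image_image cj_cj subset_iff intro!: image_cong)

lemma cj_one_image: "P \<subseteq> carrier G \<Longrightarrow> cj G \<one> ` P = P"
  by (auto simp: image_iff subset_iff)

lemma subgroup_cj_closed: "subgroup P G \<Longrightarrow> g \<in> P \<Longrightarrow> x \<in> P \<Longrightarrow> cj G g x \<in> P"
  by (simp add: cj_def subgroup.m_closed subgroup.m_inv_closed)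

lemma subgroup_hom_image:
  assumes P: "subgroup P G" and f: "\<And>x. x \<in> P \<Longrightarrow> f x \<in> carrier G"
    and mult: "\<And>x y. x \<in> P \<Longrightarrow> y \<in> P \<Longrightarrow> f (x \<otimes> y) = f x \<otimes> f y"
  shows "subgroup (f ` P) G"
proof -
  interpret h: group_hom "G\<lparr>carrier := P\<rparr>" G f
    using P f mult by (intro group_hom.intro)
      (auto simp: group_hom_axioms_def hom_def subgroup.subgroup_is_group)
  show ?thesis using h.img_is_subgroup by simp
qed

lemma subgroup_cj_image: "subgroup P G \<Longrightarrow> g \<in> carrier G \<Longrightarrow> subgroup (cj G g ` P) G"
  by (rule subgroup_hom_image) (auto simp: cj_mult subgroup.mem_carrier)

lemma cj_image_self:
  assumes P: "subgroup P G" and g: "g \<in> P" shows "cj G g ` P = P"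
proof -
  have "x = cj G g (cj G (inv g) x)" if "x \<in> P" for x
    using that assms subgroup.mem_carrier[OF P] by simp
  thus ?thesis
    using assms subgroup_cj_closed[OF P] subgroup.m_inv_closed[OF P] by blast
qed

text \<open>The library's \<open>normalizer\<close> is a stabilizer under
  \<open>g <# H #> inv g\<close>, which is \<open>cj\<close> by \<open>inv g\<close>; fixing
  \<open>H\<close> under \<open>inv g\<close> and under \<open>g\<close> amounts to the
  same.\<close>

lemma mem_normalizer_iff:
  assumes H: "H \<subseteq> carrier G"
  shows "g \<in> normalizer G H \<longleftrightarrow> g \<in> carrier G \<and> cj G g ` H = H"
proof -
  have "g <# H #> inv g = cj G (inv g) ` H" if g: "g \<in> carrier G"
    using g H by (auto simp: l_coset_def r_coset_def cj_def image_iff)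
  moreover have "cj G (inv g) ` H = H \<longleftrightarrow> cj G g ` H = H" if g: "g \<in> carrier G"
    using cj_cj_image[of "inv g" g H] cj_cj_image[of g "inv g" H] g H cj_one_image[OF H]
    by (metis inv_closed l_inv r_inv)
  ultimately show ?thesis
    using H unfolding normalizer_def stabilizer_def by (cases "g \<in> carrier G") simp_all
qed

lemma subgroup_normalizer: "H \<subseteq> carrier G \<Longrightarrow> subgroup (normalizer G H) G"
  by (rule normalizer_imp_subgroup)

lemma subset_normalizer: "subgroup H G \<Longrightarrow> H \<subseteq> normalizer G H"
  by (auto simp: mem_normalizer_iff subgroup.subset subgroup.mem_carrier cj_image_self)

lemma mem_normalizerI:
  assumes "finite H" "H \<subseteq> carrier G" "g \<in> carrier G" "cj G g ` H \<subseteq> H"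
  shows "g \<in> normalizer G H"
  using assms card_subset_eq[of H "cj G g ` H"] by (auto simp: mem_normalizer_iff card_cj_image)

lemma finite_subgroup: "subgroup H G \<Longrightarrow> finite (carrier G) \<Longrightarrow> finite H"
  by (meson finite_subset subgroup.subset)

lemma card_rcosets_times_card:
  assumes "subgroup H G" "subgroup K G" "H \<subseteq> K"
  shows "card ((\<lambda>x. H #> x) ` K) * card H = card K"
proof -
  interpret K: group "G\<lparr>carrier := K\<rparr>"
    using assms by (simp add: subgroup_imp_group)
  have "subgroup H (G\<lparr>carrier := K\<rparr>)"
    using assms by (simp add: subgroup_incl)
  moreover have "rcosets\<^bsub>G\<lparr>carrier := K\<rparr>\<^esub> H = (\<lambda>x. H #> x) ` K"
    by (auto simp: RCOSETS_def r_coset_def)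
  ultimately show ?thesis
    using K.lagrange[of H] by (simp add: order_def)
qed

lemma card_subgroup_dvd:
  assumes "subgroup H G" "subgroup K G" "H \<subseteq> K" shows "card H dvd card K"
  using card_rcosets_times_card[OF assms] by (metis dvd_triv_right)

lemma prime_index_cases:
  assumes "subgroup Z G" "subgroup H G" "subgroup Q G" "Z \<subseteq> H" "H \<subseteq> Q"
    and "card Q = p * card Z" "Factorial_Ring.prime p" "finite (carrier G)"
  shows "H = Z \<or> H = Q"
proof -
  have fin: "finite Q" "finite H" and pos: "0 < card Z"
    using assms finite_subgroup by (auto simp: subgroup.finite_imp_card_positive)
  obtain a where a: "card H = card Z * a"
    using card_subgroup_dvd[OF assms(1,2,4)] by blast
  obtain b where b: "card Q = card H * b"
    using card_subgroup_dvd[OF assms(2,3,5)] by blast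
  have "card Z * (a * b) = card Z * p"
    using a b assms(6) by (auto simp: mult_ac)
  hence "p = a * b" using pos by simp
  hence "a = 1 \<or> b = 1"
    using assms(7) by (metis prime_product)
  thus ?thesis
    using a b card_subset_eq[OF fin(2) assms(4)] card_subset_eq[OF fin(1) assms(5)] by auto
qed

text \<open>The device behind most arguments below. If the elements with some property form a
  subgroup \<open>H\<close>, the property holds on all of \<open>Q\<close> as soon as it holds on
  \<open>Z\<close> and at one element outside \<open>Z\<close>.\<close>

lemma prime_index_eq:
  assumes "subgroup Z G" "subgroup H G" "subgroup Q G" "Z \<subseteq> H" "H \<subseteq> Q"
    and "card Q = p * card Z" "Factorial_Ring.prime p" "finite (carrier G)" "x \<in> H" "x \<notin> Z"
  shows "H = Q"
  using prime_index_cases[OF assms(1-8)] assms(9,10) by auto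

text \<open>Meant for commutator maps such as \<open>h\<close> to
  \<open>inv y \<otimes> cj G h y\<close>: they are not homomorphisms, but each fibre lies in one
  coset of a centralizer \<open>L\<close>.\<close>

lemma card_le_image_times_fibre:
  assumes "subgroup H G" "subgroup L G" "finite (carrier G)"
    and fibre: "\<And>h h'. h \<in> H \<Longrightarrow> h' \<in> H \<Longrightarrow> f h = f h' \<Longrightarrow> h \<otimes> inv h' \<in> L"
  shows "card H \<le> card (f ` H) * card L"
proof -
  have fin: "finite H" "finite L"
    using assms finite_subgroup by auto
  have "card (H \<inter> f -` {a}) \<le> card L" if "a \<in> f ` H" for a
  proof -
    obtain h' where h': "h' \<in> H" "a = f h'" using \<open>a \<in> f ` H\<close> by blast
    hence c: "h' \<in> carrier G" using assms(1) by (simp add: subgroup.mem_carrier)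
    have "H \<inter> f -` {a} \<subseteq> (\<lambda>l. l \<otimes> h') ` L"
    proof
      fix h assume h: "h \<in> H \<inter> f -` {a}"
      hence "h \<otimes> inv h' \<in> L" "h \<in> carrier G"
        using fibre h' assms(1) by (auto simp: subgroup.mem_carrier)
      moreover have "h = h \<otimes> inv h' \<otimes> h'" using c calculation by (simp add: m_assoc)
      ultimately show "h \<in> (\<lambda>l. l \<otimes> h') ` L" by blast
    qed
    thus ?thesis
      by (meson card_image_le card_mono fin(2) finite_imageI le_trans)
  qed
  hence "(\<Sum>a\<in>f ` H. card (H \<inter> f -` {a})) \<le> (\<Sum>a\<in>f ` H. card L)"
    by (rule sum_mono)
  moreover have "card H = (\<Sum>a\<in>f ` H. card (H \<inter> f -` {a}))"
    using fin card_UN_disjoint[of "f ` H" "\<lambda>a. H \<inter> f -` {a}"]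
    by (subst card_UN_disjoint[symmetric]) (auto intro!: arg_cong[where f=card])
  ultimately show ?thesis by simp
qed

end

lemma funpow_funpow: "(f ^^ m) ((f ^^ n) x) = (f ^^ (m + n)) x"
  by (simp add: funpow_add)

lemma funpow_fixed_mult: "(f ^^ n) x = x \<Longrightarrow> (f ^^ (n * k)) x = x"
  by (induction k) (auto simp: funpow_add)

context group
begin

text \<open>The \<open>p\<close> elements \<open>\<gamma>\<^sup>i y\<close>, \<open>i < p\<close>, lie in the \<open>p - 1\<close> nontrivial cosets, so some \<open>\<gamma>\<^sup>d\<close> with
  \<open>0 < d < p\<close> fixes the coset of \<open>y\<close>; as \<open>d\<close> is coprime to the order of \<open>\<gamma>\<close>, so does \<open>\<gamma>\<close>.\<close>

lemma p_automorphism_trivial_on_prime_index: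
  assumes Z: "subgroup Z G" and Q: "subgroup Q G" and ZQ: "Z \<subseteq> Q" and card: "card Q = p * card Z"
    and p: "Factorial_Ring.prime p" and fin: "finite (carrier G)"
    and \<gamma>Q: "\<And>x. x \<in> Q \<Longrightarrow> \<gamma> x \<in> Q"
    and mult: "\<And>x y. x \<in> Q \<Longrightarrow> y \<in> Q \<Longrightarrow> \<gamma> (x \<otimes> y) = \<gamma> x \<otimes> \<gamma> y"
    and \<gamma>Z: "\<And>x. x \<in> Z \<Longrightarrow> \<gamma> x \<in> Z"
    and pow: "\<And>x. x \<in> Q \<Longrightarrow> (\<gamma> ^^ (p ^ k)) x = x"
    and y: "y \<in> Q"
  shows "inv y \<otimes> \<gamma> y \<in> Z"
proof -
  note cQ = subgroup.mem_carrier[OF Q] and cZ = subgroup.mem_carrier[OF Z]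
  have powQ: "(\<gamma> ^^ n) x \<in> Q" if "x \<in> Q" for n x
    using that by (induction n) (auto intro: \<gamma>Q)
  have powZ: "(\<gamma> ^^ n) x \<in> Z" if "x \<in> Z" for n x
    using that by (induction n) (auto intro: \<gamma>Z)
  have powm: "(\<gamma> ^^ n) (x \<otimes> y) = (\<gamma> ^^ n) x \<otimes> (\<gamma> ^^ n) y" if "x \<in> Q" "y \<in> Q" for n x y
    using that by (induction n) (auto simp: mult powQ)
  have finQ: "finite Q" using fin Q by (rule finite_subgroup[rotated])
  have hom1: "\<gamma> \<one> = \<one>"
    using mult[of \<one> \<one>] \<gamma>Q[of \<one>] subgroup.one_closed[OF Q] cQ
    by simp
  have hominv: "\<gamma> (inv x) = inv (\<gamma> x)" if "x \<in> Q" for x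
    using mult[of "inv x" x] that hom1 cQ \<gamma>Q subgroup.m_inv_closed[OF Q]
    by (metis inv_equality l_inv)
  have main: "\<gamma> y \<otimes> inv y \<in> Z" if y: "y \<in> Q" for y
  proof (cases "y \<in> Z")
    case True
    thus ?thesis using \<gamma>Z Z by (simp add: subgroup.m_closed subgroup.m_inv_closed)
  next
    case False
    define X where "X = (\<lambda>x. Z #> x) ` Q"
    have "card X * card Z = card Q"
      unfolding X_def by (rule card_rcosets_times_card[OF Z Q ZQ])
    hence cX: "card X = p"
      using card subgroup.finite_imp_card_positive[OF Z fin] by auto
    have fX: "finite X" using finQ by (simp add: X_def)
    define f where "f i = Z #> (\<gamma> ^^ i) y" for i
    have notZ: "(\<gamma> ^^ i) y \<notin> Z" for i
    proof
      assume a: "(\<gamma> ^^ i) y \<in> Z"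
      \<comment> \<open>\<open>n\<close> completes \<open>i\<close> to a multiple of the period
        \<open>p ^ k\<close>, so iterating \<open>\<gamma>\<close> another \<open>n\<close> times
        undoes the first \<open>i\<close> iterations and no inverse of \<open>\<gamma>\<close> has
        to be introduced.\<close>
      define n where "n = (p ^ k) * i - i"
      have "i \<le> (p ^ k) * i" using p by (simp add: prime_gt_0_nat Suc_leI)
      hence "(\<gamma> ^^ n) ((\<gamma> ^^ i) y) = (\<gamma> ^^ ((p ^ k) * i)) y"
        by (simp add: n_def funpow_funpow)
      also have "\<dots> = y" using funpow_fixed_mult[OF pow[OF y]] .
      finally show False using powZ[OF a] False by metis
    qed
    have eqD: "a \<otimes> inv b \<in> Z" if "Z #> a = Z #> b" "a \<in> Q" "b \<in> Q" for a b
    proof -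
      have "a \<in> Z #> b" using that rcos_self[OF cQ Z] by metis
      then obtain z where "z \<in> Z" "a = z \<otimes> b" by (auto simp: r_coset_def)
      thus ?thesis using that cQ cZ by (simp add: m_assoc)
    qed
    have "f i \<in> X" for i using powQ[OF y] by (auto simp: f_def X_def)
    moreover have "f i \<noteq> Z" for i
      using rcos_self[OF cQ[OF powQ[OF y]] Z, of i] notZ[of i] by (auto simp: f_def)
    ultimately have "f ` {..<p} \<subseteq> X - {Z}" by blast
    moreover have "Z #> \<one> \<in> X"
      unfolding X_def using subgroup.one_closed[OF Q] by (rule imageI)
    hence "Z \<in> X" using coset_mult_one[OF subgroup.subset[OF Z]] by simp
    ultimately have "card (f ` {..<p}) \<le> p - 1"
      using card_mono[of "X - {Z}" "f ` {..<p}"] fX by (simp add: cX)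
    hence "card (f ` {..<p}) < card {..<p}"
      using prime_gt_0_nat[OF p] by simp
    hence "\<not> inj_on f {..<p}" by (rule pigeonhole)
    then obtain i j where ij: "i < j" "j < p" "f i = f j"
      by (auto simp: inj_on_def) (metis linorder_neqE_nat)
    define d where "d = j - i"
    have d: "0 < d" "d < p" using ij by (auto simp: d_def)
    have step: "(\<gamma> ^^ n) a \<otimes> inv ((\<gamma> ^^ n) b) \<in> Z" if "a \<otimes> inv b \<in> Z" "a \<in> Q" "b \<in> Q" for a b n
    proof -
      have "(\<gamma> ^^ n) (inv b) = inv ((\<gamma> ^^ n) b)"
        by (induction n) (auto simp: hominv powQ[OF that(3)])
      thus ?thesis
        using powZ[OF that(1), of n] powm[of a "inv b" n] that subgroup.m_inv_closed[OF Q] by simp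
    qed
    have ij': "(\<gamma> ^^ j) y \<otimes> inv ((\<gamma> ^^ i) y) \<in> Z"
      using eqD[of "(\<gamma> ^^ j) y" "(\<gamma> ^^ i) y"] ij powQ[OF y] unfolding f_def by metis
    have dd: "(\<gamma> ^^ d) y \<otimes> inv y \<in> Z"
    proof -
      define n where "n = (p ^ k) * i - i"
      have le: "i \<le> (p ^ k) * i" using p by (simp add: prime_gt_0_nat Suc_leI)
      have "(\<gamma> ^^ n) ((\<gamma> ^^ i) y) = (\<gamma> ^^ ((p ^ k) * i)) y"
        using le by (simp add: n_def funpow_funpow)
      hence 1: "(\<gamma> ^^ n) ((\<gamma> ^^ i) y) = y" using funpow_fixed_mult[OF pow[OF y]] by metis
      have "(\<gamma> ^^ n) ((\<gamma> ^^ j) y) = (\<gamma> ^^ (d + (p ^ k) * i)) y"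
        using le ij by (simp add: n_def d_def funpow_funpow add.commute)
      hence 2: "(\<gamma> ^^ n) ((\<gamma> ^^ j) y) = (\<gamma> ^^ d) y"
        by (simp add: funpow_add funpow_fixed_mult[OF pow[OF y]])
      show ?thesis using step[OF ij' powQ[OF y] powQ[OF y], of n] 1 2 by simp
    qed
    have mulZ: "a \<otimes> inv c \<in> Z" if "a \<otimes> inv b \<in> Z" "b \<otimes> inv c \<in> Z" "a \<in> Q" "b \<in> Q" "c \<in> Q" for a b c
    proof -
      have "(a \<otimes> inv b) \<otimes> (b \<otimes> inv c) = a \<otimes> inv c"
        using that cQ by (simp add: m_assoc)
      thus ?thesis using that(1,2) Z by (metis subgroup.m_closed)
    qed
    have du: "(\<gamma> ^^ (d * u)) y \<otimes> inv y \<in> Z" for u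
    proof (induction u)
      case 0
      thus ?case using y cQ Z by (simp add: subgroup.one_closed)
    next
      case (Suc u)
      have "(\<gamma> ^^ d) ((\<gamma> ^^ (d * u)) y) \<otimes> inv ((\<gamma> ^^ d) y) \<in> Z"
        by (rule step[OF Suc powQ[OF y] y])
      from mulZ[OF this dd] show ?case using powQ y by (simp add: funpow_add)
    qed
    have "\<not> p dvd d" using d by (auto dest: dvd_imp_le)
    hence "coprime d (p ^ k)"
      using p prime_imp_coprime[of p d] by (auto simp: coprime_commute)
    hence "gcd d (p ^ k) = 1" by simp
    moreover obtain u v where "d * u = p ^ k * v + gcd d (p ^ k)"
      using d bezout_nat[of d "p ^ k"] by blast
    ultimately have "d * u = p ^ k * v + 1" by simp
    moreover have "(\<gamma> ^^ (p ^ k * v + 1)) y = \<gamma> y"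
      using funpow_fixed_mult[OF pow[OF y]] by simp
    ultimately show ?thesis using du[of u] by simp
  qed
  \<comment> \<open>\<open>main\<close> speaks of the quotient on the other side. Since
    \<open>Z\<close> is not known to be normal, the sides are exchanged by applying it to
    \<open>inv y\<close> and inverting.\<close>
  have "\<gamma> (inv y) \<otimes> inv (inv y) \<in> Z" using main y Q by (simp add: subgroup.m_inv_closed)
  hence "inv (\<gamma> (inv y) \<otimes> inv (inv y)) \<in> Z" using Z by (simp add: subgroup.m_inv_closed)
  thus ?thesis using y cQ \<gamma>Q hominv by (simp add: inv_mult_group)
qed

end

section \<open>Finite p-groups\<close>

text \<open>Cauchy's theorem, here Sylow's theorem with exponent 1: a prime divisor \<open>q\<close>
  of the order gives a nontrivial element whose order divides \<open>q\<close> and also a power of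
  \<open>p\<close>.\<close>

lemma (in group) order_prime_power_if:
  assumes fin: "finite (carrier G)" and p: "Factorial_Ring.prime p"
    and pow: "\<And>x. x \<in> carrier G \<Longrightarrow> \<exists>k. x [^] (p ^ k) = \<one>"
  shows "\<exists>n. order G = p ^ n"
proof -
  have pos: "order G \<noteq> 0" using fin by (simp add: order_gt_0_iff_finite[symmetric])
  have "q = p" if q: "Factorial_Ring.prime q" "q dvd order G" for q
  proof (rule ccontr)
    assume "q \<noteq> p"
    obtain m where "order G = q ^ 1 * m" using q by auto
    from sylow_thm[OF q(1) group_axioms this fin] obtain H where H: "subgroup H G" "card H = q"
      by auto
    have "1 < card H" using H q prime_gt_1_nat by simp
    then obtain x where x: "x \<in> H" "x \<noteq> \<one>"
      by (metis card.empty card.insert_remove card_1_singleton_iff is_singletonI' is_singleton_altdef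
          less_irrefl not_less_zero all_not_in_conv)
    have cx: "x \<in> carrier G" using H x by (simp add: subgroup.mem_carrier)
    interpret H: group "G\<lparr>carrier := H\<rparr>" using H(1) by (rule subgroup_imp_group)
    have "x [^]\<^bsub>G\<lparr>carrier := H\<rparr>\<^esub> q = \<one>"
      using H.pow_order_eq_1[of x] x H by (simp add: order_def)
    hence "ord x dvd q" using cx by (simp add: pow_eq_id flip: nat_pow_consistent)
    moreover obtain k where "ord x dvd p ^ k" using pow[OF cx] cx by (auto simp: pow_eq_id)
    moreover have "coprime q (p ^ k)"
      using q p \<open>q \<noteq> p\<close> by (simp add: primes_coprime)
    ultimately have "ord x = 1" by (metis coprime_common_divisor_nat)
    thus False using x cx pow_ord_eq_1[OF cx] by simp
  qed
  hence "multiplicity q (order G) = 0" if "Factorial_Ring.prime q" "q \<noteq> p" for q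
    using that not_dvd_imp_multiplicity_0 by blast
  hence "prime_factorization (order G) = replicate_mset (multiplicity p (order G)) p"
    using p pos by (intro multiset_eqI)
      (auto simp: count_prime_factorization)
  hence "order G = p ^ multiplicity p (order G)"
    using prod_mset_prime_factorization_nat[of "order G"] pos by simp
  thus ?thesis by blast
qed

text \<open>Some Sylow subgroup consists of p-elements, hence lies in \<open>H\<close>, and
  \<open>H\<close> is itself a p-group. The test works only for normal Sylow subgroups, which is why
  conjugates of \<open>E\<close> are treated apart in \<open>sylow_conjugate_of_E\<close>.\<close>

lemma (in group) sylow_subgroupI:
  assumes fin: "finite (carrier G)" and p: "Factorial_Ring.prime p" and H: "subgroup H G"
    and pH: "\<And>x. x \<in> H \<Longrightarrow> \<exists>k. x [^] (p ^ k) = \<one>"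
    and all: "\<And>x k. x \<in> carrier G \<Longrightarrow> x [^] (p ^ k) = \<one> \<Longrightarrow> x \<in> H"
  shows "sylow_subgroup p H G"
proof -
  interpret H: group "G\<lparr>carrier := H\<rparr>" using H by (rule subgroup_imp_group)
  have finH: "finite H" using H fin by (rule finite_subgroup)
  have "\<exists>n. order (G\<lparr>carrier := H\<rparr>) = p ^ n"
    using finH p pH by (intro H.order_prime_power_if) (auto simp flip: nat_pow_consistent)
  then obtain n where n: "card H = p ^ n" by (auto simp: order_def)
  have pos: "order G \<noteq> 0" using fin by (simp add: order_gt_0_iff_finite[symmetric])
  have "card H dvd order G" using lagrange[OF H] by (metis dvd_triv_right)
  hence 1: "n \<le> multiplicity p (order G)"
    using n pos p by (metis multiplicity_geI not_prime_unit)
  obtain m where "order G = p ^ multiplicity p (order G) * m"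
    using multiplicity_dvd by blast
  from sylow_thm[OF p group_axioms this fin] obtain U
    where U: "subgroup U G" "card U = p ^ multiplicity p (order G)" by auto
  interpret U: group "G\<lparr>carrier := U\<rparr>" using U(1) by (rule subgroup_imp_group)
  have "U \<subseteq> H"
  proof
    fix x assume x: "x \<in> U"
    have "x [^]\<^bsub>G\<lparr>carrier := U\<rparr>\<^esub> (p ^ multiplicity p (order G)) = \<one>"
      using U.pow_order_eq_1[of x] x U by (simp add: order_def)
    thus "x \<in> H" using all[of x] U x by (simp add: subgroup.mem_carrier flip: nat_pow_consistent)
  qed
  hence "card U \<le> card H" using finH by (simp add: card_mono)
  hence "card H = p ^ multiplicity p (order G)"
    using 1 n U power_increasing[OF 1, of p] prime_ge_1_nat[OF p] by simp
  thus ?thesis using H by (simp add: sylow_subgroup_def)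
qed

lemma (in group) sylow_subgroup_maximal:
  assumes fin: "finite (carrier G)" and p: "Factorial_Ring.prime p"
    and H: "sylow_subgroup p H G" and C: "subgroup C G" "H \<subseteq> C"
    and pow: "\<And>x. x \<in> C \<Longrightarrow> \<exists>k. x [^] (p ^ k) = \<one>"
  shows "C = H"
proof -
  interpret C: group "G\<lparr>carrier := C\<rparr>" using C(1) by (rule subgroup_imp_group)
  have finC: "finite C" using C(1) fin by (rule finite_subgroup)
  have "\<exists>n. order (G\<lparr>carrier := C\<rparr>) = p ^ n"
    using finC p pow by (intro C.order_prime_power_if) (auto simp flip: nat_pow_consistent)
  then obtain n where n: "card C = p ^ n" by (auto simp: order_def)
  have pos: "order G \<noteq> 0" using fin by (simp add: order_gt_0_iff_finite[symmetric])
  have "card C dvd order G" using lagrange[OF C(1)] by (metis dvd_triv_right)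
  hence "n \<le> multiplicity p (order G)"
    using n pos p by (metis multiplicity_geI not_prime_unit)
  hence "card C \<le> card H"
    using n H prime_ge_1_nat[OF p] by (simp add: sylow_subgroup_def power_increasing)
  thus ?thesis using C(2) finC by (metis card_seteq)
qed

lemma (in p_group) subgroup_card_prime_power: "subgroup H G \<Longrightarrow> \<exists>n. card H = p ^ n"
  using lagrange[of H] order_prime_power divides_primepow_nat[OF prime_p]
  by (metis dvd_triv_right)

lemma (in p_group) pow_order_p: "\<exists>k. \<forall>x\<in>carrier G. x [^] (p ^ k) = \<one>"
  using order_prime_power pow_order_eq_1 finite_carrier by metis

lemma (in p_group) p_group_subgroup: "subgroup H G \<Longrightarrow> p_group p (G\<lparr>carrier := H\<rparr>)"
  using subgroup_card_prime_power[of H] finite_subgroup[OF _ finite_carrier] prime_p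
  by (simp add: p_group_def p_group_axioms_def subgroup_imp_group order_def)

text \<open>The class equation modulo \<open>p\<close>: with a trivial centre, every conjugacy class
  other than that of \<open>\<one>\<close> would have size divisible by \<open>p\<close>.\<close>

lemma (in p_group) nontrivial_centre:
  assumes "carrier G \<noteq> {\<one>}"
  shows "\<exists>z\<in>carrier G. z \<noteq> \<one> \<and> (\<forall>x\<in>carrier G. x \<otimes> z = z \<otimes> x)"
proof (rule ccontr)
  assume neg: "\<not> ?thesis"
  define \<phi> where "\<phi> = (\<lambda>g. (\<lambda>h \<in> carrier G. g \<otimes> h \<otimes> (inv g)))"
  interpret A: group_action G "carrier G" \<phi>
    unfolding \<phi>_def by (rule action_by_conjugation)
  have one: "orbit G \<phi> \<one> = {\<one>}"
    by (auto simp: orbit_def \<phi>_def intro!: exI[of _ \<one>])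
  have div: "p dvd card Orb" if Orb: "Orb \<in> orbits G (carrier G) \<phi>" "Orb \<noteq> {\<one>}" for Orb
  proof -
    obtain x where x: "x \<in> carrier G" "Orb = orbit G \<phi> x" using Orb by (auto simp: orbits_def)
    have "x \<noteq> \<one>" using that x one by auto
    then obtain g where g: "g \<in> carrier G" "g \<otimes> x \<noteq> x \<otimes> g" using neg x by blast
    have "card Orb dvd order G" using A.orbit_stabilizer_theorem[OF x(1)] x(2) by (metis dvd_triv_left)
    then obtain i where i: "card Orb = p ^ i"
      using order_prime_power divides_primepow_nat[OF prime_p] by metis
    have "x \<in> Orb" using A.orbit_refl[OF x(1)] x by simp
    moreover have "\<phi> g x \<in> Orb" using g x by (auto simp: orbit_def)
    moreover have "\<phi> g x \<noteq> x" using g x by (auto simp: \<phi>_def inv_solve_right')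
    ultimately have "card Orb \<noteq> 1" by (auto simp: card_1_singleton_iff)
    hence "i \<noteq> 0" using i by (cases i) auto
    thus ?thesis using i by simp
  qed
  have finO: "finite (orbits G (carrier G) \<phi>)"
    using finite_carrier by (simp add: orbits_def)
  have mem: "{\<one>} \<in> orbits G (carrier G) \<phi>" using one by (auto simp: orbits_def)
  have "order G = (\<Sum>Orb\<in>orbits G (carrier G) \<phi>. card Orb)"
    using A.disjoint_sum[OF finite_carrier, of "\<lambda>_. 1 :: nat"] by (simp add: order_def)
  also have "\<dots> = 1 + (\<Sum>Orb\<in>orbits G (carrier G) \<phi> - {{\<one>}}. card Orb)"
    using sum.remove[OF finO mem, of card] by simp
  finally have sum: "order G = 1 + (\<Sum>Orb\<in>orbits G (carrier G) \<phi> - {{\<one>}}. card Orb)" .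
  have "p dvd (\<Sum>Orb\<in>orbits G (carrier G) \<phi> - {{\<one>}}. card Orb)"
    by (rule dvd_sum) (use div in blast)
  moreover have "p dvd order G"
  proof -
    obtain n where n: "order G = p ^ n" using order_prime_power by blast
    have "order G \<noteq> 1"
      using assms by (metis card_1_singletonE one_closed order_def singletonD)
    thus ?thesis using n by (cases n) auto
  qed
  ultimately have "p dvd 1" using sum by (metis dvd_add_left_iff)
  thus False using prime_p by simp
qed

section \<open>Relative centres and the tower of normalizers\<close>

context group
begin

lemma normal_cj: "Z \<lhd> G \<Longrightarrow> x \<in> carrier G \<Longrightarrow> z \<in> Z \<Longrightarrow> cj G x z \<in> Z"
  by (simp add: cj_def normal.inv_op_closed1)

lemma normalI_cj:
  assumes "subgroup Z G" "\<And>x z. x \<in> carrier G \<Longrightarrow> z \<in> Z \<Longrightarrow> cj G x z \<in> Z"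
  shows "Z \<lhd> G"
  unfolding normal_inv_iff
proof (intro conjI ballI)
  fix x h assume xh: "x \<in> carrier G" "h \<in> Z"
  show "x \<otimes> h \<otimes> inv x \<in> Z"
    using assms(2)[of "inv x" h] xh by (simp add: cj_def)
qed (fact assms(1))

text \<open>The equalizer of two homomorphisms modulo \<open>Z\<close>. Asking only that the image
  of \<open>f\<close> normalizes \<open>Z\<close> lets one proof serve both
  \<open>Z = {\<one>}\<close>, for plain equalizers, and a normal \<open>Z\<close> with
  \<open>f\<close> the identity, for fixed points modulo \<open>Z\<close>.\<close>

lemma subgroup_agree:
  assumes Q: "subgroup Q G" and Z: "subgroup Z G"
    and f: "\<And>x. x \<in> Q \<Longrightarrow> f x \<in> carrier G" "\<And>x y. x \<in> Q \<Longrightarrow> y \<in> Q \<Longrightarrow> f (x \<otimes> y) = f x \<otimes> f y"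
    and g: "\<And>x. x \<in> Q \<Longrightarrow> g x \<in> carrier G" "\<And>x y. x \<in> Q \<Longrightarrow> y \<in> Q \<Longrightarrow> g (x \<otimes> y) = g x \<otimes> g y"
    and norm: "\<And>x z. x \<in> Q \<Longrightarrow> z \<in> Z \<Longrightarrow> cj G (f x) z \<in> Z"
  shows "subgroup {x \<in> Q. inv (f x) \<otimes> g x \<in> Z} G"
proof -
  note cQ = subgroup.mem_carrier[OF Q] and cZ = subgroup.mem_carrier[OF Z]
  have one: "h \<one> = \<one>" and hinv: "\<And>x. x \<in> Q \<Longrightarrow> h (inv x) = inv (h x)"
    if h: "\<And>x. x \<in> Q \<Longrightarrow> h x \<in> carrier G" "\<And>x y. x \<in> Q \<Longrightarrow> y \<in> Q \<Longrightarrow> h (x \<otimes> y) = h x \<otimes> h y" for h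
  proof -
    show 1: "h \<one> = \<one>"
      using h(2)[of \<one> \<one>] h(1)[of \<one>] subgroup.one_closed[OF Q] by simp
    fix x assume x: "x \<in> Q"
    thus "h (inv x) = inv (h x)"
      using h(2)[of "inv x" x] h(1) 1 cQ subgroup.m_inv_closed[OF Q]
      by (metis inv_equality l_inv)
  qed
  show ?thesis
  proof (rule subgroupI)
    show "{x \<in> Q. inv (f x) \<otimes> g x \<in> Z} \<subseteq> carrier G" using cQ by auto
    show "{x \<in> Q. inv (f x) \<otimes> g x \<in> Z} \<noteq> {}"
      using one[OF f] one[OF g] subgroup.one_closed[OF Q] subgroup.one_closed[OF Z]
      by (auto intro!: exI[of _ \<one>])
  next
    fix x assume "x \<in> {x \<in> Q. inv (f x) \<otimes> g x \<in> Z}"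
    hence x: "x \<in> Q" "inv (f x) \<otimes> g x \<in> Z" by auto
    have i: "inv x \<in> Q" using x Q by (simp add: subgroup.m_inv_closed)
    have "cj G (f (inv x)) (inv (inv (f x) \<otimes> g x)) \<in> Z"
      using norm[OF i] x Z by (simp add: subgroup.m_inv_closed)
    also have "cj G (f (inv x)) (inv (inv (f x) \<otimes> g x)) = inv (f (inv x)) \<otimes> g (inv x)"
      using x hinv[OF f x(1)] hinv[OF g x(1)] f(1)[OF x(1)] g(1)[OF x(1)]
      by (simp add: cj_def inv_mult_group m_assoc)
    finally show "inv x \<in> {x \<in> Q. inv (f x) \<otimes> g x \<in> Z}" using i by simp
  next
    fix x y assume "x \<in> {x \<in> Q. inv (f x) \<otimes> g x \<in> Z}" "y \<in> {x \<in> Q. inv (f x) \<otimes> g x \<in> Z}"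
    hence x: "x \<in> Q" "inv (f x) \<otimes> g x \<in> Z" and y: "y \<in> Q" "inv (f y) \<otimes> g y \<in> Z" by auto
    have "cj G (f y) (inv (f x) \<otimes> g x) \<otimes> (inv (f y) \<otimes> g y) \<in> Z"
      using norm[OF y(1) x(2)] y(2) Z by (simp add: subgroup.m_closed)
    also have "cj G (f y) (inv (f x) \<otimes> g x) \<otimes> (inv (f y) \<otimes> g y) = inv (f (x \<otimes> y)) \<otimes> g (x \<otimes> y)"
      using f(2)[OF x(1) y(1)] g(2)[OF x(1) y(1)] f(1)[OF x(1)] f(1)[OF y(1)] g(1)[OF x(1)] g(1)[OF y(1)]
      by (simp add: cj_def inv_mult_group m_assoc)
    finally show "x \<otimes> y \<in> {x \<in> Q. inv (f x) \<otimes> g x \<in> Z}"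
      using x y Q by (simp add: subgroup.m_closed)
  qed
qed

lemma subgroup_equalizer:
  assumes Q: "subgroup Q G"
    and f: "\<And>x. x \<in> Q \<Longrightarrow> f x \<in> carrier G" "\<And>x y. x \<in> Q \<Longrightarrow> y \<in> Q \<Longrightarrow> f (x \<otimes> y) = f x \<otimes> f y"
    and g: "\<And>x. x \<in> Q \<Longrightarrow> g x \<in> carrier G" "\<And>x y. x \<in> Q \<Longrightarrow> y \<in> Q \<Longrightarrow> g (x \<otimes> y) = g x \<otimes> g y"
  shows "subgroup {x \<in> Q. f x = g x} G"
proof -
  have "subgroup {x \<in> Q. inv (f x) \<otimes> g x \<in> {\<one>}} G"
    by (rule subgroup_agree[OF Q triv_subgroup]) (use f g in auto)
  moreover have "inv (f x) \<otimes> g x = \<one> \<longleftrightarrow> f x = g x" if "x \<in> Q" for x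
    using f(1)[OF that] g(1)[OF that] by (metis inv_equality inv_inv l_inv inv_closed)
  ultimately show ?thesis by (simp cong: conj_cong)
qed

lemma subgroup_fixed_mod:
  assumes "Z \<lhd> G" "subgroup Q G" "x \<in> carrier G"
  shows "subgroup {y \<in> Q. inv y \<otimes> cj G x y \<in> Z} G"
  using assms by (intro subgroup_agree[where f = "\<lambda>x. x"])
    (auto simp: normal_imp_subgroup subgroup.mem_carrier cj_mult normal_cj)

text \<open>The preimage in \<open>G\<close> of the centre of \<open>G/Z\<close>, as
  \<open>inv y \<otimes> cj G x y\<close> is the commutator of \<open>y\<close> and
  \<open>x\<close>. Being a map on subsets of one group, it can be iterated to give an upper central
  series that starts at any normal subgroup.\<close>

definition rel_centre :: "'a set \<Rightarrow> 'a set" where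
  "rel_centre Z = {y \<in> carrier G. \<forall>x\<in>carrier G. inv y \<otimes> cj G x y \<in> Z}"

lemma rel_centreD: "y \<in> rel_centre Z \<Longrightarrow> x \<in> carrier G \<Longrightarrow> inv y \<otimes> cj G x y \<in> Z"
  by (simp add: rel_centre_def)

lemma subset_rel_centre: "Z \<lhd> G \<Longrightarrow> Z \<subseteq> rel_centre Z"
  using subgroup.mem_carrier[OF normal_imp_subgroup]
  by (auto simp: rel_centre_def normal_cj subgroup.m_closed subgroup.m_inv_closed
      normal_imp_subgroup)

lemma normal_rel_centre:
  assumes Z: "Z \<lhd> G" shows "rel_centre Z \<lhd> G"
proof (rule normalI_cj)
  have "subgroup (\<Inter> ((\<lambda>x. {y \<in> carrier G. inv y \<otimes> cj G x y \<in> Z}) ` carrier G)) G"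
    using subgroup_fixed_mod[OF Z subgroup_self] by (intro subgroups_Inter) auto
  moreover have "\<Inter> ((\<lambda>x. {y \<in> carrier G. inv y \<otimes> cj G x y \<in> Z}) ` carrier G) = rel_centre Z"
    by (auto simp: rel_centre_def)
  ultimately show sub: "subgroup (rel_centre Z) G" by simp
  fix x y assume xy: "x \<in> carrier G" "y \<in> rel_centre Z"
  have "inv y \<otimes> cj G x y \<in> rel_centre Z"
    using rel_centreD[OF xy(2,1)] subset_rel_centre[OF Z] by blast
  hence "y \<otimes> (inv y \<otimes> cj G x y) \<in> rel_centre Z"
    using xy sub by (simp add: subgroup.m_closed)
  thus "cj G x y \<in> rel_centre Z"
    using xy subgroup.mem_carrier[OF sub] by simp
qed

end

text \<open>This is \<open>nontrivial_centre\<close> for the p-group \<open>G Mod Z\<close>, pulled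
  back to \<open>G\<close>.\<close>

lemma (in p_group) rel_centre_larger:
  assumes Z: "Z \<lhd> G" "Z \<noteq> carrier G"
  shows "\<exists>y\<in>rel_centre Z. y \<notin> Z"
proof -
  interpret Z: normal Z G by (fact Z(1))
  interpret F: group "G Mod Z" by (rule Z.factorgroup_is_group)
  have finF: "finite (carrier (G Mod Z))"
    using finite_carrier by (simp add: FactGroup_def RCOSETS_def)
  have lag: "order (G Mod Z) * card Z = order G"
    using lagrange[OF Z.subgroup_axioms] by (simp add: order_def FactGroup_def)
  then obtain n where "order (G Mod Z) = p ^ n"
    using order_prime_power divides_primepow_nat[OF prime_p] by (metis dvd_triv_left)
  then interpret F: p_group p "G Mod Z"
    using finF prime_p by unfold_locales auto
  have "carrier (G Mod Z) \<noteq> {\<one>\<^bsub>G Mod Z\<^esub>}"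
  proof
    assume "carrier (G Mod Z) = {\<one>\<^bsub>G Mod Z\<^esub>}"
    hence "card Z = card (carrier G)" using lag by (simp add: order_def)
    thus False using Z card_subset_eq[OF finite_carrier Z.subset] by simp
  qed
  then obtain Y where Y: "Y \<in> carrier (G Mod Z)" "Y \<noteq> \<one>\<^bsub>G Mod Z\<^esub>"
    "\<And>X. X \<in> carrier (G Mod Z) \<Longrightarrow> X \<otimes>\<^bsub>G Mod Z\<^esub> Y = Y \<otimes>\<^bsub>G Mod Z\<^esub> X"
    using F.nontrivial_centre by blast
  then obtain y where y: "y \<in> carrier G" "Y = Z #> y" by (auto simp: FactGroup_def RCOSETS_def)
  have "y \<notin> Z"
  proof
    assume "y \<in> Z"
    hence "Z #> y = Z" by (simp add: Z.rcos_const)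
    thus False using Y(2) y(2) by (simp add: FactGroup_def)
  qed
  moreover have "inv y \<otimes> cj G x y \<in> Z" if x: "x \<in> carrier G" for x
  proof -
    have "Z #> (x \<otimes> y) = Z #> (y \<otimes> x)"
      using Y(3)[of "Z #> x"] x y by (auto simp: FactGroup_def RCOSETS_def Z.rcos_sum)
    hence "x \<otimes> y \<in> Z #> (y \<otimes> x)"
      using rcos_self[of "x \<otimes> y" Z] x y Z.subgroup_axioms by simp
    then obtain z where z: "z \<in> Z" "x \<otimes> y = z \<otimes> (y \<otimes> x)" by (auto simp: r_coset_def)
    hence cz: "z \<in> carrier G" by simp
    have "inv y \<otimes> cj G x y = inv (x \<otimes> y) \<otimes> (y \<otimes> x)"
      using x y by (simp add: cj_def inv_mult_group m_assoc)
    also have "\<dots> = cj G (y \<otimes> x) (inv z)"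
      unfolding z(2) using x y cz by (simp add: cj_def inv_mult_group m_assoc)
    finally show ?thesis using normal_cj[OF Z(1)] z x y by simp
  qed
  ultimately show ?thesis using y by (auto simp: rel_centre_def)
qed

lemma (in p_group) card_mult_le:
  assumes "subgroup H G" "subgroup K G" "H \<subseteq> K" "H \<noteq> K"
  shows "p * card H \<le> card K"
proof -
  obtain a b where ab: "card H = p ^ a" "card K = p ^ b"
    using assms subgroup_card_prime_power by metis
  have "card H < card K"
    using assms finite_subgroup[OF _ finite_carrier] by (simp add: psubset_card_mono psubsetI)
  hence "a < b" using ab prime_gt_1_nat[OF prime_p] by simp
  hence "p ^ Suc a \<le> p ^ b" using prime_ge_1_nat[OF prime_p] by (intro power_increasing) auto
  thus ?thesis using ab by simp
qed

lemma (in p_group) card_intermediate: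
  assumes "subgroup Z G" "subgroup H G" "subgroup Q G" "Z \<subseteq> H" "H \<subseteq> Q" "H \<noteq> Z" "H \<noteq> Q"
    and "card Q = p ^ 2 * card Z"
  shows "card H = p * card Z" "card Q = p * card H"
proof -
  have 1: "p * card Z \<le> card H" and 2: "p * card H \<le> card Q"
    using card_mult_le assms by metis+
  have "p * card H \<le> p * (p * card Z)" using 2 assms(8) by (simp add: power2_eq_square)
  hence "card H \<le> p * card Z" using prime_gt_0_nat[OF prime_p] by simp
  thus "card H = p * card Z" using 1 by simp
  thus "card Q = p * card H" using assms(8) by (simp add: power2_eq_square)
qed

lemma (in group) funpow_cj:
  "g \<in> carrier G \<Longrightarrow> x \<in> carrier G \<Longrightarrow> (cj G g ^^ n) x = cj G (g [^] n) x"
  by (induction n) (auto simp: cj_cj)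

lemma (in p_group) funpow_cj_id:
  "\<exists>k. \<forall>g\<in>carrier G. \<forall>x\<in>carrier G. (cj G g ^^ (p ^ k)) x = x"
  using pow_order_p by (metis cj_one_left funpow_cj)

text \<open>Conjugation within a p-group has p-power order, so the preceding section's result on
  p-automorphisms applies to it.\<close>

lemma (in p_group) cj_trivial_on_prime_index:
  assumes "subgroup Z G" "subgroup Q G" "Z \<subseteq> Q" "card Q = p * card Z" "g \<in> carrier G"
    and "cj G g ` Q \<subseteq> Q" "cj G g ` Z \<subseteq> Z" "y \<in> Q"
  shows "inv y \<otimes> cj G g y \<in> Z"
proof -
  obtain k where "\<forall>g\<in>carrier G. \<forall>x\<in>carrier G. (cj G g ^^ (p ^ k)) x = x"
    using funpow_cj_id by blast
  thus ?thesis
    using assms subgroup.mem_carrier[OF assms(2)] cj_mult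
    by (intro p_automorphism_trivial_on_prime_index[OF assms(1-4) prime_p finite_carrier,
          where \<gamma> = "cj G g" and k = k]) auto
qed

lemma (in group) commutator_sym:
  assumes Z: "subgroup Z G" and "x \<in> carrier G" "y \<in> carrier G" "inv x \<otimes> cj G y x \<in> Z"
  shows "inv y \<otimes> cj G x y \<in> Z"
proof -
  have "inv y \<otimes> cj G x y = inv (inv x \<otimes> cj G y x)"
    using assms by (simp add: cj_def inv_mult_group m_assoc)
  thus ?thesis using assms by (simp add: subgroup.m_inv_closed)
qed

lemma (in group) cj_mem_of_commutator:
  assumes "subgroup Q G" "y \<in> Q" "x \<in> carrier G" "inv y \<otimes> cj G x y \<in> Q"
  shows "cj G x y \<in> Q"
proof -
  have "y \<otimes> (inv y \<otimes> cj G x y) \<in> Q" using assms by (simp add: subgroup.m_closed)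
  thus ?thesis using assms subgroup.mem_carrier[OF assms(1)] by simp
qed

lemma (in group) commutator_trivial_iff:
  assumes "x \<in> carrier G" "y \<in> carrier G"
  shows "inv y \<otimes> cj G x y = \<one> \<longleftrightarrow> cj G x y = y"
  using assms by (metis cj_closed inv_equality inv_inv l_inv inv_closed)

text \<open>Let \<open>Y\<close> be a largest normal subgroup of \<open>G\<close> inside
  \<open>Q\<close>. The normal subgroup \<open>rel_centre Y\<close> is larger, hence not inside
  \<open>Q\<close>; but it normalizes \<open>Q\<close>, because its commutators with
  \<open>G\<close> lie in \<open>Y\<close> and so in \<open>Q\<close>.\<close>

lemma (in p_group) normalizer_larger:
  assumes Q: "subgroup Q G" "Q \<noteq> carrier G"
  shows "\<exists>x\<in>normalizer G Q. x \<notin> Q"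
proof -
  define A where "A = {Y. Y \<lhd> G \<and> Y \<subseteq> Q}"
  have cQ: "Q \<subseteq> carrier G" using Q by (simp add: subgroup.subset)
  have "{\<one>} \<lhd> G" by (rule normalI_cj) (auto simp: triv_subgroup)
  hence "{\<one>} \<in> A" using Q by (auto simp: A_def subgroup.one_closed)
  then obtain Y where Y: "Y \<in> A" "\<forall>Y'. Y' \<in> A \<longrightarrow> card Y' \<le> card Y"
    using ex_has_greatest_nat[of "\<lambda>Y. Y \<in> A" "{\<one>}" card "Suc (card Q)"]
      card_mono[OF finite_subgroup[OF Q(1) finite_carrier]]
    by (auto simp: A_def less_Suc_eq_le)
  have nY: "Y \<lhd> G" "Y \<subseteq> Q" using Y by (auto simp: A_def)
  have "Y \<noteq> carrier G" using nY Q cQ by blast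
  then obtain y where y: "y \<in> rel_centre Y" "y \<notin> Y" using rel_centre_larger nY by blast
  have nR: "rel_centre Y \<lhd> G" using nY by (simp add: normal_rel_centre)
  have "Y \<subset> rel_centre Y" using subset_rel_centre[OF nY(1)] y by blast
  hence "card Y < card (rel_centre Y)"
    using finite_subgroup[OF normal_imp_subgroup[OF nR] finite_carrier] by (simp add: psubset_card_mono)
  hence "\<not> rel_centre Y \<subseteq> Q" using Y nR by (auto simp: A_def not_le[symmetric])
  then obtain x where x: "x \<in> rel_centre Y" "x \<notin> Q" by blast
  have cx: "x \<in> carrier G" using x by (simp add: rel_centre_def)
  have "cj G x q \<in> Q" if q: "q \<in> Q" for q
  proof -
    have "inv x \<otimes> cj G q x \<in> Y" using x q cQ by (intro rel_centreD) auto
    hence "inv q \<otimes> cj G x q \<in> Y" using commutator_sym[OF normal_imp_subgroup[OF nY(1)] cx] q cQ by blast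
    thus ?thesis using cj_mem_of_commutator[OF Q(1) q cx] nY by blast
  qed
  hence "x \<in> normalizer G Q"
    using mem_normalizerI[OF finite_subgroup[OF Q(1) finite_carrier] cQ cx] by blast
  thus ?thesis using x by blast
qed

section \<open>Self-centralizing sections of order \<open>p\<^sup>2\<close> and their
  normalizers\<close>

context p_group
begin

text \<open>\<open>sc_pair Z Q\<close> says that \<open>Q/Z\<close> is a self-centralizing subgroup of order \<open>p\<^sup>2\<close> of \<open>G/Z\<close>.\<close>

definition sc_pair :: "'a set \<Rightarrow> 'a set \<Rightarrow> bool" where
  "sc_pair Z Q \<longleftrightarrow> Z \<lhd> G \<and> subgroup Q G \<and> Z \<subseteq> Q \<and> card Q = p ^ 2 * card Z \<and>
     (\<forall>x\<in>carrier G. (\<forall>y\<in>Q. inv y \<otimes> cj G x y \<in> Z) \<longrightarrow> x \<in> Q)"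

lemma sc_pairD:
  assumes "sc_pair Z Q"
  shows "Z \<lhd> G" "subgroup Z G" "subgroup Q G" "Z \<subseteq> Q" "card Q = p ^ 2 * card Z"
    "\<And>x. x \<in> carrier G \<Longrightarrow> (\<And>y. y \<in> Q \<Longrightarrow> inv y \<otimes> cj G x y \<in> Z) \<Longrightarrow> x \<in> Q"
  using assms by (auto simp: sc_pair_def normal_imp_subgroup)

text \<open>The centre of \<open>G/Z\<close> is nontrivial and lies in every self-centralizing
  subgroup. It is not all of \<open>Q/Z\<close>: otherwise everything would centralize
  \<open>Q/Z\<close> and so lie in \<open>Q\<close>. Between 1 and \<open>p\<^sup>2\<close> only the
  order \<open>p\<close> remains.\<close>

lemma sc_pair_rel_centre:
  assumes pr: "sc_pair Z Q" and ne: "Q \<noteq> carrier G"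
  shows "rel_centre Z \<subseteq> Q" "card (rel_centre Z) = p * card Z" "card Q = p * card (rel_centre Z)"
proof -
  note d = sc_pairD[OF pr]
  have nR: "rel_centre Z \<lhd> G" using d by (simp add: normal_rel_centre)
  note sR = normal_imp_subgroup[OF nR]
  have cQ: "Q \<subseteq> carrier G" using d by (simp add: subgroup.subset)
  show sub: "rel_centre Z \<subseteq> Q"
  proof
    fix x assume x: "x \<in> rel_centre Z"
    have cx: "x \<in> carrier G" using x by (simp add: rel_centre_def)
    show "x \<in> Q"
      using d(6)[OF cx] commutator_sym[OF d(2) cx] rel_centreD[OF x] cQ by blast
  qed
  have "Z \<noteq> carrier G" using ne d(4) cQ by blast
  hence "rel_centre Z \<noteq> Z" using rel_centre_larger[OF d(1)] by blast
  moreover have "rel_centre Z \<noteq> Q"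
  proof
    assume "rel_centre Z = Q"
    hence "x \<in> Q" if "x \<in> carrier G" for x
      using d(6)[OF that] rel_centreD that by blast
    thus False using ne cQ by blast
  qed
  ultimately show "card (rel_centre Z) = p * card Z" "card Q = p * card (rel_centre Z)"
    using card_intermediate[OF d(2) sR d(3) subset_rel_centre[OF d(1)] sub _ _ d(5)] by blast+
qed

text \<open>For \<open>y \<in> Q - rel_centre Z\<close> the commutator map \<open>n \<mapsto> [y, n]\<close> embeds \<open>N\<^sub>G(Q)/Q\<close> into
  \<open>rel_centre Z / Z\<close>, which has order \<open>p\<close>; so the normalizer grows by a factor \<open>p\<close> exactly.\<close>

lemma sc_pair_step:
  assumes pr: "sc_pair Z Q" and ne: "Q \<noteq> carrier G"
  shows "sc_pair (rel_centre Z) (normalizer G Q)"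
    and "card (normalizer G Q) = p * card Q"
    and "\<And>n y. n \<in> normalizer G Q \<Longrightarrow> y \<in> Q \<Longrightarrow> inv y \<otimes> cj G n y \<in> rel_centre Z"
    and "\<And>y z. y \<in> Q \<Longrightarrow> y \<notin> rel_centre Z \<Longrightarrow> z \<in> rel_centre Z \<Longrightarrow>
           \<exists>n\<in>normalizer G Q. inv (y \<otimes> z) \<otimes> cj G n y \<in> Z"
proof -
  note d = sc_pairD[OF pr]
  define R where "R = rel_centre Z"
  define N where "N = normalizer G Q"
  have nR: "R \<lhd> G" using d by (simp add: normal_rel_centre R_def)
  note sR = normal_imp_subgroup[OF nR]
  have cQ: "Q \<subseteq> carrier G" using d by (simp add: subgroup.subset)
  have sN: "subgroup N G" using cQ by (simp add: N_def subgroup_normalizer)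
  have QN: "Q \<subseteq> N" using d by (simp add: N_def subset_normalizer)
  have Nmem: "n \<in> N \<longleftrightarrow> n \<in> carrier G \<and> cj G n ` Q = Q" for n
    unfolding N_def by (rule mem_normalizer_iff[OF cQ])
  have RQ: "R \<subseteq> Q" and cardR: "card R = p * card Z" and cardQ: "card Q = p * card R"
    using sc_pair_rel_centre[OF pr ne] by (simp_all add: R_def)
  have ZR: "Z \<subseteq> R" using subset_rel_centre d by (simp add: R_def)
  note cR = subgroup.mem_carrier[OF sR] and cZ = subgroup.mem_carrier[OF d(2)]
  have N_ne: "N \<noteq> Q" using normalizer_larger[OF d(3) ne] by (auto simp: N_def)
  have act: "inv y \<otimes> cj G n y \<in> R" if "n \<in> N" "y \<in> Q" for n y
    using that Nmem by (intro cj_trivial_on_prime_index[OF sR d(3) RQ cardQ]) (auto intro: normal_cj[OF nR])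
  have main: "card N = p * card Q \<and> (\<forall>z\<in>R. \<exists>n\<in>N. inv (y \<otimes> z) \<otimes> cj G n y \<in> Z)"
    if y: "y \<in> Q" "y \<notin> R" for y
  proof -
    have cy: "y \<in> carrier G" using y cQ by blast
    define f where "f n = Z #> (inv y \<otimes> cj G n y)" for n
    define A where "A = (\<lambda>x. Z #> x) ` R"
    have "card A * card Z = card R"
      unfolding A_def by (rule card_rcosets_times_card[OF d(2) sR ZR])
    hence cardA: "card A = p"
      using cardR subgroup.finite_imp_card_positive[OF d(2) finite_carrier] by simp
    have finA: "finite A" using finite_subgroup[OF sR finite_carrier] by (simp add: A_def)
    have sub: "f ` N \<subseteq> A" using act y by (auto simp: f_def A_def)
    have coset: "\<exists>z\<in>Z. a = z \<otimes> b" if "Z #> a = Z #> b" "a \<in> carrier G" for a b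
      using rcos_self[OF that(2) d(2)] that(1) by (auto simp: r_coset_def)
    have "card N \<le> card (f ` N) * card Q"
    proof (rule card_le_image_times_fibre[OF sN d(3) finite_carrier])
      fix n n' assume n: "n \<in> N" "n' \<in> N" "f n = f n'"
      have cn: "n \<in> carrier G" "n' \<in> carrier G" using n Nmem by auto
      define w where "w = n \<otimes> inv n'"
      have cw: "w \<in> carrier G" using cn by (simp add: w_def)
      obtain z where z: "z \<in> Z" "inv y \<otimes> cj G n y = z \<otimes> (inv y \<otimes> cj G n' y)"
        using coset[OF n(3)[unfolded f_def]] cn cy by auto
      have c: "z \<in> carrier G" using z cZ by simp
      have "cj G n y = y \<otimes> (inv y \<otimes> cj G n y)" using cy cn by simp
      also have "\<dots> = cj G (inv y) z \<otimes> cj G n' y"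
        unfolding z(2) using cy cn c by (simp add: cj_def m_assoc)
      finally have eq: "cj G n y = cj G (inv y) z \<otimes> cj G n' y" .
      define c where "c = cj G (inv n') (cj G (inv y) z)"
      have cc: "c \<in> carrier G" using cn cy \<open>z \<in> carrier G\<close> by (simp add: c_def)
      have "cj G w y = cj G (inv n') (cj G n y)"
        using cn cy by (simp add: w_def cj_cj)
      also have "\<dots> = c \<otimes> y"
        unfolding eq using cn cy \<open>z \<in> carrier G\<close> by (simp add: c_def cj_mult)
      finally have "inv y \<otimes> cj G w y = cj G y c"
        using cy cc by (simp add: cj_def m_assoc)
      also have "\<dots> \<in> Z" using z cn cy by (simp add: c_def normal_cj[OF d(1)])
      finally have yw: "inv y \<otimes> cj G w y \<in> Z" .
      \<comment> \<open>\<open>w\<close> centralizes \<open>R\<close> and \<open>y\<close> modulo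
        \<open>Z\<close>, hence all of \<open>Q\<close>, and self-centralization puts it into
        \<open>Q\<close>.\<close>
      define H where "H = {q \<in> Q. inv q \<otimes> cj G w q \<in> Z}"
      have "subgroup H G" unfolding H_def by (rule subgroup_fixed_mod[OF d(1,3) cw])
      moreover have "R \<subseteq> H" using RQ cw by (auto simp: H_def R_def rel_centreD)
      ultimately have "H = Q"
        using prime_index_eq[OF sR _ d(3) _ _ cardQ prime_p finite_carrier, of H y] yw y
        by (auto simp: H_def)
      thus "n \<otimes> inv n' \<in> Q" using d(6)[OF cw] by (auto simp: H_def w_def)
    qed
    moreover have "p * card Q \<le> card N" using card_mult_le[OF d(3) sN QN] N_ne by simp
    moreover have fp: "card (f ` N) \<le> p" using card_mono[OF finA sub] cardA by simp
    hence "card (f ` N) * card Q \<le> p * card Q" by (rule mult_le_mono1)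
    ultimately have cardN: "card N = p * card Q" and "p * card Q \<le> card (f ` N) * card Q"
      by linarith+
    moreover have "0 < card Q" using subgroup.finite_imp_card_positive[OF d(3) finite_carrier] .
    \<comment> \<open>Equality in the count has a second use: all \<open>p\<close> cosets occur as
      values of \<open>f\<close>, which is the transitivity stated in the last claim.\<close>
    ultimately have "card (f ` N) = p" using fp by simp
    hence fN: "f ` N = A" using card_subset_eq[OF finA sub] cardA by simp
    have "\<exists>n\<in>N. inv (y \<otimes> z) \<otimes> cj G n y \<in> Z" if z: "z \<in> R" for z
    proof -
      have "Z #> z \<in> f ` N" using z fN by (auto simp: A_def)
      then obtain n where n: "n \<in> N" "Z #> (inv y \<otimes> cj G n y) = Z #> z" by (auto simp: f_def)
      have cn: "n \<in> carrier G" using n Nmem by auto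
      obtain z' where z': "z' \<in> Z" "inv y \<otimes> cj G n y = z' \<otimes> z"
        using coset[OF n(2)] cn cy by auto
      have "inv (y \<otimes> z) \<otimes> cj G n y = inv z \<otimes> (inv y \<otimes> cj G n y)"
        using cy cn cR[OF z] by (simp add: inv_mult_group m_assoc)
      also have "\<dots> = cj G z z'" unfolding z'(2) using cR[OF z] cZ[OF z'(1)] by (simp add: cj_def m_assoc)
      finally have "inv (y \<otimes> z) \<otimes> cj G n y \<in> Z"
        using normal_cj[OF d(1) cR[OF z] z'(1)] by simp
      thus ?thesis using n(1) by (rule bexI)
    qed
    thus ?thesis using cardN by blast
  qed
  have "card R \<noteq> card Q"
    using cardQ prime_gt_1_nat[OF prime_p] subgroup.finite_imp_card_positive[OF sR finite_carrier] by simp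
  hence "R \<noteq> Q" by auto
  with RQ have "\<exists>y\<in>Q. y \<notin> R" by auto
  hence cardN: "card N = p * card Q" using main by blast
  have "sc_pair R N"
    unfolding sc_pair_def
  proof (intro conjI ballI impI)
    show "card N = p ^ 2 * card R" using cardN cardQ by (simp add: power2_eq_square)
    show "R \<subseteq> N" using RQ QN by blast
    fix x assume x: "x \<in> carrier G" "\<forall>y\<in>N. inv y \<otimes> cj G x y \<in> R"
    \<comment> \<open>Self-centralization of the next pair: an element centralizing
      \<open>N\<close>, and hence \<open>Q\<close>, modulo \<open>R\<close> moves elements of
      \<open>Q\<close> only by factors from \<open>R \<subseteq> Q\<close>, so it normalizes
      \<open>Q\<close>.\<close>
    have "cj G x y \<in> Q" if "y \<in> Q" for y
      using cj_mem_of_commutator[OF d(3) that x(1)] x(2) that QN RQ by blast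
    thus "x \<in> N"
      unfolding N_def using mem_normalizerI[OF finite_subgroup[OF d(3) finite_carrier] cQ x(1)] by blast
  qed (use nR sN in auto)
  thus "sc_pair (rel_centre Z) (normalizer G Q)" by (simp add: R_def N_def)
  show "card (normalizer G Q) = p * card Q" using cardN by (simp add: N_def)
  show "\<And>n y. n \<in> normalizer G Q \<Longrightarrow> y \<in> Q \<Longrightarrow> inv y \<otimes> cj G n y \<in> rel_centre Z"
    using act by (simp add: N_def R_def)
  show "\<And>y z. y \<in> Q \<Longrightarrow> y \<notin> rel_centre Z \<Longrightarrow> z \<in> rel_centre Z \<Longrightarrow>
           \<exists>n\<in>normalizer G Q. inv (y \<otimes> z) \<otimes> cj G n y \<in> Z"
    using main by (simp add: N_def R_def)
qed

lemma normalizer_tower: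
  assumes "sc_pair Z E" "order G = p ^ m * card E" "j \<le> m"
  shows "sc_pair ((rel_centre ^^ j) Z) (iter_normalizer G E j) \<and>
    card (iter_normalizer G E j) = p ^ j * card E"
  using assms(3)
proof (induction j)
  case 0
  thus ?case using assms by simp
next
  case (Suc j)
  hence IH: "sc_pair ((rel_centre ^^ j) Z) (iter_normalizer G E j)"
    "card (iter_normalizer G E j) = p ^ j * card E" by auto
  have "0 < card E"
    using sc_pairD(3)[OF assms(1)] subgroup.finite_imp_card_positive finite_carrier by metis
  moreover have "p ^ j < p ^ m" using Suc.prems prime_gt_1_nat[OF prime_p] by simp
  ultimately have "card (iter_normalizer G E j) < order G" using IH(2) assms(2) by simp
  hence "iter_normalizer G E j \<noteq> carrier G" by (auto simp: order_def)
  from sc_pair_step(1,2)[OF IH(1) this] show ?case using IH(2) by simp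
qed

section \<open>The base of the tower for the two shapes of \<open>E\<close>\<close>

lemma mem_rel_centre_one:
  "z \<in> rel_centre {\<one>} \<longleftrightarrow> z \<in> carrier G \<and> (\<forall>x\<in>carrier G. cj G x z = z)"
  unfolding rel_centre_def using commutator_trivial_iff by auto

text \<open>A group of order \<open>p\<^sup>2\<close> is abelian, read in \<open>G/Z\<close>: were
  its centre of order \<open>p\<close>, an element outside would commute with the centre and with
  itself, hence with everything.\<close>

lemma commutator_in_index_p2:
  assumes Z: "Z \<lhd> G" and card: "order G = p ^ 2 * card Z" and x: "x \<in> carrier G" and y: "y \<in> carrier G"
  shows "inv y \<otimes> cj G x y \<in> Z"
proof -
  define R where "R = rel_centre Z"
  note sZ = normal_imp_subgroup[OF Z]
  have sR: "subgroup R G" using normal_rel_centre[OF Z] by (simp add: R_def normal_imp_subgroup)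
  have ZR: "Z \<subseteq> R" using subset_rel_centre[OF Z] by (simp add: R_def)
  have "1 < p ^ 2" using prime_gt_1_nat[OF prime_p] by (intro one_less_power) auto
  hence "Z \<noteq> carrier G"
    using card subgroup.finite_imp_card_positive[OF sZ finite_carrier] by (auto simp: order_def)
  hence RZ: "R \<noteq> Z" using rel_centre_larger[OF Z] by (auto simp: R_def)
  have "R = carrier G"
  proof (rule ccontr)
    assume ne: "R \<noteq> carrier G"
    have cG: "card (carrier G) = p * card R"
      using card_intermediate[OF sZ sR subgroup_self ZR subgroup.subset[OF sR] RZ ne] card
      by (simp add: order_def)
    obtain a where a: "a \<in> carrier G" "a \<notin> R" using ne subgroup.subset[OF sR] by blast
    define H where "H = {b \<in> carrier G. inv b \<otimes> cj G a b \<in> Z}"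
    have sH: "subgroup H G" unfolding H_def by (rule subgroup_fixed_mod[OF Z subgroup_self a(1)])
    have RH: "R \<subseteq> H" using a by (auto simp: H_def R_def rel_centreD) (auto simp: rel_centre_def)
    have "inv a \<otimes> cj G a a = \<one>" using a by (simp add: cj_def)
    hence "a \<in> H" using a subgroup.one_closed[OF sZ] by (simp add: H_def)
    hence "H = carrier G"
      using prime_index_eq[OF sR sH subgroup_self RH subgroup.subset[OF sH] cG prime_p finite_carrier] a
      by blast
    hence "inv b \<otimes> cj G a b \<in> Z" if "b \<in> carrier G" for b using that by (auto simp: H_def)
    hence "a \<in> R" using commutator_sym[OF sZ] a by (auto simp: R_def rel_centre_def)
    thus False using a by blast
  qed
  thus ?thesis using x y rel_centreD by (auto simp: R_def)
qed

text \<open>Fibres lie in cosets of \<open>L\<close>, and a proper subgroup of a p-group has index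
  at least \<open>p\<close>, so at least \<open>p\<close> values are taken. This spares the proof
  that the commutator map is a homomorphism.\<close>

lemma commutator_map_surj:
  assumes H: "subgroup H G" and L: "subgroup L G" "L \<subseteq> H" "L \<noteq> H" and A: "card A = p"
    and f: "\<And>h. h \<in> H \<Longrightarrow> f h \<in> A"
    and fibre: "\<And>h h'. h \<in> H \<Longrightarrow> h' \<in> H \<Longrightarrow> f h = f h' \<Longrightarrow> h \<otimes> inv h' \<in> L"
  shows "f ` H = A"
proof -
  have finA: "finite A" using A prime_gt_0_nat[OF prime_p] card_ge_0_finite by metis
  have sub: "f ` H \<subseteq> A" using f by blast
  have "card H \<le> card (f ` H) * card L"
    by (rule card_le_image_times_fibre[OF H L(1) finite_carrier fibre])
  moreover have "p * card L \<le> card H" by (rule card_mult_le[OF L(1) H L(2,3)])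
  ultimately have "p * card L \<le> card (f ` H) * card L" by (rule le_trans[rotated])
  hence "p \<le> card (f ` H)"
    using subgroup.finite_imp_card_positive[OF L(1) finite_carrier] by simp
  thus ?thesis using card_seteq[OF finA sub] A by simp
qed

lemma subgroup_centralizer_elem:
  assumes "subgroup E G" "w \<in> carrier G" shows "subgroup {e \<in> E. cj G e w = w} G"
proof -
  have "cj G e w = w \<longleftrightarrow> cj G w e = e" if "e \<in> E" for e
    using that assms subgroup.mem_carrier[OF assms(1) that] by (auto simp: cj_eq_self_iff)
  hence "{e \<in> E. cj G e w = w} = {e \<in> E. cj G w e = e}" by blast
  also have "subgroup \<dots> G"
    using assms subgroup.mem_carrier[OF assms(1)]
    by (intro subgroup_equalizer) (auto simp: cj_mult)
  finally show ?thesis .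
qed

text \<open>The base of the tower: \<open>Z\<close> is trivial if \<open>|E| = p\<^sup>2\<close> and the centre of \<open>E\<close> if \<open>|E| = p\<^sup>3\<close>.\<close>

definition pearl_base :: "'a set \<Rightarrow> 'a set \<Rightarrow> bool" where
  "pearl_base Z E \<longleftrightarrow> sc_pair Z E \<and> (card Z = 1 \<or> card Z = p) \<and>
     (\<forall>z\<in>Z. \<forall>x\<in>carrier G. cj G x z = z) \<and>
     (\<forall>w\<in>E - Z. \<forall>z\<in>Z. \<exists>e\<in>E. cj G e w = w \<otimes> z) \<and>
     (Z = {\<one>} \<or> (\<forall>Q. subgroup Q G \<and> E \<subseteq> Q \<longrightarrow> {x \<in> Q. \<forall>y\<in>Q. cj G y x = x} = Z))"

lemma pearl_base_abelian:
  assumes E: "subgroup E G" and cent: "centralizer G E \<subseteq> E" and card: "card E = p ^ 2"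
  shows "pearl_base {\<one>} E"
proof -
  note cE = subgroup.mem_carrier[OF E]
  have "{\<one>} \<lhd> G" by (rule normalI_cj) (auto simp: triv_subgroup)
  moreover have "x \<in> E" if "x \<in> carrier G" "\<forall>y\<in>E. inv y \<otimes> cj G x y = \<one>" for x
  proof -
    have "x \<otimes> y = y \<otimes> x" if "y \<in> E" for y
      using that \<open>x \<in> carrier G\<close> \<open>\<forall>y\<in>E. inv y \<otimes> cj G x y = \<one>\<close> commutator_trivial_iff[of x y]
        cj_eq_self_iff[of x y] cE[OF that] by auto
    thus ?thesis using that cent by (auto simp: centralizer_def)
  qed
  ultimately have "sc_pair {\<one>} E"
    using E card by (auto simp: sc_pair_def subgroup.one_closed)
  thus ?thesis
    using cE subgroup.one_closed[OF E] by (auto simp: pearl_base_def intro!: bexI[of _ \<one>])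
qed

text \<open>The centre of \<open>G\<close> is nontrivial and, since \<open>E\<close> contains its
  centralizer, lies in the centre of \<open>E\<close>. The latter has order \<open>p\<close> because
  \<open>E\<close> is non-abelian of order \<open>p\<^sup>3\<close>, so the two agree. The
  substantial point is that \<open>E/Z\<close> is self-centralizing.\<close>

lemma pearl_base_nonabelian:
  assumes E: "subgroup E G" and cent: "centralizer G E \<subseteq> E"
    and nonab: "\<not> comm_group (G\<lparr>carrier := E\<rparr>)" and card: "card E = p ^ 3"
  shows "pearl_base (rel_centre {\<one>}) E"
proof -
  note cE = subgroup.mem_carrier[OF E]
  define Z where "Z = rel_centre {\<one>}"
  define ZE where "ZE = {x \<in> E. \<forall>y\<in>E. cj G y x = x}"
  have "{\<one>} \<lhd> G" by (rule normalI_cj) (auto simp: triv_subgroup)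
  hence nZ: "Z \<lhd> G" unfolding Z_def by (rule normal_rel_centre)
  note sZ = normal_imp_subgroup[OF nZ]
  have memZ: "z \<in> Z \<longleftrightarrow> z \<in> carrier G \<and> (\<forall>x\<in>carrier G. cj G x z = z)" for z
    unfolding Z_def by (rule mem_rel_centre_one)
  have inE: "x \<in> E" if "x \<in> carrier G" "\<And>y. y \<in> E \<Longrightarrow> cj G x y = y" for x
  proof -
    have "x \<otimes> y = y \<otimes> x" if "y \<in> E" for y
      using \<open>x \<in> carrier G\<close> \<open>\<And>y. y \<in> E \<Longrightarrow> cj G x y = y\<close>[OF that] cE[OF that] cj_eq_self_iff[of x y] by simp
    thus ?thesis using that cent by (auto simp: centralizer_def)
  qed
  have swap: "cj G x y = y \<longleftrightarrow> cj G y x = x" if "x \<in> carrier G" "y \<in> carrier G" for x y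
    using that by (auto simp: cj_eq_self_iff)
  have ZZE: "Z \<subseteq> ZE"
  proof
    fix z assume z: "z \<in> Z"
    hence "z \<in> E" using inE[of z] memZ swap cE by metis
    thus "z \<in> ZE" using z memZ cE by (auto simp: ZE_def)
  qed
  have ZE_E: "ZE \<subseteq> E" by (auto simp: ZE_def)
  have sZE: "subgroup ZE G"
  proof -
    have "ZE = (\<Inter>y\<in>E. {x \<in> E. cj G y x = x})"
      using subgroup.one_closed[OF E] by (auto simp: ZE_def)
    moreover have "subgroup (\<Inter>((\<lambda>y. {x \<in> E. cj G y x = x}) ` E)) G"
    proof (rule subgroups_Inter)
      show "(\<lambda>y. {x \<in> E. cj G y x = x}) ` E \<noteq> {}" using subgroup.one_closed[OF E] by blast
      fix H assume "H \<in> (\<lambda>y. {x \<in> E. cj G y x = x}) ` E"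
      then obtain y where y: "y \<in> E" "H = {x \<in> E. cj G y x = x}" by blast
      show "subgroup H G" unfolding y(2)
        by (rule subgroup_equalizer[OF E]) (use y cE in \<open>auto simp: cj_mult\<close>)
    qed
    ultimately show ?thesis by simp
  qed
  have ZE_ne: "ZE \<noteq> E"
  proof
    assume "ZE = E"
    hence c: "cj G y x = x" if "x \<in> E" "y \<in> E" for x y using that by (auto simp: ZE_def)
    have "x \<otimes> y = y \<otimes> x" if "x \<in> E" "y \<in> E" for x y
      using c[OF that(2,1)] cE that cj_eq_self_iff[of x y] by simp
    thus False
      using nonab subgroup_imp_group[OF E]
      by (auto intro!: group.group_comm_groupI)
  qed
  \<comment> \<open>The quotient of a group by its centre does not have prime order:
    \<open>a\<close> would commute with the centre and with itself, hence with all of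
    \<open>E\<close>.\<close>
  have ZE_index: "card E \<noteq> p * card ZE"
  proof
    assume cE': "card E = p * card ZE"
    obtain a where a: "a \<in> E" "a \<notin> ZE" using ZE_ne ZE_E by blast
    define C where "C = {y \<in> E. cj G a y = y}"
    have "subgroup C G" unfolding C_def
      by (rule subgroup_equalizer[OF E]) (use a cE in \<open>auto simp: cj_mult\<close>)
    moreover have "ZE \<subseteq> C" using a by (auto simp: ZE_def C_def)
    moreover have "a \<in> C" using a cE by (simp add: C_def cj_def)
    ultimately have "C = E"
      using prime_index_eq[OF sZE _ E _ _ cE' prime_p finite_carrier, of C a] a by (auto simp: C_def)
    hence "cj G y a = a" if "y \<in> E" for y
      using that swap[of a y] cE a by (auto simp: C_def)
    thus False using a by (auto simp: ZE_def)
  qed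
  have "carrier G \<noteq> {\<one>}"
  proof
    assume "carrier G = {\<one>}"
    hence "ZE = {\<one>}" "E = {\<one>}"
      using subgroup.subset[OF sZE] subgroup.subset[OF E] subgroup.one_closed[OF sZE] subgroup.one_closed[OF E]
      by auto
    thus False using ZE_ne by simp
  qed
  then obtain z where z: "z \<in> carrier G" "z \<noteq> \<one>" "\<forall>x\<in>carrier G. x \<otimes> z = z \<otimes> x"
    using nontrivial_centre by blast
  have "z \<in> Z" using z by (auto simp: memZ cj_eq_self_iff)
  hence "{\<one>} \<noteq> Z" using z by blast
  hence 1: "p \<le> card Z"
    using card_mult_le[OF triv_subgroup sZ] subgroup.one_closed[OF sZ] by simp
  have "card ZE dvd p ^ 3" using card_subgroup_dvd[OF sZE E ZE_E] card by simp
  then obtain i where i: "card ZE = p ^ i" "i \<le> 3" using divides_primepow_nat[OF prime_p] by blast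
  have "i \<noteq> 3" using i card card_subset_eq[OF finite_subgroup[OF E finite_carrier] ZE_E] ZE_ne by auto
  moreover have "i \<noteq> 2" using i card ZE_index by (auto simp: power3_eq_cube power2_eq_square)
  ultimately have "i \<le> 1" using i by linarith
  hence "card ZE \<le> p" using i prime_ge_1_nat[OF prime_p] power_increasing[of i 1 p] by simp
  hence "Z = ZE"
    using 1 card_seteq[OF finite_subgroup[OF sZE finite_carrier] ZZE] by simp
  with \<open>card ZE \<le> p\<close> 1 have cardZ: "card Z = p" by simp
  have ZE: "Z = {x \<in> E. \<forall>y\<in>E. cj G y x = x}" using \<open>Z = ZE\<close> by (simp add: ZE_def)
  have ZsubE: "Z \<subseteq> E" using ZE by blast
  have cardE: "card E = p ^ 2 * card Z" using card cardZ by (simp add: power3_eq_cube power2_eq_square)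
  have commE: "inv y \<otimes> cj G x y \<in> Z" if "x \<in> E" "y \<in> E" for x y
  proof -
    interpret PE: p_group p "G\<lparr>carrier := E\<rparr>" using E by (rule p_group_subgroup)
    have cjE: "cj (G\<lparr>carrier := E\<rparr>) x y = cj G x y" if "x \<in> E" for x y
      using that E by (simp add: cj_def m_inv_consistent)
    have "subgroup Z (G\<lparr>carrier := E\<rparr>)" using sZ E ZsubE by (simp add: subgroup_incl)
    hence "Z \<lhd> G\<lparr>carrier := E\<rparr>"
      by (rule PE.normalI_cj) (use cE in \<open>auto simp: cjE normal_cj[OF nZ]\<close>)
    from PE.commutator_in_index_p2[OF this] show ?thesis
      using that cardE E by (simp add: order_def cjE m_inv_consistent)
  qed
  have conj: "\<exists>e\<in>E. cj G e w = w \<otimes> z" if w: "w \<in> E" "w \<notin> Z" and z: "z \<in> Z" for w z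
  proof -
    define C where "C = {e \<in> E. cj G e w = w}"
    have sC: "subgroup C G" unfolding C_def using E cE[OF w(1)] by (rule subgroup_centralizer_elem)
    have cw: "w \<in> carrier G" using w cE by blast
    have "C \<noteq> E" using w unfolding ZE C_def by blast
    have "(\<lambda>e. inv w \<otimes> cj G e w) ` E = Z"
    proof (rule commutator_map_surj[OF E sC _ \<open>C \<noteq> E\<close> cardZ])
      fix e e' assume e: "e \<in> E" "e' \<in> E" "inv w \<otimes> cj G e w = inv w \<otimes> cj G e' w"
      have ce: "e \<in> carrier G" "e' \<in> carrier G" using e cE by auto
      have "cj G e w = cj G e' w" using e(3) ce cw by simp
      hence "cj G (e \<otimes> inv e') w = w" using ce cw by (simp flip: cj_cj)
      thus "e \<otimes> inv e' \<in> C" using e E by (simp add: C_def subgroup.m_closed subgroup.m_inv_closed)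
    qed (use commE w in \<open>auto simp: C_def\<close>)
    then obtain e where e: "e \<in> E" "z = inv w \<otimes> cj G e w" using z by blast
    hence "cj G e w = w \<otimes> z" using cw cE by simp
    thus ?thesis using e by blast
  qed
  \<comment> \<open>An automorphism of \<open>E\<close> that is trivial on \<open>Z\<close> and on
    \<open>E/Z\<close> is inner. The element \<open>x\<close> is corrected twice: by
    \<open>e\<close> in \<open>E\<close> so that the result \<open>y\<close> fixes \<open>a\<close>,
    then by \<open>c\<close> in the centralizer \<open>M\<close> of \<open>a\<close> so that the
    result \<open>v\<close> fixes \<open>b\<close> as well. Then \<open>v\<close> centralizes
    \<open>E\<close>, and so it lies in \<open>E\<close>.\<close>
  have selfc: "x \<in> E" if x: "x \<in> carrier G" "\<And>y. y \<in> E \<Longrightarrow> inv y \<otimes> cj G x y \<in> Z" for x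
  proof -
    have "Z \<noteq> E" using ZE_ne \<open>Z = ZE\<close> by simp
    then obtain a where a: "a \<in> E" "a \<notin> Z" using ZsubE by blast
    have ca: "a \<in> carrier G" using a cE by blast
    obtain e where e: "e \<in> E" "cj G e a = a \<otimes> (inv a \<otimes> cj G x a)"
      using conj[OF a x(2)[OF a(1)]] by blast
    have ce: "e \<in> carrier G" using e cE by blast
    define y where "y = x \<otimes> inv e"
    have cy: "y \<in> carrier G" using x ce by (simp add: y_def)
    have "cj G x a = cj G e a" using e ca x by simp
    hence ya: "cj G y a = a" using x ce ca by (simp add: y_def flip: cj_cj)
    define M where "M = {c \<in> E. cj G c a = a}"
    have sM: "subgroup M G" unfolding M_def by (rule subgroup_centralizer_elem[OF E ca])
    have ZM: "Z \<subseteq> M"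
      using ZsubE ca memZ swap cE by (auto simp: M_def)
    have aM: "a \<in> M" using a ca by (simp add: M_def cj_def)
    have "M \<noteq> E" using a unfolding ZE M_def by blast
    then obtain b where b: "b \<in> E" "b \<notin> M" by (auto simp: M_def)
    have cb: "b \<in> carrier G" using b cE by blast
    have ymod: "inv b \<otimes> cj G y b \<in> Z"
    proof -
      define z1 where "z1 = inv b \<otimes> cj G x b"
      have z1: "z1 \<in> Z" "cj G x b = b \<otimes> z1" using x b cb by (auto simp: z1_def)
      have "inv e \<in> E" using e E by (simp add: subgroup.m_inv_closed)
      hence z2: "inv b \<otimes> cj G (inv e) b \<in> Z" using commE b by blast
      have cz1: "z1 \<in> carrier G" using z1 subgroup.mem_carrier[OF sZ] by blast
      have "cj G y b = cj G (inv e) b \<otimes> z1"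
        using x ce cb z1 cz1 memZ by (simp add: y_def cj_mult flip: cj_cj)
      hence "inv b \<otimes> cj G y b = (inv b \<otimes> cj G (inv e) b) \<otimes> z1"
        using ce cb cz1 by (simp add: m_assoc)
      thus ?thesis using z1 z2 sZ by (simp add: subgroup.m_closed)
    qed
    define L where "L = {c \<in> M. cj G c b = b}"
    have sL: "subgroup L G" unfolding L_def by (rule subgroup_centralizer_elem[OF sM cb])
    have "L \<noteq> M"
    proof
      assume "L = M"
      hence "cj G b a = a" using aM swap[OF cb ca] by (auto simp: L_def)
      thus False using b by (auto simp: M_def)
    qed
    have "(\<lambda>c. inv b \<otimes> cj G c b) ` M = Z"
    proof (rule commutator_map_surj[OF sM sL _ \<open>L \<noteq> M\<close> cardZ])
      fix c c' assume c: "c \<in> M" "c' \<in> M" "inv b \<otimes> cj G c b = inv b \<otimes> cj G c' b"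
      have cc: "c \<in> carrier G" "c' \<in> carrier G" using c cE by (auto simp: M_def)
      have "cj G c b = cj G c' b" using c(3) cc cb by simp
      hence "cj G (c \<otimes> inv c') b = b" using cc cb by (simp flip: cj_cj)
      thus "c \<otimes> inv c' \<in> L" using c sM by (simp add: L_def subgroup.m_closed subgroup.m_inv_closed)
    qed (use commE b in \<open>auto simp: L_def M_def\<close>)
    then obtain c where c: "c \<in> M" "inv b \<otimes> cj G y b = inv b \<otimes> cj G c b"
      using ymod by (metis (no_types, lifting) imageE)
    have cc: "c \<in> carrier G" "c \<in> E" using c cE by (auto simp: M_def)
    define v where "v = y \<otimes> inv c"
    have cv: "v \<in> carrier G" using cy cc by (simp add: v_def)
    have "cj G c a = a" using c by (simp add: M_def)
    hence va: "cj G v a = a" using cy cc ca ya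
      by (metis cj_cj cj_inv_cancel(1) inv_closed v_def)
    have "cj G y b = cj G c b" using c(2) cy cc cb by simp
    hence vb: "cj G v b = b" using cy cc cb by (simp add: v_def flip: cj_cj)
    define F where "F = {c \<in> E. cj G v c = c}"
    have sF: "subgroup F G" unfolding F_def
      by (rule subgroup_equalizer[OF E]) (use cv cE in \<open>auto simp: cj_mult\<close>)
    have ZF: "Z \<subseteq> F" using ZsubE cv memZ by (auto simp: F_def)
    have aF: "a \<in> F" "b \<in> F" using a b va vb by (auto simp: F_def)
    \<comment> \<open>A proper \<open>F\<close> would have order \<open>p * card Z\<close>, hence be
      generated by \<open>Z\<close> and \<open>a\<close> and lie in \<open>M\<close>; but it
      contains \<open>b\<close>.\<close>
    have "F = E"
    proof (rule ccontr)
      assume "F \<noteq> E"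
      have FE: "F \<subseteq> E" by (auto simp: F_def)
      have "F \<noteq> Z" using aF a by blast
      have "card F = p * card Z"
        by (rule card_intermediate[OF sZ sF E ZF FE \<open>F \<noteq> Z\<close> \<open>F \<noteq> E\<close> cardE])
      moreover have "subgroup (F \<inter> M) G" using sF sM by (rule subgroups_Inter_pair)
      ultimately have "F \<inter> M = F"
        using prime_index_eq[OF sZ _ sF _ _ _ prime_p finite_carrier, of "F \<inter> M" a] ZF ZM aF aM a by blast
      thus False using aF b by blast
    qed
    hence "v \<in> E" using inE[OF cv] by (auto simp: F_def)
    hence "v \<otimes> c \<otimes> e \<in> E" using cc e E by (simp add: subgroup.m_closed)
    thus "x \<in> E" using x cc ce by (simp add: v_def y_def m_assoc)
  qed
  have "{x \<in> Q. \<forall>y\<in>Q. cj G y x = x} = Z" if Q: "subgroup Q G" "E \<subseteq> Q" for Q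
  proof (intro subset_antisym subsetI)
    fix x assume x: "x \<in> {x \<in> Q. \<forall>y\<in>Q. cj G y x = x}"
    hence cx: "x \<in> carrier G" and "\<And>y. y \<in> E \<Longrightarrow> cj G y x = x"
      using Q subgroup.mem_carrier[OF Q(1)] by auto
    hence "x \<in> E" using inE[OF cx] swap[OF cx cE] by simp
    thus "x \<in> Z" using x Q unfolding ZE by auto
  next
    fix x assume "x \<in> Z"
    thus "x \<in> {x \<in> Q. \<forall>y\<in>Q. cj G y x = x}"
      using ZsubE Q memZ[of x] subgroup.mem_carrier[OF Q(1)] by auto
  qed
  moreover have "sc_pair Z E"
    unfolding sc_pair_def using nZ E ZsubE cardE selfc by simp
  ultimately show ?thesis
    unfolding pearl_base_def Z_def[symmetric] using cardZ memZ conj by simp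
qed

end

section \<open>Fusion systems\<close>

lemma conj_map_cj: "conj_map G P g = (\<lambda>x\<in>P. cj G g x)"
  by (simp add: conj_map_def cj_def)

lemma conj_hom_cj:
  "conj_hom G P Q = {(\<lambda>x\<in>P. cj G g x) | g. g \<in> carrier G \<and> cj G g ` P \<subseteq> Q}"
  by (simp add: conj_hom_def conj_map_cj)

context fusion_system
begin

lemma F_dom: "\<phi> \<in> F P Q \<Longrightarrow> subgroup P S" and F_cod: "\<phi> \<in> F P Q \<Longrightarrow> subgroup Q S"
  using objects by blast+

lemma F_ext: "\<phi> \<in> F P Q \<Longrightarrow> \<phi> \<in> extensional P"
  and F_mult: "\<phi> \<in> F P Q \<Longrightarrow> x \<in> P \<Longrightarrow> y \<in> P \<Longrightarrow> \<phi> (x \<otimes> y) = \<phi> x \<otimes> \<phi> y"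
  and F_mem: "\<phi> \<in> F P Q \<Longrightarrow> x \<in> P \<Longrightarrow> \<phi> x \<in> Q"
  and F_inj: "\<phi> \<in> F P Q \<Longrightarrow> inj_on \<phi> P"
  using injective_hom[of \<phi> P Q] by (auto simp: mon_def hom_def)

lemma F_eq: "\<phi> \<in> F P Q \<Longrightarrow> x \<in> P \<Longrightarrow> y \<in> P \<Longrightarrow> \<phi> x = \<phi> y \<longleftrightarrow> x = y"
  using F_inj by (metis inj_onD)

lemma F_dom_carrier: "\<phi> \<in> F P Q \<Longrightarrow> x \<in> P \<Longrightarrow> x \<in> carrier S"
  using F_dom subgroup.mem_carrier by metis

lemma F_carrier: "\<phi> \<in> F P Q \<Longrightarrow> x \<in> P \<Longrightarrow> \<phi> x \<in> carrier S"
  using F_cod F_mem subgroup.mem_carrier by metis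

lemma F_one: "\<phi> \<in> F P Q \<Longrightarrow> \<phi> \<one> = \<one>"
  using F_mult[of \<phi> P Q \<one> \<one>] F_carrier[of \<phi> P Q \<one>] subgroup.one_closed[OF F_dom] by simp

lemma F_inv: "\<phi> \<in> F P Q \<Longrightarrow> x \<in> P \<Longrightarrow> \<phi> (inv x) = inv (\<phi> x)"
  using F_mult[of \<phi> P Q "inv x" x] F_one[of \<phi> P Q] F_carrier[of \<phi> P Q] F_dom_carrier[of \<phi> P Q]
    subgroup.m_inv_closed[OF F_dom]
  by (metis inv_equality l_inv)

lemma F_cj: "\<phi> \<in> F P Q \<Longrightarrow> g \<in> P \<Longrightarrow> x \<in> P \<Longrightarrow> \<phi> (cj S g x) = cj S (\<phi> g) (\<phi> x)"
  using subgroup.m_closed[OF F_dom] subgroup.m_inv_closed[OF F_dom]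
  by (simp add: cj_def F_mult F_inv)

lemma F_cm: "\<phi> \<in> F P Q \<Longrightarrow> g \<in> P \<Longrightarrow> x \<in> P \<Longrightarrow>
    \<phi> (inv x \<otimes> cj S g x) = inv (\<phi> x) \<otimes> cj S (\<phi> g) (\<phi> x)"
  using subgroup_cj_closed[OF F_dom] subgroup.m_inv_closed[OF F_dom]
  by (simp add: F_mult F_inv F_cj)

lemma F_image_subgroup: "\<phi> \<in> F P Q \<Longrightarrow> subgroup (\<phi> ` P) S"
  using onto_image F_cod by metis

lemma F_card_image: "\<phi> \<in> F P Q \<Longrightarrow> A \<subseteq> P \<Longrightarrow> card (\<phi> ` A) = card A"
  by (meson F_inj card_image inj_on_subset)

lemma F_subset_image:
  assumes "\<phi> \<in> F P Q" "subgroup A S" "A \<subseteq> P" shows "subgroup (\<phi> ` A) S"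
  using assms by (intro subgroup_hom_image[OF assms(2)]) (auto intro: F_carrier F_mult)

lemma F_finite: "\<phi> \<in> F P Q \<Longrightarrow> finite P"
  using F_dom finite_subgroup finite_carrier by metis

lemma F_comp: "\<phi> \<in> F P Q \<Longrightarrow> \<psi> \<in> F Q R \<Longrightarrow> (\<lambda>x\<in>P. \<psi> (\<phi> x)) \<in> F P R"
  using compose_closed[of \<phi> P Q \<psi> R] by (simp add: compose_def)

lemma F_cong: "\<phi> \<in> F P Q \<Longrightarrow> (\<And>x. x \<in> P \<Longrightarrow> f x = \<phi> x) \<Longrightarrow> restrict f P \<in> F P Q"
  using F_ext[of \<phi> P Q] by (metis extensional_restrict restrict_ext)

lemma F_eqI: "\<phi> \<in> F P Q \<Longrightarrow> \<psi> \<in> extensional P \<Longrightarrow> (\<And>x. x \<in> P \<Longrightarrow> \<psi> x = \<phi> x) \<Longrightarrow> \<psi> \<in> F P Q"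
  using F_cong[of \<phi> P Q \<psi>] by (simp add: extensional_restrict)

lemma F_conj:
  "subgroup P S \<Longrightarrow> subgroup Q S \<Longrightarrow> g \<in> carrier S \<Longrightarrow> cj S g ` P \<subseteq> Q \<Longrightarrow> (\<lambda>x\<in>P. cj S g x) \<in> F P Q"
  using conj_hom_subset[of P Q] by (auto simp: conj_hom_cj)

lemma F_incl: "subgroup P S \<Longrightarrow> subgroup Q S \<Longrightarrow> P \<subseteq> Q \<Longrightarrow> (\<lambda>x\<in>P. x) \<in> F P Q"
  using F_conj[of P Q \<one>] subgroup.mem_carrier[of P S]
  by (simp add: cj_one_image subgroup.subset cong: restrict_cong)

lemma F_restrict:
  assumes "\<phi> \<in> F P Q" "subgroup A S" "A \<subseteq> P" shows "restrict \<phi> A \<in> F A Q"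
  using F_comp[OF F_incl[OF assms(2) F_dom[OF assms(1)] assms(3)] assms(1)]
  by (rule F_cong) auto

lemma F_codomain:
  assumes "\<phi> \<in> F P Q" "subgroup R S" "\<phi> ` P \<subseteq> R" shows "\<phi> \<in> F P R"
  using F_comp[OF onto_image[OF assms(1)] F_incl[OF F_image_subgroup[OF assms(1)] assms(2,3)]]
    F_ext[OF assms(1)]
  by (rule F_eqI) auto

lemma F_left_inverse:
  assumes "\<phi> \<in> F P Q" shows "\<exists>\<psi>\<in>F (\<phi> ` P) P. \<forall>x\<in>P. \<psi> (\<phi> x) = x"
  using inverse_onto_image[OF assms] F_inj[OF assms] by (intro bexI) auto

lemma F_Aut_image: "\<alpha> \<in> F P P \<Longrightarrow> \<alpha> ` P = P"
  using F_card_image[of \<alpha> P P P] F_mem[of \<alpha> P P] F_finite[of \<alpha> P P]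
  by (metis card_subset_eq image_subsetI order_refl)

lemma F_Aut_inverse:
  assumes "\<alpha> \<in> F P P"
  shows "\<exists>\<alpha>'\<in>F P P. (\<forall>x\<in>P. \<alpha>' (\<alpha> x) = x) \<and> (\<forall>x\<in>P. \<alpha> (\<alpha>' x) = x)"
proof -
  obtain \<alpha>' where a: "\<alpha>' \<in> F P P" "\<forall>x\<in>P. \<alpha>' (\<alpha> x) = x"
    using F_left_inverse[OF assms] F_Aut_image[OF assms] by auto
  have "\<alpha> (\<alpha>' x) = x" if "x \<in> P" for x
    using that a F_Aut_image[OF assms] by (metis imageE)
  thus ?thesis using a by blast
qed

lemma F_Aut_invariant:
  assumes "\<alpha> \<in> F P P" "A \<subseteq> P" "\<alpha> ` A \<subseteq> A" shows "\<alpha> ` A = A"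
  using assms F_card_image[OF assms(1,2)] finite_subset[OF assms(2) F_finite[OF assms(1)]]
  by (metis card_subset_eq)

lemma F_Aut_inverse_invariant:
  assumes "\<alpha> \<in> F P P" "\<And>x. x \<in> P \<Longrightarrow> \<alpha>' (\<alpha> x) = x" "A \<subseteq> P" "\<And>x. x \<in> A \<Longrightarrow> \<alpha> x \<in> A" "x \<in> A"
  shows "\<alpha>' x \<in> A"
proof -
  have "\<alpha> ` A = A" using assms by (intro F_Aut_invariant) auto
  then obtain y where "y \<in> A" "x = \<alpha> y" using assms(5) by blast
  thus ?thesis using assms(2,3) by auto
qed

lemma F_funpow:
  assumes "\<alpha> \<in> F P P" shows "restrict (\<alpha> ^^ n) P \<in> F P P"
proof (induction n)
  case 0
  from F_incl[OF F_dom[OF assms] F_dom[OF assms] order_refl] show ?case by (rule F_cong) simp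
next
  case (Suc n)
  from F_comp[OF this assms] show ?case by (rule F_cong) auto
qed

lemma finite_Aut: "finite (F P P)"
proof (cases "F P P = {}")
  case False
  then obtain \<alpha> where "\<alpha> \<in> F P P" by blast
  hence "finite P" by (rule F_finite)
  moreover have "F P P \<subseteq> P \<rightarrow>\<^sub>E P"
    using F_mem F_ext by (auto simp: PiE_def)
  ultimately show ?thesis by (meson finite_PiE finite_subset)
qed simp

text \<open>Products in \<open>Aut_group\<close> are composites of functions with the right factor
  applied first, whereas \<open>cj_cj\<close> multiplies conjugating elements in order of
  application.\<close>

lemma Aut_group_simps:
  assumes P: "subgroup P S"
  shows "carrier (Aut_group S F P) = F P P"
    and "\<one>\<^bsub>Aut_group S F P\<^esub> = (\<lambda>x\<in>P. x)"
    and "\<alpha> \<in> F P P \<Longrightarrow> \<beta> \<in> F P P \<Longrightarrow> \<alpha> \<otimes>\<^bsub>Aut_group S F P\<^esub> \<beta> = (\<lambda>x\<in>P. \<alpha> (\<beta> x))"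
    and "group (Aut_group S F P)"
proof -
  have bij: "\<alpha> \<in> Bij P" if "\<alpha> \<in> F P P" for \<alpha>
    using that F_ext F_inj F_Aut_image by (auto simp: Bij_def bij_betw_def)
  show c: "carrier (Aut_group S F P) = F P P" by (simp add: Aut_group_def)
  show o: "\<one>\<^bsub>Aut_group S F P\<^esub> = (\<lambda>x\<in>P. x)"
    by (simp add: Aut_group_def AutoGroup_def BijGroup_def)
  have m: "\<alpha> \<otimes>\<^bsub>Aut_group S F P\<^esub> \<beta> = (\<lambda>x\<in>P. \<alpha> (\<beta> x))" if "\<alpha> \<in> F P P" "\<beta> \<in> F P P" for \<alpha> \<beta>
    using that bij by (simp add: Aut_group_def AutoGroup_def BijGroup_def compose_def)
  thus "\<alpha> \<in> F P P \<Longrightarrow> \<beta> \<in> F P P \<Longrightarrow> \<alpha> \<otimes>\<^bsub>Aut_group S F P\<^esub> \<beta> = (\<lambda>x\<in>P. \<alpha> (\<beta> x))" .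
  have id: "(\<lambda>x\<in>P. x) \<in> F P P" by (rule F_incl[OF P P order_refl])
  show "group (Aut_group S F P)"
  proof (rule groupI; unfold c o)
    fix \<alpha> \<beta> \<gamma> assume a: "\<alpha> \<in> F P P" "\<beta> \<in> F P P" "\<gamma> \<in> F P P"
    show "\<alpha> \<otimes>\<^bsub>Aut_group S F P\<^esub> \<beta> \<in> F P P" using a by (simp add: m F_comp)
    show "\<alpha> \<otimes>\<^bsub>Aut_group S F P\<^esub> \<beta> \<otimes>\<^bsub>Aut_group S F P\<^esub> \<gamma> =
      \<alpha> \<otimes>\<^bsub>Aut_group S F P\<^esub> (\<beta> \<otimes>\<^bsub>Aut_group S F P\<^esub> \<gamma>)"
      using a by (simp add: m F_comp F_mem cong: restrict_cong)
  next
    fix \<alpha> assume a: "\<alpha> \<in> F P P"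
    show "(\<lambda>x\<in>P. x) \<otimes>\<^bsub>Aut_group S F P\<^esub> \<alpha> = \<alpha>"
      using a id F_ext[OF a] by (simp add: m F_mem cong: restrict_cong) (simp add: extensional_restrict)
    obtain \<alpha>' where a': "\<alpha>' \<in> F P P" "\<forall>x\<in>P. \<alpha>' (\<alpha> x) = x" using F_Aut_inverse[OF a] by blast
    hence "\<alpha>' \<otimes>\<^bsub>Aut_group S F P\<^esub> \<alpha> = (\<lambda>x\<in>P. x)" using a by (simp add: m cong: restrict_cong)
    thus "\<exists>\<beta>\<in>F P P. \<beta> \<otimes>\<^bsub>Aut_group S F P\<^esub> \<alpha> = (\<lambda>x\<in>P. x)" using a' by blast
  qed (rule id)
qed

lemma Aut_group_pow:
  assumes P: "subgroup P S" and a: "\<alpha> \<in> F P P"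
  shows "\<alpha> [^]\<^bsub>Aut_group S F P\<^esub> n = restrict (\<alpha> ^^ n) P"
proof (induction n)
  case 0
  thus ?case by (simp add: Aut_group_simps[OF P] nat_pow_def id_def)
next
  case (Suc n)
  interpret A: group "Aut_group S F P" by (rule Aut_group_simps(4)[OF P])
  have "\<alpha> [^]\<^bsub>Aut_group S F P\<^esub> Suc n = \<alpha> \<otimes>\<^bsub>Aut_group S F P\<^esub> \<alpha> [^]\<^bsub>Aut_group S F P\<^esub> n"
    using a A.nat_pow_Suc2 by (simp add: Aut_group_simps[OF P])
  also have "\<dots> = (\<lambda>x\<in>P. \<alpha> ((\<alpha> ^^ n) x))"
    unfolding Suc using a F_funpow[OF a] by (subst Aut_group_simps(3)[OF P]) (auto cong: restrict_cong)
  finally show ?case by (simp cong: restrict_cong)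
qed

lemma Aut_group_pow_one:
  assumes P: "subgroup P S" and a: "\<alpha> \<in> F P P"
  shows "\<alpha> [^]\<^bsub>Aut_group S F P\<^esub> n = \<one>\<^bsub>Aut_group S F P\<^esub> \<longleftrightarrow> (\<forall>x\<in>P. (\<alpha> ^^ n) x = x)"
  unfolding Aut_group_pow[OF assms] Aut_group_simps(2)[OF P]
  by (metis restrict_apply' restrict_ext)

lemma conj_hom_Aut: "subgroup P S \<Longrightarrow> conj_hom S P P \<subseteq> F P P"
  by (rule conj_hom_subset)

lemma conj_hom_AutE:
  assumes "\<alpha> \<in> conj_hom S P P"
  obtains g where "g \<in> carrier S" "cj S g ` P \<subseteq> P" "\<And>x. x \<in> P \<Longrightarrow> \<alpha> x = cj S g x"
  using assms by (auto simp: conj_hom_cj)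

lemma conj_hom_AutI:
  assumes "\<alpha> \<in> F P P" "g \<in> carrier S" "\<And>x. x \<in> P \<Longrightarrow> \<alpha> x = cj S g x"
  shows "\<alpha> \<in> conj_hom S P P"
proof -
  have "\<alpha> = (\<lambda>x\<in>P. cj S g x)"
    using assms F_ext[OF assms(1)] by (metis extensional_restrict restrict_ext)
  moreover have "cj S g ` P \<subseteq> P" using assms F_mem[OF assms(1)] by auto
  ultimately show ?thesis using assms(2) by (auto simp: conj_hom_cj)
qed

lemma conj_hom_p_power:
  assumes "subgroup P S" "\<alpha> \<in> conj_hom S P P"
  shows "\<exists>k. \<forall>x\<in>P. (\<alpha> ^^ (p ^ k)) x = x"
proof -
  obtain g where g: "g \<in> carrier S" "cj S g ` P \<subseteq> P" "\<And>x. x \<in> P \<Longrightarrow> \<alpha> x = cj S g x"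
    using assms(2) by (rule conj_hom_AutE) blast
  have a: "\<alpha> \<in> F P P" using assms conj_hom_Aut by blast
  have "(\<alpha> ^^ n) x = (cj S g ^^ n) x \<and> (\<alpha> ^^ n) x \<in> P" if "x \<in> P" for n x
    using that by (induction n) (auto simp: g(3) F_mem[OF a] intro: subsetD[OF g(2)])
  thus ?thesis using funpow_cj_id g(1) subgroup.mem_carrier[OF assms(1)] by metis
qed

lemma subgroup_conj_hom:
  assumes P: "subgroup P S" shows "subgroup (conj_hom S P P) (Aut_group S F P)"
proof -
  interpret A: group "Aut_group S F P" by (rule Aut_group_simps(4)[OF P])
  note sub = conj_hom_Aut[OF P] and cP = subgroup.mem_carrier[OF P]
  show ?thesis
  proof (rule A.subgroupI)
    show "conj_hom S P P \<subseteq> carrier (Aut_group S F P)" using sub by (simp add: Aut_group_simps[OF P])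
    show "conj_hom S P P \<noteq> {}"
      using conj_hom_AutI[OF F_incl[OF P P order_refl] one_closed] cP by auto
  next
    fix \<alpha> assume a: "\<alpha> \<in> conj_hom S P P"
    then obtain g where g: "g \<in> carrier S" "cj S g ` P \<subseteq> P" "\<And>x. x \<in> P \<Longrightarrow> \<alpha> x = cj S g x"
      by (rule conj_hom_AutE) blast
    have aF: "\<alpha> \<in> F P P" using a sub by blast
    obtain \<alpha>' where a': "\<alpha>' \<in> F P P" "\<forall>x\<in>P. \<alpha>' (\<alpha> x) = x" "\<forall>x\<in>P. \<alpha> (\<alpha>' x) = x"
      using F_Aut_inverse[OF aF] by blast
    have "\<alpha>' x = cj S (inv g) x" if "x \<in> P" for x
    proof -
      have "x = cj S g (\<alpha>' x)" using a'(3) g(3) F_mem[OF a'(1)] that by metis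
      thus ?thesis using cj_inv_cancel(1)[OF g(1)] cP F_mem[OF a'(1) that] by metis
    qed
    hence "\<alpha>' \<in> conj_hom S P P" using a' g by (intro conj_hom_AutI[of _ _ "inv g"]) auto
    moreover have "inv\<^bsub>Aut_group S F P\<^esub> \<alpha> = \<alpha>'"
      using a' aF by (intro A.inv_equality) (auto simp: Aut_group_simps[OF P] cong: restrict_cong)
    ultimately show "inv\<^bsub>Aut_group S F P\<^esub> \<alpha> \<in> conj_hom S P P" by simp
  next
    fix \<alpha> \<beta> assume a: "\<alpha> \<in> conj_hom S P P" and b: "\<beta> \<in> conj_hom S P P"
    obtain g where g: "g \<in> carrier S" "cj S g ` P \<subseteq> P" "\<And>x. x \<in> P \<Longrightarrow> \<alpha> x = cj S g x"
      using a by (rule conj_hom_AutE) blast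
    obtain h where h: "h \<in> carrier S" "cj S h ` P \<subseteq> P" "\<And>x. x \<in> P \<Longrightarrow> \<beta> x = cj S h x"
      using b by (rule conj_hom_AutE) blast
    have ab: "\<alpha> \<in> F P P" "\<beta> \<in> F P P" using a b sub by auto
    have "(\<lambda>x\<in>P. \<alpha> (\<beta> x)) \<in> conj_hom S P P"
    proof (rule conj_hom_AutI[of _ _ "h \<otimes> g"])
      fix x assume x: "x \<in> P"
      hence "cj S h x \<in> P" using h by blast
      thus "(\<lambda>x\<in>P. \<alpha> (\<beta> x)) x = cj S (h \<otimes> g) x" using x g h cP by (simp add: cj_cj)
    qed (use ab g h F_comp in auto)
    thus "\<alpha> \<otimes>\<^bsub>Aut_group S F P\<^esub> \<beta> \<in> conj_hom S P P" using ab by (simp add: Aut_group_simps[OF P])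
  qed
qed

lemma sylow_conj_homI:
  assumes P: "subgroup P S"
    and all: "\<And>\<alpha> k. \<alpha> \<in> F P P \<Longrightarrow> (\<And>x. x \<in> P \<Longrightarrow> (\<alpha> ^^ (p ^ k)) x = x) \<Longrightarrow>
      \<exists>g\<in>carrier S. \<forall>x\<in>P. \<alpha> x = cj S g x"
  shows "sylow_subgroup p (conj_hom S P P) (Aut_group S F P)"
proof -
  interpret A: group "Aut_group S F P" by (rule Aut_group_simps(4)[OF P])
  show ?thesis
  proof (rule A.sylow_subgroupI[OF _ prime_p subgroup_conj_hom[OF P]])
    show "finite (carrier (Aut_group S F P))" by (simp add: Aut_group_simps[OF P] finite_Aut)
    show "\<exists>k. \<alpha> [^]\<^bsub>Aut_group S F P\<^esub> (p ^ k) = \<one>\<^bsub>Aut_group S F P\<^esub>" if "\<alpha> \<in> conj_hom S P P" for \<alpha>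
      using conj_hom_p_power[OF P that] that conj_hom_Aut[OF P] by (simp add: Aut_group_pow_one[OF P] subset_iff)
    show "\<alpha> \<in> conj_hom S P P" if "\<alpha> \<in> carrier (Aut_group S F P)"
      "\<alpha> [^]\<^bsub>Aut_group S F P\<^esub> (p ^ k) = \<one>\<^bsub>Aut_group S F P\<^esub>" for \<alpha> k
    proof -
      have a: "\<alpha> \<in> F P P" using that(1) by (simp add: Aut_group_simps(1)[OF P])
      moreover have "(\<alpha> ^^ (p ^ k)) x = x" if "x \<in> P" for x
        using Aut_group_pow_one[OF P a] that \<open>\<alpha> [^]\<^bsub>Aut_group S F P\<^esub> (p ^ k) = \<one>\<^bsub>Aut_group S F P\<^esub>\<close> by blast
      ultimately obtain g where "g \<in> carrier S" "\<forall>x\<in>P. \<alpha> x = cj S g x" using all[of \<alpha> k] by blast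
      thus ?thesis using conj_hom_AutI[OF a] by blast
    qed
  qed
qed

text \<open>This removes \<open>inv_into\<close>: \<open>g\<close> belongs to the domain if some
  \<open>h\<close> acts on the image of \<open>P\<close> as \<open>g\<close> acts on
  \<open>P\<close>. That \<open>h\<close> maps this image to itself follows from the
  equation.\<close>

lemma mem_extension_domain:
  assumes \<phi>: "\<phi> \<in> F P Q"
  shows "g \<in> extension_domain S P \<phi> \<longleftrightarrow>
    g \<in> carrier S \<and> cj S g ` P = P \<and> (\<exists>h\<in>carrier S. \<forall>x\<in>P. \<phi> (cj S g x) = cj S h (\<phi> x))"
proof -
  define f where "f = (\<lambda>y \<in> \<phi> ` P. \<phi> (conj_map S P g (inv_into P \<phi> y)))"
  have P: "P \<subseteq> carrier S" using F_dom[OF \<phi>] by (rule subgroup.subset)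
  have f: "f (\<phi> x) = \<phi> (cj S g x)" if "x \<in> P" for x
    using that F_inj[OF \<phi>] by (simp add: f_def conj_map_cj)
  have "f \<in> conj_hom S (\<phi> ` P) (\<phi> ` P) \<longleftrightarrow> (\<exists>h\<in>carrier S. \<forall>x\<in>P. \<phi> (cj S g x) = cj S h (\<phi> x))"
    if g: "cj S g ` P = P"
  proof
    assume "f \<in> conj_hom S (\<phi> ` P) (\<phi> ` P)"
    then obtain h where "h \<in> carrier S" "\<And>y. y \<in> \<phi> ` P \<Longrightarrow> f y = cj S h y"
      by (rule conj_hom_AutE) blast
    thus "\<exists>h\<in>carrier S. \<forall>x\<in>P. \<phi> (cj S g x) = cj S h (\<phi> x)" using f by (metis imageI)
  next
    assume "\<exists>h\<in>carrier S. \<forall>x\<in>P. \<phi> (cj S g x) = cj S h (\<phi> x)"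
    then obtain h where h: "h \<in> carrier S" "\<And>x. x \<in> P \<Longrightarrow> \<phi> (cj S g x) = cj S h (\<phi> x)" by blast
    have "f = (\<lambda>y\<in>\<phi> ` P. cj S h y)"
    proof (rule ext)
      fix y show "f y = (\<lambda>y\<in>\<phi> ` P. cj S h y) y"
      proof (cases "y \<in> \<phi> ` P")
        case True
        then obtain x where "x \<in> P" "y = \<phi> x" by blast
        thus ?thesis using f h by simp
      qed (simp add: f_def)
    qed
    moreover have "cj S h (\<phi> x) \<in> \<phi> ` P" if "x \<in> P" for x
      using h(2)[OF that] g that by (metis imageI)
    hence "cj S h ` \<phi> ` P \<subseteq> \<phi> ` P" by blast
    ultimately show "f \<in> conj_hom S (\<phi> ` P) (\<phi> ` P)" using h(1) by (auto simp: conj_hom_cj)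
  qed
  thus ?thesis by (auto simp: extension_domain_def mem_normalizer_iff[OF P] f_def)
qed

text \<open>Morphism sets are empty unless their ends are subgroups, so an explicit formula on this
  set can become a morphism of the subsystem only after this check.\<close>

lemma subgroup_extension_domain:
  assumes \<phi>: "\<phi> \<in> F P Q" shows "subgroup (extension_domain S P \<phi>) S"
proof (rule subgroupI)
  note mem = mem_extension_domain[OF \<phi>] and cP = F_dom_carrier[OF \<phi>] and c\<phi> = F_carrier[OF \<phi>]
  have P: "P \<subseteq> carrier S" using cP by blast
  show "extension_domain S P \<phi> \<subseteq> carrier S" by (auto simp: mem)
  have "\<one> \<in> extension_domain S P \<phi>"
    unfolding mem using P c\<phi> cP by (intro conjI bexI[of _ \<one>]) (auto simp: cj_one_image)
  thus "extension_domain S P \<phi> \<noteq> {}" by blast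
  fix g assume "g \<in> extension_domain S P \<phi>"
  then obtain h where g: "g \<in> carrier S" "cj S g ` P = P" "h \<in> carrier S"
    "\<And>x. x \<in> P \<Longrightarrow> \<phi> (cj S g x) = cj S h (\<phi> x)" by (auto simp: mem)
  have ig: "cj S (inv g) x \<in> P" if x: "x \<in> P" for x
  proof -
    obtain y where "y \<in> P" "x = cj S g y" using x g(2) by blast
    thus ?thesis using g cP by simp
  qed
  have "cj S (inv g) ` P = P"
    using cj_cj_image[of g "inv g" P] g P by (simp add: cj_one_image)
  moreover have "\<phi> (cj S (inv g) x) = cj S (inv h) (\<phi> x)" if x: "x \<in> P" for x
  proof -
    have "\<phi> x = cj S h (\<phi> (cj S (inv g) x))" using g(4)[OF ig[OF x]] g(1) cP[OF x] by simp
    thus ?thesis using cj_inv_cancel(1)[OF g(3) c\<phi>[OF ig[OF x]]] by simp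
  qed
  ultimately show "inv g \<in> extension_domain S P \<phi>" using g by (auto simp: mem)
  fix g' assume "g' \<in> extension_domain S P \<phi>"
  then obtain h' where g': "g' \<in> carrier S" "cj S g' ` P = P" "h' \<in> carrier S"
    "\<And>x. x \<in> P \<Longrightarrow> \<phi> (cj S g' x) = cj S h' (\<phi> x)" by (auto simp: mem)
  have "cj S (g \<otimes> g') ` P = P" using cj_cj_image[of g g' P] g g' P by simp
  moreover have "\<phi> (cj S (g \<otimes> g') x) = cj S (h \<otimes> h') (\<phi> x)" if x: "x \<in> P" for x
  proof -
    have "cj S g x \<in> P" using g(2) x by blast
    thus ?thesis using g g' x cP c\<phi> by (simp flip: cj_cj)
  qed
  ultimately show "g \<otimes> g' \<in> extension_domain S P \<phi>" using g g' by (auto simp: mem)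
qed

end

section \<open>Automorphisms of the normalizer tower\<close>

context p_group
begin

lemma normalizer_of_normal: "R \<lhd> G \<Longrightarrow> normalizer G R = carrier G"
proof (intro subset_antisym subsetI)
  fix g assume R: "R \<lhd> G"
  note sR = normal_imp_subgroup[OF R]
  {
    assume "g \<in> normalizer G R"
    thus "g \<in> carrier G" using mem_normalizer_iff[OF subgroup.subset[OF sR]] by blast
  }
  assume "g \<in> carrier G"
  thus "g \<in> normalizer G R"
    using normal_cj[OF R]
    by (intro mem_normalizerI finite_subgroup[OF sR finite_carrier] subgroup.subset[OF sR]) auto
qed

text \<open>It lets \<open>rel_centre Z\<close> be recognized inside \<open>W\<close> alone, so that
  automorphisms of \<open>W\<close> preserving \<open>Z\<close> preserve it. An \<open>x\<close>
  central in \<open>W\<close> modulo \<open>Z\<close> lies in the self-centralizing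
  \<open>Q\<close>. If it were outside \<open>rel_centre Z\<close>, then an \<open>n\<close>
  normalizing \<open>Q\<close> but not in \<open>Q\<close> would centralize both
  \<open>rel_centre Z\<close> and \<open>x\<close>, hence \<open>Q\<close>, modulo
  \<open>Z\<close>.\<close>

lemma sc_pair_relative_centre_eq:
  assumes pr: "sc_pair Z Q" and ne: "Q \<noteq> carrier G" and W: "subgroup W G" "normalizer G Q \<subseteq> W"
  shows "{x \<in> W. \<forall>y\<in>W. inv x \<otimes> cj G y x \<in> Z} = rel_centre Z"
proof (intro subset_antisym subsetI)
  note d = sc_pairD[OF pr] and R = sc_pair_rel_centre[OF pr ne]
  have sR: "subgroup (rel_centre Z) G" using normal_rel_centre[OF d(1)] by (rule normal_imp_subgroup)
  have QN: "Q \<subseteq> normalizer G Q" using d(3) by (rule subset_normalizer)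
  note cW = subgroup.mem_carrier[OF W(1)] and cQ = subgroup.mem_carrier[OF d(3)]
  fix x
  {
    assume "x \<in> rel_centre Z"
    thus "x \<in> {x \<in> W. \<forall>y\<in>W. inv x \<otimes> cj G y x \<in> Z}"
      using R(1) QN W cW by (auto intro: rel_centreD)
  }
  assume "x \<in> {x \<in> W. \<forall>y\<in>W. inv x \<otimes> cj G y x \<in> Z}"
  hence x: "x \<in> W" "\<And>y. y \<in> W \<Longrightarrow> inv x \<otimes> cj G y x \<in> Z" by auto
  have xQ: "x \<in> Q"
    using d(6)[OF cW[OF x(1)]] commutator_sym[OF d(2) cW[OF x(1)] cQ] x(2) QN W(2) by blast
  show "x \<in> rel_centre Z"
  proof (rule ccontr)
    assume xR: "x \<notin> rel_centre Z"
    obtain n where n: "n \<in> normalizer G Q" "n \<notin> Q" using normalizer_larger[OF d(3) ne] by blast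
    have cn: "n \<in> carrier G" using n W(2) cW by blast
    define H where "H = {q \<in> Q. inv q \<otimes> cj G n q \<in> Z}"
    have "subgroup H G" unfolding H_def by (rule subgroup_fixed_mod[OF d(1,3) cn])
    moreover have "rel_centre Z \<subseteq> H" using R(1) cn by (auto simp: H_def rel_centreD)
    moreover have "x \<in> H" using xQ x(2) n W(2) by (auto simp: H_def)
    ultimately have "H = Q"
      using prime_index_eq[OF sR _ d(3) _ _ R(3) prime_p finite_carrier, of H x] xR
      by (auto simp: H_def)
    thus False using d(6)[OF cn] n(2) by (auto simp: H_def)
  qed
qed

text \<open>Climbing the chain: suppose that \<open>\<delta>\<close>, the \<open>p ^ k\<close>-th
  iterate of \<open>\<gamma>\<close>, fixes \<open>c i\<close> pointwise. For \<open>x\<close> in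
  the next member, \<open>\<delta> x = x \<otimes> z\<close> with \<open>z\<close> in
  \<open>c i\<close>, so the \<open>l\<close>-th iterate of \<open>\<delta>\<close> sends
  \<open>x\<close> to \<open>x \<otimes> z [^] l\<close>, and the exponent of the group kills
  \<open>z\<close>.\<close>

lemma chain_stabilizer_p_power:
  assumes sub: "\<And>i. i \<le> n \<Longrightarrow> subgroup (c i) G" and c0: "c 0 = {\<one>}"
    and mono: "\<And>i. i < n \<Longrightarrow> c i \<subseteq> c (Suc i)"
    and mult: "\<And>x y. x \<in> c n \<Longrightarrow> y \<in> c n \<Longrightarrow> \<gamma> (x \<otimes> y) = \<gamma> x \<otimes> \<gamma> y"
    and mem: "\<And>x. x \<in> c n \<Longrightarrow> \<gamma> x \<in> carrier G"
    and stab: "\<And>i x. i < n \<Longrightarrow> x \<in> c (Suc i) \<Longrightarrow> inv x \<otimes> \<gamma> x \<in> c i"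
  shows "\<exists>k. \<forall>x\<in>c n. (\<gamma> ^^ (p ^ k)) x = x"
proof -
  have mono_n: "c i \<subseteq> c n" if "i \<le> n" for i
    using that by (induction rule: inc_induct) (use mono in blast)+
  have inv: "\<gamma> x \<in> c i" if "x \<in> c i" "i \<le> n" for x i
  proof (cases i)
    case 0
    have "\<one> \<in> c n" using c0 mono_n[of 0] by auto
    hence "\<gamma> \<one> = \<one>" using mult[of \<one> \<one>] mem[of \<one>] by simp
    thus ?thesis using 0 that c0 by simp
  next
    case (Suc j)
    have cx: "x \<in> carrier G" using that sub subgroup.mem_carrier by metis
    have "x \<in> c n" using that mono_n by blast
    have "inv x \<otimes> \<gamma> x \<in> c i" using stab[of j x] mono[of j] that Suc by auto
    hence "x \<otimes> (inv x \<otimes> \<gamma> x) \<in> c i" using that sub by (simp add: subgroup.m_closed)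
    thus ?thesis using cx mem[OF \<open>x \<in> c n\<close>] by simp
  qed
  obtain e where e: "\<forall>x\<in>carrier G. x [^] (p ^ e) = \<one>" using pow_order_p by blast
  have "i \<le> n \<Longrightarrow> \<exists>k. \<forall>x\<in>c i. (\<gamma> ^^ (p ^ k)) x = x" for i
  proof (induction i)
    case 0
    have "\<gamma> \<one> = \<one>" using inv[of \<one> 0] c0 by simp
    hence "(\<gamma> ^^ j) \<one> = \<one>" for j by (induction j) auto
    thus ?case using c0 by auto
  next
    case (Suc i)
    have "i \<le> n" using Suc.prems by simp
    from Suc.IH[OF this] obtain k where k: "\<forall>x\<in>c i. (\<gamma> ^^ (p ^ k)) x = x" by (rule exE)
    define \<delta> where "\<delta> = \<gamma> ^^ (p ^ k)"
    have sI: "subgroup (c i) G" using sub Suc.prems by simp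
    have ci: "x \<in> carrier G" if "x \<in> c (Suc i)" for x
      by (rule subgroup.mem_carrier[OF sub[OF Suc.prems] that])
    have sub_i: "c i \<subseteq> c (Suc i)" using mono Suc.prems by simp
    have pw: "\<exists>z\<in>c i. (\<gamma> ^^ l) x = x \<otimes> z" if x: "x \<in> c (Suc i)" for x l
    proof (induction l)
      case 0
      thus ?case using ci[OF x] sI by (auto intro!: bexI[of _ \<one>] simp: subgroup.one_closed)
    next
      case (Suc l)
      then obtain z where z: "z \<in> c i" "(\<gamma> ^^ l) x = x \<otimes> z" by blast
      have cn: "x \<in> c n" "z \<in> c n" using x z mono_n \<open>Suc i \<le> n\<close> sub_i by (meson subsetD)+
      have cc: "x \<in> carrier G" "z \<in> carrier G" using x z ci sub_i by auto
      have "inv x \<otimes> \<gamma> x \<in> c i" using stab x \<open>Suc i \<le> n\<close> by simp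
      moreover have "\<gamma> z \<in> c i" using inv z \<open>Suc i \<le> n\<close> by simp
      ultimately have "inv x \<otimes> \<gamma> x \<otimes> \<gamma> z \<in> c i"
        using sI by (simp add: subgroup.m_closed)
      moreover have "(\<gamma> ^^ Suc l) x = x \<otimes> (inv x \<otimes> \<gamma> x \<otimes> \<gamma> z)"
        using z mult[OF cn] mem[OF cn(1)] mem[OF cn(2)] cc by (simp add: m_assoc)
      ultimately show ?case by blast
    qed
    have "(\<gamma> ^^ (p ^ (k + e))) x = x" if x: "x \<in> c (Suc i)" for x
    proof -
      obtain z where z: "z \<in> c i" "\<delta> x = x \<otimes> z" using pw[OF x] by (auto simp: \<delta>_def)
      have cc: "x \<in> carrier G" "z \<in> carrier G" using x z ci sub_i by auto
      have cx: "x \<in> c n" using x mono_n[OF Suc.prems] by blast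
      have cz: "z [^] (l::nat) \<in> c i" for l
        using z(1) sI by (induction l) (auto simp: subgroup.one_closed subgroup.m_closed)
      note cn = cx cz
      have \<delta>m: "(\<gamma> ^^ l) (x \<otimes> y) = (\<gamma> ^^ l) x \<otimes> (\<gamma> ^^ l) y" if "y \<in> c i" for l y
      proof -
        have "y \<in> c n" using that mono_n[of i] Suc.prems by auto
        have pn: "(\<gamma> ^^ l) u \<in> c n" if "u \<in> c n" for u l
          using that by (induction l) (auto intro: inv)
        show ?thesis by (induction l) (auto simp: mult pn cn \<open>y \<in> c n\<close>)
      qed
      have "(\<delta> ^^ l) x = x \<otimes> z [^] l" for l
      proof (induction l)
        case (Suc l)
        have "(\<delta> ^^ Suc l) x = \<delta> x \<otimes> \<delta> (z [^] l)"
          using Suc \<delta>m[OF cn(2)] by (simp add: \<delta>_def)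
        also have "\<dots> = x \<otimes> z [^] Suc l"
          using z k cn cc nat_pow_Suc2[OF cc(2), of l] by (simp add: \<delta>_def m_assoc)
        finally show ?case .
      qed (use cc in simp)
      hence "(\<delta> ^^ (p ^ e)) x = x" using e cc by simp
      thus ?thesis by (simp add: \<delta>_def funpow_mult power_add)
    qed
    thus ?case by blast
  qed
  thus ?thesis by blast
qed

end

section \<open>The towers of a pearl and of its conjugates\<close>

text \<open>The assumptions on \<open>E\<close> are chosen to pass to each of its \<F>-conjugates,
  so that every conjugate has a tower of its own and the orders of the terms can be
  compared.\<close>

locale pearl_tower = saturated_fusion_system p S F
  for p :: nat and S (structure) and F +
  fixes E :: "'a set" and m :: nat
  assumes E: "subgroup E S" and centric_E: "centric S F E"
    and shape: "card E = p ^ 2 \<or> \<not> comm_group (S\<lparr>carrier := E\<rparr>) \<and> card E = p ^ 3"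
    and order_S: "order S = p ^ m * card E"
begin

lemma ex_pearl_base_image:
  assumes \<phi>: "\<phi> \<in> F E (carrier S)"
  shows "\<exists>Z. pearl_base Z (\<phi> ` E)"
proof -
  have s: "subgroup (\<phi> ` E) S" by (rule F_image_subgroup[OF \<phi>])
  have c: "centralizer S (\<phi> ` E) \<subseteq> \<phi> ` E" using centric_E \<phi> by (simp add: centric_def)
  have card: "card (\<phi> ` E) = card E" using F_card_image[OF \<phi>] by blast
  show ?thesis
  proof (cases "card E = p ^ 2")
    case True
    thus ?thesis using pearl_base_abelian[OF s c] card by auto
  next
    case False
    hence na: "\<not> comm_group (S\<lparr>carrier := E\<rparr>)" "card E = p ^ 3" using shape by auto
    have "\<not> comm_group (S\<lparr>carrier := \<phi> ` E\<rparr>)"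
    proof
      assume "comm_group (S\<lparr>carrier := \<phi> ` E\<rparr>)"
      hence comm: "a \<otimes> b = b \<otimes> a" if "a \<in> \<phi> ` E" "b \<in> \<phi> ` E" for a b
        using that comm_monoid.m_comm[OF comm_group.axioms(1)] by fastforce
      have "x \<otimes> y = y \<otimes> x" if "x \<in> E" "y \<in> E" for x y
      proof -
        have "\<phi> (x \<otimes> y) = \<phi> (y \<otimes> x)"
          using comm[of "\<phi> x" "\<phi> y"] that F_mult[OF \<phi>] by simp
        thus ?thesis using that F_eq[OF \<phi>] subgroup.m_closed[OF E] by simp
      qed
      thus False using na subgroup_imp_group[OF E] by (auto intro!: group.group_comm_groupI)
    qed
    thus ?thesis using pearl_base_nonabelian[OF s c] card na by auto
  qed
qed

text \<open>Chosen by \<open>SOME\<close> so that both shapes of \<open>E\<close> share all further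
  arguments; these see only the properties collected in \<open>pearl_base\<close>.\<close>

definition Z0 :: "'a set" where "Z0 = (SOME Z. pearl_base Z E)"

lemma pearl_base_Z0: "pearl_base Z0 E"
proof -
  have "(\<lambda>x\<in>E. x) \<in> F E (carrier S)"
    by (rule F_incl[OF E subgroup_self subgroup.subset[OF E]])
  hence "\<exists>Z. pearl_base Z ((\<lambda>x\<in>E. x) ` E)" by (rule ex_pearl_base_image)
  hence "\<exists>Z. pearl_base Z E" by simp
  thus ?thesis unfolding Z0_def by (rule someI_ex)
qed

abbreviation N :: "nat \<Rightarrow> 'a set" where "N j \<equiv> iter_normalizer S E j"

definition Zs :: "nat \<Rightarrow> 'a set" where "Zs j = (rel_centre ^^ j) Z0"

lemma Zs_Suc: "Zs (Suc j) = rel_centre (Zs j)" and Zs_0: "Zs 0 = Z0"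
  by (simp_all add: Zs_def)

lemma tower: "j \<le> m \<Longrightarrow> sc_pair (Zs j) (N j)" and card_N: "j \<le> m \<Longrightarrow> card (N j) = p ^ j * card E"
  using normalizer_tower[OF _ order_S, of Z0 j] pearl_base_Z0
  by (auto simp: pearl_base_def Zs_def)

lemma N_subgroup: "subgroup (N j) S"
proof (induction j)
  case (Suc j)
  thus ?case by (simp add: subgroup_normalizer subgroup.subset)
qed (simp add: E)

lemma N_subset_Suc: "N j \<subseteq> N (Suc j)"
  using subset_normalizer[OF N_subgroup] by simp

lemma N_mono: "i \<le> j \<Longrightarrow> N i \<subseteq> N j"
  by (induction rule: dec_induct) (use N_subset_Suc in blast)+

lemma E_subset_N: "E \<subseteq> N j"
  using N_mono[of 0 j] by simp

lemma card_E_pos: "0 < card E"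
  using E finite_carrier by (rule subgroup.finite_imp_card_positive)

lemma N_proper: "j < m \<Longrightarrow> N j \<noteq> carrier S"
  using card_N[of j] order_S card_E_pos prime_gt_1_nat[OF prime_p] by (auto simp: order_def)

lemma mem_N_Suc: "g \<in> N (Suc j) \<longleftrightarrow> g \<in> carrier S \<and> cj S g ` N j = N j"
  using mem_normalizer_iff[OF subgroup.subset[OF N_subgroup]] by simp

lemma Zs_subgroup: "j \<le> m \<Longrightarrow> subgroup (Zs j) S" and Zs_normal: "j \<le> m \<Longrightarrow> Zs j \<lhd> S"
  using sc_pairD[OF tower] by blast+

lemma Zs_normal_Suc: "j < m \<Longrightarrow> Zs (Suc j) \<lhd> S"
  using normal_rel_centre[OF Zs_normal] by (simp add: Zs_Suc)

lemma Zs_subgroup_Suc: "j < m \<Longrightarrow> subgroup (Zs (Suc j)) S"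
  using Zs_normal_Suc normal_imp_subgroup by blast

lemma Zs_step:
  assumes "j < m"
  shows "Zs j \<subseteq> Zs (Suc j)" "Zs (Suc j) \<subseteq> N j" "card (Zs (Suc j)) = p * card (Zs j)"
    "card (N j) = p * card (Zs (Suc j))"
  using sc_pair_rel_centre[OF tower N_proper] subset_rel_centre[OF Zs_normal] assms by (auto simp: Zs_Suc)

text \<open>By induction the image of \<open>N (Suc j)\<close> normalizes the image of
  \<open>N j\<close>. The inclusion is an equality because the tower over the conjugate of
  \<open>E\<close> has terms of the same orders.\<close>

lemma iter_normalizer_image:
  assumes "j \<le> m" "\<phi> \<in> F (N j) (carrier S)"
  shows "iter_normalizer S (\<phi> ` E) j = \<phi> ` N j"
  using assms
proof (induction j arbitrary: \<phi>)
  case (Suc j)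
  note \<phi> = Suc.prems(2)
  let ?E = "\<phi> ` E"
  have r: "restrict \<phi> (N j) \<in> F (N j) (carrier S)"
    by (rule F_restrict[OF \<phi> N_subgroup N_subset_Suc])
  have "restrict \<phi> (N j) ` A = \<phi> ` A" if "A \<subseteq> N j" for A using that by (auto simp: image_iff)
  hence IH: "iter_normalizer S ?E j = \<phi> ` N j"
    using Suc.IH[OF _ r] Suc.prems E_subset_N[of j] by simp
  have rE: "restrict \<phi> E \<in> F E (carrier S)" by (rule F_restrict[OF \<phi> E E_subset_N])
  hence "\<exists>Z. pearl_base Z (restrict \<phi> E ` E)" by (rule ex_pearl_base_image)
  then obtain Z where Z: "sc_pair Z ?E" by (auto simp: pearl_base_def)
  have cE: "card ?E = card E" using F_card_image[OF \<phi> E_subset_N] .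
  hence "card (iter_normalizer S ?E (Suc j)) = p ^ Suc j * card E"
    using normalizer_tower[OF Z, of m "Suc j"] order_S Suc.prems by simp
  hence card: "card (iter_normalizer S ?E (Suc j)) = card (\<phi> ` N (Suc j))"
    using card_N[OF Suc.prems(1)] F_card_image[OF \<phi> order_refl] by simp
  have sI: "\<phi> ` N j \<subseteq> carrier S" using F_carrier[OF \<phi>] N_subset_Suc[of j] by blast
  have "\<phi> ` N (Suc j) \<subseteq> iter_normalizer S ?E (Suc j)"
  proof (rule image_subsetI)
    fix n assume n: "n \<in> N (Suc j)"
    have "cj S (\<phi> n) (\<phi> x) \<in> \<phi> ` N j" if x: "x \<in> N j" for x
    proof -
      have "\<phi> (cj S n x) = cj S (\<phi> n) (\<phi> x)" using F_cj[OF \<phi> n] x N_subset_Suc by blast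
      moreover have "cj S n x \<in> N j" using n x mem_N_Suc[of n j] by blast
      ultimately show ?thesis by (metis imageI)
    qed
    thus "\<phi> n \<in> iter_normalizer S ?E (Suc j)"
      using mem_normalizerI[OF finite_subset[OF sI finite_carrier] sI F_carrier[OF \<phi> n]] IH by auto
  qed
  moreover have "finite (iter_normalizer S ?E (Suc j))"
  proof -
    have "subgroup (iter_normalizer S ?E (Suc j)) S" using IH sI by (simp add: subgroup_normalizer)
    thus ?thesis using finite_subgroup finite_carrier by blast
  qed
  ultimately show ?case using card card_subset_eq by metis
qed simp

text \<open>The normalizer of a conjugate of \<open>N j\<close> is term \<open>Suc j\<close> of the
  tower over a conjugate of \<open>E\<close>, and its order \<open>p ^ Suc j * card E\<close> does
  not depend on the conjugate.\<close>

lemma N_fully_normalized: "j < m \<Longrightarrow> fully_normalized S F (N j)"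
  unfolding fully_normalized_def
proof
  fix \<phi> assume j: "j < m" and \<phi>: "\<phi> \<in> F (N j) (carrier S)"
  have rE: "restrict \<phi> E \<in> F E (carrier S)" by (rule F_restrict[OF \<phi> E E_subset_N])
  hence "\<exists>Z. pearl_base Z (restrict \<phi> E ` E)" by (rule ex_pearl_base_image)
  then obtain Z where Z: "sc_pair Z (\<phi> ` E)" by (auto simp: pearl_base_def)
  have cE: "card (\<phi> ` E) = card E" using F_card_image[OF \<phi> E_subset_N] .
  have "card (iter_normalizer S (\<phi> ` E) (Suc j)) = p ^ Suc j * card E"
    using normalizer_tower[OF Z, of m "Suc j"] order_S j cE by simp
  thus "card (normalizer S (\<phi> ` N j)) \<le> card (normalizer S (N j))"
    using iter_normalizer_image[OF _ \<phi>] j card_N[of "Suc j"] by simp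
qed

lemma Z0_invariant:
  assumes "\<gamma> \<in> F (N j) (N j)" "x \<in> Z0" shows "\<gamma> x \<in> Z0"
proof (cases "Z0 = {\<one>}")
  case True
  thus ?thesis using assms F_one by simp
next
  case False
  hence Z: "Z0 = {x \<in> N j. \<forall>y\<in>N j. cj S y x = x}"
    using pearl_base_Z0 N_subgroup[of j] E_subset_N[of j] unfolding pearl_base_def by blast
  have "x \<in> {x \<in> N j. \<forall>y\<in>N j. cj S y x = x}"
    using assms(2) by (rule subst[OF Z])
  hence x: "x \<in> N j" "\<And>y. y \<in> N j \<Longrightarrow> cj S y x = x" by blast+
  have "cj S y (\<gamma> x) = \<gamma> x" if "y \<in> N j" for y
  proof -
    have "y \<in> \<gamma> ` N j" using F_Aut_image[OF assms(1)] that by simp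
    then obtain y' where "y' \<in> N j" "y = \<gamma> y'" by blast
    thus ?thesis using F_cj[OF assms(1), of y' x] x by simp
  qed
  hence "\<gamma> x \<in> {x \<in> N j. \<forall>y\<in>N j. cj S y x = x}" using F_mem[OF assms(1) x(1)] by blast
  thus ?thesis by (rule subst[OF Z[symmetric]])
qed

text \<open>Within \<open>N j\<close> the group \<open>Zs (Suc i)\<close> is the relative centre
  over \<open>Zs i\<close>. This description needs \<open>N (Suc i)\<close> inside
  \<open>N j\<close>, so the induction stops at \<open>Zs j\<close> and leaves
  \<open>Zs (Suc j)\<close> to \<open>Zs_top_invariant\<close>.\<close>

lemma Zs_invariant:
  assumes \<gamma>: "\<gamma> \<in> F (N j) (N j)" and "i \<le> j" "j \<le> m" "x \<in> Zs i"
  shows "\<gamma> x \<in> Zs i"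
  using assms(2,4)
proof (induction i arbitrary: x)
  case 0
  thus ?case using Z0_invariant[OF \<gamma>] by (simp add: Zs_0)
next
  case (Suc i)
  have i: "i < m" using Suc.prems assms(3) by simp
  have Z: "{x \<in> N j. \<forall>y\<in>N j. inv x \<otimes> cj S y x \<in> Zs i} = Zs (Suc i)"
    unfolding Zs_Suc using i N_mono[of "Suc i" j] Suc.prems
    by (intro sc_pair_relative_centre_eq[OF tower N_proper N_subgroup]) auto
  have x: "x \<in> N j" "\<And>y. y \<in> N j \<Longrightarrow> inv x \<otimes> cj S y x \<in> Zs i" using Suc.prems Z by blast+
  have "inv (\<gamma> x) \<otimes> cj S y (\<gamma> x) \<in> Zs i" if "y \<in> N j" for y
  proof -
    have "y \<in> \<gamma> ` N j" using F_Aut_image[OF \<gamma>] that by simp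
    then obtain y' where y': "y' \<in> N j" "y = \<gamma> y'" by blast
    have "\<gamma> (inv x \<otimes> cj S y' x) \<in> Zs i" using Suc.IH x(2)[OF y'(1)] Suc.prems by simp
    thus ?thesis using F_cm[OF \<gamma> y'(1) x(1)] y'(2) by simp
  qed
  thus ?case using Z F_mem[OF \<gamma> x(1)] by blast
qed

text \<open>Otherwise \<open>Z\<^sub>j\<^sub>+\<^sub>1\<close>, which is normal in \<open>S\<close>, would be \<open>\<F>\<close>-conjugate to the fully normalized
  subgroup \<open>N\<^sup>j\<^sup>-\<^sup>1\<close>: all other maximal subgroups of \<open>N\<^sup>j\<close> above \<open>Z\<^sub>j\<close> are \<open>N\<^sup>j\<^sup>+\<^sup>1\<close>-conjugate to it.\<close>

lemma Zs_top_invariant: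
  assumes \<gamma>: "\<gamma> \<in> F (N (Suc i)) (N (Suc i))" and i: "Suc i < m" and x: "x \<in> Zs (Suc (Suc i))"
  shows "\<gamma> x \<in> Zs (Suc (Suc i))"
proof (rule ccontr)
  define Q Z M R where "Q = N (Suc i)" and "Z = Zs (Suc i)" and "M = N i" and "R = Zs (Suc (Suc i))"
  assume "\<gamma> x \<notin> Zs (Suc (Suc i))"
  hence x': "x \<in> R" "\<gamma> x \<notin> R" using x by (auto simp: R_def)
  note \<gamma>' = \<gamma>[folded Q_def]
  have pr: "sc_pair Z Q" unfolding Z_def Q_def using i by (intro tower) simp
  have neQ: "Q \<noteq> carrier S" unfolding Q_def by (rule N_proper[OF i])
  note d = sc_pairD[OF pr]
  have R: "R = rel_centre Z" by (simp add: R_def Z_def Zs_Suc)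
  have nR: "R \<lhd> S" unfolding R by (rule normal_rel_centre[OF d(1)])
  note sR = normal_imp_subgroup[OF nR] and step = sc_pair_rel_centre[OF pr neQ, folded R]
  have ZR: "Z \<subseteq> R" unfolding R by (rule subset_rel_centre[OF d(1)])
  have sM: "subgroup M S" by (simp add: M_def N_subgroup)
  have MQ: "M \<subseteq> Q" unfolding M_def Q_def by (rule N_subset_Suc)
  have ZM: "Z \<subseteq> M" and cardM: "card M = p * card Z"
    using Zs_step[of i] i by (auto simp: Z_def M_def)
  have normM: "normalizer S M = Q" by (simp add: M_def Q_def)
  define X where "X = \<gamma> ` R"
  have sX: "subgroup X S" unfolding X_def by (rule F_subset_image[OF \<gamma>' sR step(1)])
  have cardX: "card X = p * card Z"
    using F_card_image[OF \<gamma>' step(1)] step(2) by (simp add: X_def)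
  have "\<gamma> ` Z = Z"
    using Zs_invariant[OF \<gamma>, of "Suc i"] i d(4) by (intro F_Aut_invariant[OF \<gamma>']) (auto simp: Z_def)
  hence ZX: "Z \<subseteq> X" using ZR by (auto simp: X_def)
  have XQ: "X \<subseteq> Q" using step(1) F_mem[OF \<gamma>'] by (auto simp: X_def)
  have XR: "\<gamma> x \<in> X" using x' by (simp add: X_def)
  have "M \<noteq> R"
  proof
    assume "M = R"
    hence "normalizer S M = carrier S" using normalizer_of_normal[OF nR] by simp
    thus False using normM neQ by simp
  qed
  hence "\<not> M \<subseteq> R"
    using card_subset_eq[OF finite_subgroup[OF sR finite_carrier], of M] cardM step(2) by auto
  then obtain y where y: "y \<in> M" "y \<notin> R" by blast
  have cy: "y \<in> carrier S" using y sM by (simp add: subgroup.mem_carrier)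
  have sXR: "subgroup (X \<inter> R) S" using sX sR by (rule subgroups_Inter_pair)
  define A where "A = (\<lambda>x. R #> x) ` Q"
  have "card A * card R = card Q" unfolding A_def by (rule card_rcosets_times_card[OF sR d(3) step(1)])
  hence cardA: "card A = p"
    using step(3) subgroup.finite_imp_card_positive[OF sR finite_carrier] by simp
  have coset: "\<exists>r\<in>R. a = r \<otimes> b" if "R #> a = R #> b" "a \<in> carrier S" for a b
    using rcos_self[OF that(2) sR] that(1) by (auto simp: r_coset_def)
  \<comment> \<open>\<open>X\<close> is not inside \<open>R\<close>, so it meets every coset of
    \<open>R\<close> in \<open>Q\<close>, in particular that of \<open>y\<close>. The common element
    has the form \<open>y \<otimes> z\<close> with \<open>z\<close> in \<open>R\<close>, and
    \<open>sc_pair_step\<close> supplies an \<open>n\<close> moving \<open>y\<close> to it modulo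
    \<open>Z\<close>. Then \<open>X\<close> and the conjugate of \<open>M\<close> by
    \<open>n\<close> are both generated by \<open>Z\<close> and this one element.\<close>
  have "(\<lambda>x. R #> x) ` X = A"
  proof (rule commutator_map_surj[OF sX sXR _ _ cardA])
    show "X \<inter> R \<noteq> X" using XR x' by blast
    show "R #> h \<in> A" if "h \<in> X" for h using that XQ by (auto simp: A_def)
    fix h h' assume h: "h \<in> X" "h' \<in> X" "R #> h = R #> h'"
    have ch: "h \<in> carrier S" "h' \<in> carrier S" using h subgroup.mem_carrier[OF sX] by auto
    obtain r where r: "r \<in> R" "h = r \<otimes> h'" using coset[OF h(3) ch(1)] by blast
    hence "h \<otimes> inv h' \<in> R" using ch subgroup.mem_carrier[OF sR] by (simp add: m_assoc)
    moreover have "h \<otimes> inv h' \<in> X" using h sX by (simp add: subgroup.m_closed subgroup.m_inv_closed)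
    ultimately show "h \<otimes> inv h' \<in> X \<inter> R" by blast
  qed blast
  moreover have "R #> y \<in> A" using y MQ by (auto simp: A_def)
  ultimately obtain v where v: "v \<in> X" "R #> v = R #> y" by (metis imageE)
  have cv: "v \<in> carrier S" using v sX by (simp add: subgroup.mem_carrier)
  obtain r where r: "r \<in> R" "v = r \<otimes> y" using coset[OF v(2) cv] by blast
  have cr: "r \<in> carrier S" using r sR by (simp add: subgroup.mem_carrier)
  define z where "z = cj S y r"
  have z: "z \<in> R" "v = y \<otimes> z" using normal_cj[OF nR cy r(1)] r cr cy by (auto simp: z_def cj_def m_assoc)
  obtain n where n: "n \<in> normalizer S Q" "inv (y \<otimes> z) \<otimes> cj S n y \<in> Z"
    using sc_pair_step(4)[OF pr neQ, folded R] y z MQ by blast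
  have cn: "n \<in> carrier S" using n mem_normalizer_iff subgroup.subset[OF d(3)] by blast
  have "v \<otimes> (inv v \<otimes> cj S n y) \<in> X" using n(2) z(2) v(1) ZX sX by (auto simp: subgroup.m_closed)
  hence yX: "cj S n y \<in> X" using cv cn cy by simp
  have yZ: "cj S n y \<notin> Z"
  proof
    assume "cj S n y \<in> Z"
    hence "cj S (inv n) (cj S n y) \<in> Z" using cn by (intro normal_cj[OF d(1) inv_closed])
    thus False using y ZR cn cy by auto
  qed
  have sMn: "subgroup (cj S n ` M) S" by (rule subgroup_cj_image[OF sM cn])
  have ZMn: "Z \<subseteq> cj S n ` M"
  proof
    fix w assume w: "w \<in> Z"
    have "cj S (inv n) w \<in> M" using normal_cj[OF d(1) _ w] ZM cn by auto
    moreover have "w = cj S n (cj S (inv n) w)" using w cn subgroup.mem_carrier[OF d(2)] by simp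
    ultimately show "w \<in> cj S n ` M" by blast
  qed
  have cMn: "card (cj S n ` M) = p * card Z" using card_cj_image[OF cn subgroup.subset[OF sM]] cardM by simp
  have sI: "subgroup (cj S n ` M \<inter> X) S" using sMn sX by (rule subgroups_Inter_pair)
  have mI: "cj S n y \<in> cj S n ` M \<inter> X" using yX y by blast
  have "cj S n ` M \<inter> X = cj S n ` M"
    using prime_index_eq[OF d(2) sI sMn _ _ cMn prime_p finite_carrier mI yZ] ZMn ZX by blast
  moreover have "cj S n ` M \<inter> X = X"
    using prime_index_eq[OF d(2) sI sX _ _ cardX prime_p finite_carrier mI yZ] ZMn ZX by blast
  ultimately have MX: "cj S n ` M = X" by blast
  obtain \<gamma>' where g': "\<gamma>' \<in> F Q Q" "\<forall>x\<in>Q. \<gamma>' (\<gamma> x) = x" using F_Aut_inverse[OF \<gamma>'] by blast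
  have "(\<lambda>x\<in>M. cj S n x) \<in> F M Q" using MX XQ by (intro F_conj[OF sM d(3) cn]) auto
  from F_comp[OF this g'(1)] have \<phi>: "(\<lambda>x\<in>M. \<gamma>' ((\<lambda>x\<in>M. cj S n x) x)) \<in> F M Q" .
  have im: "(\<lambda>x\<in>M. \<gamma>' ((\<lambda>x\<in>M. cj S n x) x)) ` M = R"
  proof -
    have "(\<lambda>x\<in>M. \<gamma>' ((\<lambda>x\<in>M. cj S n x) x)) ` M = \<gamma>' ` cj S n ` M" by (auto simp: image_iff)
    also have "\<dots> = \<gamma>' ` \<gamma> ` R" by (simp add: MX X_def)
    also have "\<dots> = R" using g'(2) step(1) by (auto simp: image_iff subset_iff)
    finally show ?thesis .
  qed
  have "(\<lambda>x\<in>M. \<gamma>' ((\<lambda>x\<in>M. cj S n x) x)) \<in> F M (carrier S)"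
    using \<phi> F_carrier[OF \<phi>] by (intro F_codomain[OF \<phi> subgroup_self]) blast
  hence "card (normalizer S R) \<le> card (normalizer S M)"
    using N_fully_normalized[of i] i im unfolding fully_normalized_def M_def by (metis Suc_lessD)
  moreover have "normalizer S R = carrier S" by (rule normalizer_of_normal[OF nR])
  ultimately have "card (carrier S) \<le> card Q" using normM by simp
  thus False
    using neQ card_seteq[OF finite_carrier subgroup.subset[OF d(3)]] by simp
qed

section \<open>The chain in \<open>N j\<close> and its stabilizer\<close>

lemma card_Z0: "card Z0 = 1 \<or> card Z0 = p"
  by (rule pearl_base_Z0[unfolded pearl_base_def, THEN conjunct2, THEN conjunct1])

lemma Z0_central: "z \<in> Z0 \<Longrightarrow> x \<in> carrier S \<Longrightarrow> cj S x z = z"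
  by (rule pearl_base_Z0[unfolded pearl_base_def, THEN conjunct2, THEN conjunct2, THEN conjunct1,
        rule_format])

lemma Z0_conj: "w \<in> E \<Longrightarrow> w \<notin> Z0 \<Longrightarrow> z \<in> Z0 \<Longrightarrow> \<exists>e\<in>E. cj S e w = w \<otimes> z"
  by (rule pearl_base_Z0[unfolded pearl_base_def, THEN conjunct2, THEN conjunct2, THEN conjunct2,
        THEN conjunct1, rule_format, OF DiffI])

text \<open>The chain \<open>1 \<le> Z\<^sub>0 < Z\<^sub>1 < \<dots> < Z\<^sub>j\<^sub>+\<^sub>1 < N\<^sup>j\<close>, whose factors have order \<open>1\<close> or \<open>p\<close>.\<close>

definition chain :: "nat \<Rightarrow> nat \<Rightarrow> 'a set" where
  "chain j i = (if i = 0 then {\<one>} else if i \<le> j + 2 then Zs (i - 1) else N j)"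

lemma chain_cases:
  assumes "i < j + 3"
  obtains "i = 0" "chain j i = {\<one>}" "chain j (Suc i) = Z0"
  | k where "i = Suc k" "k \<le> j" "chain j i = Zs k" "chain j (Suc i) = Zs (Suc k)"
  | "i = j + 2" "chain j i = Zs (Suc j)" "chain j (Suc i) = N j"
proof (cases i)
  case 0
  thus ?thesis using that(1) by (simp add: chain_def Zs_0)
next
  case (Suc k)
  show ?thesis
  proof (cases "k \<le> j")
    case True
    thus ?thesis using Suc that(2)[of k] by (simp add: chain_def)
  next
    case False
    hence "k = Suc j" using Suc assms by simp
    thus ?thesis using Suc that(3) by (simp add: chain_def)
  qed
qed

lemma chain_0: "chain j 0 = {\<one>}" and chain_top: "chain j (j + 3) = N j"
  by (simp_all add: chain_def)

lemma Zs_subgroup': "j < m \<Longrightarrow> i \<le> Suc j \<Longrightarrow> subgroup (Zs i) S"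
  by (cases i) (use Zs_subgroup Zs_subgroup_Suc in auto)

lemma chain_subgroup: "j < m \<Longrightarrow> subgroup (chain j i) S"
  using Zs_subgroup'[of j "i - 1"] N_subgroup triv_subgroup by (auto simp: chain_def)

lemma chain_mono: "j < m \<Longrightarrow> i < j + 3 \<Longrightarrow> chain j i \<subseteq> chain j (Suc i)"
  using Zs_step subgroup.one_closed[OF Zs_subgroup[of 0]]
  by (erule_tac chain_cases) (auto simp: Zs_0)

lemma chain_mono_le:
  assumes "j < m" "i \<le> k" "k \<le> j + 3" shows "chain j i \<subseteq> chain j k"
  using assms(2,3)
proof (induction rule: dec_induct)
  case (step n)
  thus ?case using chain_mono[OF assms(1), of n] by auto
qed simp

lemma chain_subset: "j < m \<Longrightarrow> i \<le> j + 3 \<Longrightarrow> chain j i \<subseteq> N j"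
  using chain_mono_le[of j i "j + 3"] chain_top by simp

lemma chain_factor:
  assumes "j < m" "i < j + 3"
  shows "chain j (Suc i) = chain j i \<or> card (chain j (Suc i)) = p * card (chain j i)"
  using assms(2)
proof (cases rule: chain_cases)
  case 1
  have "Z0 = {\<one>}" if "card Z0 = 1"
    using that subgroup.one_closed[OF Zs_subgroup[of 0]] by (auto simp: Zs_0 card_1_singleton_iff)
  thus ?thesis using 1 card_Z0 by auto
qed (use Zs_step assms in auto)

text \<open>All factors but the last are central in a quotient of \<open>S\<close>; on the last one,
  of order \<open>p\<close>, the normalizer of \<open>N j\<close> acts trivially because it acts as
  a p-group.\<close>

lemma chain_conj:
  assumes "j < m" "i < j + 3" "g \<in> N (Suc j)" "x \<in> chain j (Suc i)"
  shows "inv x \<otimes> cj S g x \<in> chain j i"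
  using assms(2)
proof (cases rule: chain_cases)
  have cg: "g \<in> carrier S" by (rule subgroup.mem_carrier[OF N_subgroup assms(3)])
  have cx: "x \<in> carrier S" by (rule subgroup.mem_carrier[OF chain_subgroup[OF assms(1)] assms(4)])
  {
    case 1
    hence "cj S g x = x" using Z0_central cg assms(4) by simp
    thus ?thesis using 1 cx by simp
  next
    case (2 k)
    thus ?thesis using rel_centreD[of x "Zs k" g] cg assms(4) by (simp add: Zs_Suc)
  next
    case 3
    thus ?thesis
      using sc_pair_step(3)[OF tower[OF less_imp_le[OF assms(1)]] N_proper[OF assms(1)], of g x] assms
      by (simp add: Zs_Suc)
  }
qed

text \<open>The premise \<open>top\<close> stands in for \<open>Zs_top_invariant\<close> when
  \<open>j = 0\<close>, where no earlier term of the tower is available to distinguish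
  \<open>Zs 1\<close>.\<close>

lemma chain_invariant:
  assumes j: "j < m" and \<gamma>: "\<gamma> \<in> F (N j) (N j)" and top: "j = 0 \<Longrightarrow> (\<And>x. x \<in> Zs 1 \<Longrightarrow> \<gamma> x \<in> Zs 1)"
    and i: "i \<le> j + 3" and x: "x \<in> chain j i"
  shows "\<gamma> x \<in> chain j i"
proof (cases "i = 0 \<or> i = j + 3")
  case True
  thus ?thesis using x F_one[OF \<gamma>] F_mem[OF \<gamma>] by (auto simp: chain_0 chain_top)
next
  case False
  then obtain k where k: "i = Suc k" "k \<le> Suc j" using i by (cases i) auto
  hence eq: "chain j i = Zs k" by (simp add: chain_def)
  have "\<gamma> x \<in> Zs k"
  proof (cases "k \<le> j")
    case True
    thus ?thesis using Zs_invariant[OF \<gamma>, of k x] x eq j by simp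
  next
    case False
    hence kj: "k = Suc j" using k by simp
    show ?thesis
    proof (cases j)
      case 0
      thus ?thesis using top kj x eq by simp
    next
      case (Suc l)
      thus ?thesis using Zs_top_invariant[of \<gamma> l x] \<gamma> j kj x eq by simp
    qed
  qed
  thus ?thesis using eq by simp
qed

text \<open>Trivial action on each factor, which is stronger than invariance of the members of the
  chain.\<close>

definition stabilizes :: "nat \<Rightarrow> ('a \<Rightarrow> 'a) \<Rightarrow> bool" where
  "stabilizes j \<gamma> \<longleftrightarrow> (\<forall>i < j + 3. \<forall>x \<in> chain j (Suc i). inv x \<otimes> \<gamma> x \<in> chain j i)"

lemma stabilizesD: "stabilizes j \<gamma> \<Longrightarrow> i < j + 3 \<Longrightarrow> x \<in> chain j (Suc i) \<Longrightarrow> inv x \<otimes> \<gamma> x \<in> chain j i"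
  by (simp add: stabilizes_def)

lemma stabilizes_invariant:
  assumes "j < m" "\<gamma> \<in> F (N j) (N j)" "stabilizes j \<gamma>" "i \<le> j + 3" "x \<in> chain j i"
  shows "\<gamma> x \<in> chain j i"
proof (cases i)
  case 0
  thus ?thesis using assms F_one by (simp add: chain_0)
next
  case (Suc k)
  have x: "x \<in> N j" using chain_subset[OF assms(1,4)] assms(5) by blast
  have "inv x \<otimes> \<gamma> x \<in> chain j i"
    using stabilizesD[OF assms(3), of k x] chain_mono[OF assms(1), of k] assms Suc by auto
  hence "x \<otimes> (inv x \<otimes> \<gamma> x) \<in> chain j i"
    using assms chain_subgroup by (simp add: subgroup.m_closed)
  thus ?thesis using F_dom_carrier[OF assms(2) x] F_carrier[OF assms(2) x] by simp
qed

text \<open>The stabilizer of the chain is a \<open>p\<close>-group containing \<open>Aut\<^sub>S(N\<^sup>j)\<close>, which is a Sylow subgroup;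
  so both agree.\<close>

lemma stabilizes_conj:
  assumes j: "j < m" and \<gamma>: "\<gamma> \<in> F (N j) (N j)" "stabilizes j \<gamma>"
  shows "\<exists>g\<in>N (Suc j). \<forall>x\<in>N j. \<gamma> x = cj S g x"
proof -
  define Q where "Q = N j"
  have Q: "subgroup Q S" by (simp add: Q_def N_subgroup)
  interpret A: group "Aut_group S F Q" by (rule Aut_group_simps(4)[OF Q])
  define C where "C = {\<gamma> \<in> F Q Q. stabilizes j \<gamma>}"
  have csub: "x \<in> Q" if "x \<in> chain j i" "i \<le> j + 3" for x i
    using that chain_subset[OF j] by (auto simp: Q_def)
  have cc: "x \<in> carrier S" if "x \<in> chain j i" for x i
    by (rule subgroup.mem_carrier[OF chain_subgroup[OF j] that])
  have sC: "subgroup C (Aut_group S F Q)"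
  proof (rule A.subgroupI)
    show "C \<subseteq> carrier (Aut_group S F Q)" by (auto simp: C_def Aut_group_simps[OF Q])
    have "stabilizes j (\<lambda>x\<in>Q. x)"
      using csub cc subgroup.one_closed[OF chain_subgroup[OF j]] by (auto simp: stabilizes_def)
    hence "(\<lambda>x\<in>Q. x) \<in> C" using F_incl[OF Q Q order_refl] by (simp add: C_def)
    thus "C \<noteq> {}" by blast
  next
    fix \<alpha> assume "\<alpha> \<in> C"
    hence a: "\<alpha> \<in> F Q Q" "stabilizes j \<alpha>" by (auto simp: C_def)
    obtain \<alpha>' where a': "\<alpha>' \<in> F Q Q" "\<forall>x\<in>Q. \<alpha>' (\<alpha> x) = x" "\<forall>x\<in>Q. \<alpha> (\<alpha>' x) = x"
      using F_Aut_inverse[OF a(1)] by blast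
    have "inv x \<otimes> \<alpha>' x \<in> chain j i" if i: "i < j + 3" and x: "x \<in> chain j (Suc i)" for i x
    proof -
      have xQ: "x \<in> Q" using csub x i by simp
      have "chain j (Suc i) \<subseteq> Q" using csub i by auto
      hence y: "\<alpha>' x \<in> chain j (Suc i)"
        using F_Aut_inverse_invariant[OF a(1), of \<alpha>' "chain j (Suc i)" x] a' x i
          stabilizes_invariant[OF j a(1)[unfolded Q_def] a(2)] by auto
      have "inv (\<alpha>' x) \<otimes> \<alpha> (\<alpha>' x) \<in> chain j i" using stabilizesD[OF a(2) i y] .
      hence "inv (inv (\<alpha>' x) \<otimes> x) \<in> chain j i"
        using a'(3) xQ chain_subgroup[OF j] by (simp add: subgroup.m_inv_closed)
      thus ?thesis using cc[OF x] cc[OF y] by (simp add: inv_mult_group)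
    qed
    hence "\<alpha>' \<in> C" using a' by (simp add: C_def stabilizes_def)
    moreover have "inv\<^bsub>Aut_group S F Q\<^esub> \<alpha> = \<alpha>'"
      using a' a by (intro A.inv_equality) (auto simp: Aut_group_simps[OF Q] cong: restrict_cong)
    ultimately show "inv\<^bsub>Aut_group S F Q\<^esub> \<alpha> \<in> C" by simp
  next
    fix \<alpha> \<beta> assume "\<alpha> \<in> C" "\<beta> \<in> C"
    hence a: "\<alpha> \<in> F Q Q" "stabilizes j \<alpha>" and b: "\<beta> \<in> F Q Q" "stabilizes j \<beta>" by (auto simp: C_def)
    have "inv x \<otimes> \<alpha> (\<beta> x) \<in> chain j i" if i: "i < j + 3" and x: "x \<in> chain j (Suc i)" for i x
    proof -
      define z where "z = inv x \<otimes> \<beta> x"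
      have z: "z \<in> chain j i" unfolding z_def by (rule stabilizesD[OF b(2) i x])
      have xQ: "x \<in> Q" "z \<in> Q" using csub x z i by auto
      have cx: "x \<in> carrier S" "z \<in> carrier S" using cc x z by auto
      have "\<beta> x = x \<otimes> z" using cx F_carrier[OF b(1) xQ(1)] by (simp add: z_def)
      hence "inv x \<otimes> \<alpha> (\<beta> x) = (inv x \<otimes> \<alpha> x) \<otimes> \<alpha> z"
        using F_mult[OF a(1) xQ] cx F_carrier[OF a(1)] xQ by (simp add: m_assoc)
      moreover have "inv x \<otimes> \<alpha> x \<in> chain j i" by (rule stabilizesD[OF a(2) i x])
      moreover have "\<alpha> z \<in> chain j i"
        using stabilizes_invariant[OF j a(1)[unfolded Q_def] a(2) _ z] i by simp
      ultimately show ?thesis using chain_subgroup[OF j] by (simp add: subgroup.m_closed)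
    qed
    hence "stabilizes j (\<lambda>x\<in>Q. \<alpha> (\<beta> x))" using csub by (auto simp: stabilizes_def)
    thus "\<alpha> \<otimes>\<^bsub>Aut_group S F Q\<^esub> \<beta> \<in> C"
      using a b F_comp[OF b(1) a(1)] by (simp add: C_def Aut_group_simps[OF Q])
  qed
  have sub: "conj_hom S Q Q \<subseteq> C"
  proof
    fix \<alpha> assume a: "\<alpha> \<in> conj_hom S Q Q"
    then obtain g where g: "g \<in> carrier S" "cj S g ` Q \<subseteq> Q" "\<And>x. x \<in> Q \<Longrightarrow> \<alpha> x = cj S g x"
      by (rule conj_hom_AutE) blast
    have "g \<in> N (Suc j)"
      using mem_normalizerI[OF finite_subgroup[OF Q finite_carrier] subgroup.subset[OF Q] g(1,2)]
      by (simp add: Q_def)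
    hence "stabilizes j \<alpha>" using chain_conj[OF j] csub g(3) by (auto simp: stabilizes_def)
    thus "\<alpha> \<in> C" using a conj_hom_Aut[OF Q] by (auto simp: C_def)
  qed
  have pow: "\<exists>k. \<alpha> [^]\<^bsub>Aut_group S F Q\<^esub> (p ^ k) = \<one>\<^bsub>Aut_group S F Q\<^esub>" if "\<alpha> \<in> C" for \<alpha>
  proof -
    have a: "\<alpha> \<in> F Q Q" "stabilizes j \<alpha>" using that by (auto simp: C_def)
    have "\<exists>k. \<forall>x\<in>chain j (j + 3). (\<alpha> ^^ (p ^ k)) x = x"
      using chain_subgroup[OF j] chain_0 chain_mono[OF j] a
      by (intro chain_stabilizer_p_power)
        (auto simp: chain_top Q_def F_mult F_carrier stabilizesD)
    thus ?thesis using Aut_group_pow_one[OF Q a(1)] by (simp add: chain_top Q_def)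
  qed
  have "sylow_subgroup p (conj_hom S Q Q) (Aut_group S F Q)"
    using fully_normalized_imp[OF Q] N_fully_normalized[OF j] by (simp add: Q_def)
  hence "C = conj_hom S Q Q"
    using A.sylow_subgroup_maximal[OF _ prime_p _ sC sub pow] finite_Aut
    by (simp add: Aut_group_simps[OF Q])
  hence "\<gamma> \<in> conj_hom S Q Q" using \<gamma> by (auto simp: C_def Q_def)
  then obtain g where g: "g \<in> carrier S" "cj S g ` Q \<subseteq> Q" "\<And>x. x \<in> Q \<Longrightarrow> \<gamma> x = cj S g x"
    by (rule conj_hom_AutE) blast
  have "g \<in> N (Suc j)"
    using mem_normalizerI[OF finite_subgroup[OF Q finite_carrier] subgroup.subset[OF Q] g(1,2)]
    by (simp add: Q_def)
  thus ?thesis using g by (auto simp: Q_def)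
qed

text \<open>For \<open>j > 0\<close> every member of the chain is preserved, and an automorphism of
  p-power order acts trivially on a factor of order \<open>p\<close>. So it lies in the stabilizer
  of the chain, which consists of conjugations.\<close>

lemma p_automorphism_conj:
  assumes j: "j < m" "0 < j" and \<gamma>: "\<gamma> \<in> F (N j) (N j)"
    and pow: "\<And>x. x \<in> N j \<Longrightarrow> (\<gamma> ^^ (p ^ k)) x = x"
  shows "\<exists>g\<in>N (Suc j). \<forall>x\<in>N j. \<gamma> x = cj S g x"
proof (rule stabilizes_conj[OF j(1) \<gamma>])
  have inv: "\<gamma> x \<in> chain j i" if "x \<in> chain j i" "i \<le> j + 3" for x i
    using chain_invariant[OF j(1) \<gamma> _ that(2,1)] j(2) by simp
  show "stabilizes j \<gamma>"
    unfolding stabilizes_def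
  proof (intro allI impI ballI)
    fix i x assume i: "i < j + 3" and x: "x \<in> chain j (Suc i)"
    note sub = chain_subgroup[OF j(1), of i] chain_subgroup[OF j(1), of "Suc i"]
    show "inv x \<otimes> \<gamma> x \<in> chain j i"
    proof (cases "chain j (Suc i) = chain j i")
      case True
      thus ?thesis using x inv[OF x] i sub by (auto simp: subgroup.m_closed subgroup.m_inv_closed)
    next
      case False
      hence card: "card (chain j (Suc i)) = p * card (chain j i)" using chain_factor[OF j(1) i] by blast
      have "y \<in> N j" if "y \<in> chain j (Suc i)" for y
        using that chain_subset[OF j(1), of "Suc i"] i by auto
      thus ?thesis
        using inv i F_mult[OF \<gamma>] pow x
        by (intro p_automorphism_trivial_on_prime_index[OF sub chain_mono[OF j(1) i] card prime_p
              finite_carrier, where \<gamma> = \<gamma> and k = k]) auto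
    qed
  qed
qed

section \<open>Extending automorphisms up the tower\<close>

text \<open>Preserving the chain, \<open>\<alpha>\<close> normalizes its stabilizer, which is the
  group of automorphisms of \<open>N j\<close> induced by \<open>S\<close>. Hence the domain in the
  extension axiom is the whole of \<open>N (Suc j)\<close>.\<close>

lemma extend_step:
  assumes j: "j < m" and \<alpha>: "\<alpha> \<in> F (N j) (N j)" and top: "j = 0 \<Longrightarrow> (\<And>x. x \<in> Zs 1 \<Longrightarrow> \<alpha> x \<in> Zs 1)"
  shows "\<exists>\<beta>\<in>F (N (Suc j)) (N (Suc j)). \<forall>x\<in>N j. \<beta> x = \<alpha> x"
proof -
  define Q where "Q = N j"
  have Q: "subgroup Q S" by (simp add: Q_def N_subgroup)
  note \<alpha>Q = \<alpha>[folded Q_def]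
  have csub: "x \<in> Q" if "x \<in> chain j i" "i \<le> j + 3" for x i
    using that chain_subset[OF j] by (auto simp: Q_def)
  have cc: "x \<in> carrier S" if "x \<in> chain j i" for x i
    by (rule subgroup.mem_carrier[OF chain_subgroup[OF j] that])
  have inv: "\<alpha> x \<in> chain j i" if "x \<in> chain j i" "i \<le> j + 3" for x i
    using chain_invariant[OF j \<alpha> top that(2,1)] by simp
  obtain \<alpha>' where a': "\<alpha>' \<in> F Q Q" "\<forall>x\<in>Q. \<alpha>' (\<alpha> x) = x" "\<forall>x\<in>Q. \<alpha> (\<alpha>' x) = x"
    using F_Aut_inverse[OF \<alpha>Q] by blast
  have inv': "\<alpha>' x \<in> chain j i" if x: "x \<in> chain j i" and i: "i \<le> j + 3" for x i
  proof -
    have "chain j i \<subseteq> Q" using csub i by auto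
    thus ?thesis using F_Aut_inverse_invariant[OF \<alpha>Q, of \<alpha>' "chain j i" x] a'(2) inv x i by auto
  qed
  have \<alpha>S: "\<alpha> \<in> F Q (carrier S)"
    using F_carrier[OF \<alpha>Q] by (intro F_codomain[OF \<alpha>Q subgroup_self]) blast
  have dom: "extension_domain S Q \<alpha> = N (Suc j)"
  proof (intro subset_antisym subsetI)
    fix g assume "g \<in> extension_domain S Q \<alpha>"
    thus "g \<in> N (Suc j)" using mem_extension_domain[OF \<alpha>Q] mem_N_Suc[of g j] by (simp add: Q_def)
  next
    fix g assume g: "g \<in> N (Suc j)"
    hence g': "g \<in> carrier S" "cj S g ` Q = Q" using mem_N_Suc[of g j] by (simp_all add: Q_def)
    define \<delta> where "\<delta> = (\<lambda>x\<in>Q. \<alpha> (cj S g (\<alpha>' x)))"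
    have "(\<lambda>x\<in>Q. cj S g x) \<in> F Q Q" using g' by (intro F_conj[OF Q Q]) auto
    from F_comp[OF F_comp[OF a'(1) this] \<alpha>Q] have \<delta>: "\<delta> \<in> F Q Q"
      unfolding \<delta>_def by (rule F_cong) (simp add: F_mem[OF a'(1)])
    have "stabilizes j \<delta>"
      unfolding stabilizes_def
    proof (intro allI impI ballI)
      fix i x assume i: "i < j + 3" and x: "x \<in> chain j (Suc i)"
      have xQ: "x \<in> Q" using csub x i by simp
      define y where "y = \<alpha>' x"
      have y: "y \<in> chain j (Suc i)" using inv'[OF x] i by (simp add: y_def)
      have yQ: "y \<in> Q" using csub y i by simp
      define z where "z = inv y \<otimes> cj S g y"
      have z: "z \<in> chain j i" unfolding z_def by (rule chain_conj[OF j i g y])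
      have zQ: "z \<in> Q" using csub z i by simp
      have "cj S g y = y \<otimes> z" using cc[OF y] g' by (simp add: z_def)
      hence "\<delta> x = x \<otimes> \<alpha> z"
        using xQ F_mult[OF \<alpha>Q yQ zQ] a'(3) by (simp add: \<delta>_def y_def)
      hence "inv x \<otimes> \<delta> x = \<alpha> z" using cc[OF x] F_carrier[OF \<alpha>Q zQ] by simp
      thus "inv x \<otimes> \<delta> x \<in> chain j i" using inv[OF z] i by simp
    qed
    then obtain h where h: "h \<in> N (Suc j)" "\<forall>x\<in>Q. \<delta> x = cj S h x"
      using stabilizes_conj[OF j, of \<delta>] \<delta> by (auto simp: Q_def)
    have "\<alpha> (cj S g x) = cj S h (\<alpha> x)" if x: "x \<in> Q" for x
      using h(2) F_mem[OF \<alpha>Q x] a'(2) x by (auto simp: \<delta>_def)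
    moreover have "h \<in> carrier S" using h(1) mem_N_Suc[of h j] by blast
    ultimately show "g \<in> extension_domain S Q \<alpha>" using mem_extension_domain[OF \<alpha>Q] g' by blast
  qed
  have im: "\<alpha> ` Q = Q" by (rule F_Aut_image[OF \<alpha>Q])
  hence "fully_centralized S F (\<alpha> ` Q)"
    using fully_normalized_imp[OF Q] N_fully_normalized[OF j] by (simp add: Q_def)
  from extension[OF \<alpha>S this] obtain \<psi>
    where \<psi>: "\<psi> \<in> F (N (Suc j)) (carrier S)" "\<forall>x\<in>Q. \<psi> x = \<alpha> x" unfolding dom by blast
  \<comment> \<open>The axiom only provides values in \<open>S\<close>. They normalize
    \<open>Q\<close> because \<open>\<psi>\<close> extends an automorphism of
    \<open>Q\<close>.\<close>
  have "\<psi> n \<in> N (Suc j)" if n: "n \<in> N (Suc j)" for n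
  proof -
    have "cj S (\<psi> n) x \<in> Q" if x: "x \<in> Q" for x
    proof -
      have y: "\<alpha>' x \<in> Q" using F_mem[OF a'(1) x] .
      have yN: "\<alpha>' x \<in> N (Suc j)" using y N_subset_Suc[of j] unfolding Q_def by blast
      have "cj S n (\<alpha>' x) \<in> Q" using y n mem_N_Suc[of n j] unfolding Q_def by blast
      hence "\<psi> (cj S n (\<alpha>' x)) \<in> Q" using \<psi>(2) F_mem[OF \<alpha>Q] by simp
      thus ?thesis using F_cj[OF \<psi>(1) n yN] \<psi>(2) y a'(3) x by simp
    qed
    thus ?thesis
      using mem_normalizerI[OF finite_subgroup[OF Q finite_carrier] subgroup.subset[OF Q] F_carrier[OF \<psi>(1) n]]
      by (auto simp: Q_def)
  qed
  hence "\<psi> \<in> F (N (Suc j)) (N (Suc j))" by (intro F_codomain[OF \<psi>(1) N_subgroup]) blast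
  thus ?thesis using \<psi>(2) by (auto simp: Q_def)
qed

lemma extend_to_N:
  assumes \<alpha>: "\<alpha> \<in> F E E" and K: "\<And>x. x \<in> Zs 1 \<Longrightarrow> \<alpha> x \<in> Zs 1" and "j \<le> m"
  shows "\<exists>\<beta>\<in>F (N j) (N j). \<forall>x\<in>E. \<beta> x = \<alpha> x"
  using assms(3)
proof (induction j)
  case 0
  thus ?case using \<alpha> by auto
next
  case (Suc j)
  then obtain \<beta> where b: "\<beta> \<in> F (N j) (N j)" "\<forall>x\<in>E. \<beta> x = \<alpha> x" by auto
  have jm: "j < m" using Suc.prems by simp
  have "\<beta> x \<in> Zs 1" if "x \<in> Zs 1" for x
  proof -
    have "x \<in> E" using that Zs_step(2)[of 0] jm by auto
    thus ?thesis using b(2) K[OF that] by simp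
  qed
  hence "\<exists>\<beta>'\<in>F (N (Suc j)) (N (Suc j)). \<forall>x\<in>N j. \<beta>' x = \<beta> x"
    by (rule extend_step[OF jm b(1)])
  then obtain \<beta>' where b': "\<beta>' \<in> F (N (Suc j)) (N (Suc j))" "\<forall>x\<in>N j. \<beta>' x = \<beta> x"
    by (rule bexE)
  have "\<forall>x\<in>E. \<beta>' x = \<alpha> x"
  proof
    fix x assume x: "x \<in> E"
    hence "x \<in> N j" by (rule subsetD[OF E_subset_N])
    thus "\<beta>' x = \<alpha> x" using b(2) b'(2) x by simp
  qed
  thus ?case using b'(1) by (rule bexI)
qed

end

section \<open>Fusion in the pearl\<close>

lemma (in fusion_system) F_preimage_subgroup:
  assumes "\<phi> \<in> F P Q" "subgroup X S" "X \<subseteq> P" "subgroup A S"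
  shows "subgroup {x \<in> X. \<phi> x \<in> A} S"
proof (rule subgroupI)
  show "{x \<in> X. \<phi> x \<in> A} \<subseteq> carrier S" using subgroup.subset[OF assms(2)] by blast
  have "\<one> \<in> {x \<in> X. \<phi> x \<in> A}"
    using F_one[OF assms(1)] subgroup.one_closed[OF assms(2)] subgroup.one_closed[OF assms(4)] by simp
  thus "{x \<in> X. \<phi> x \<in> A} \<noteq> {}" by blast
  fix a assume a: "a \<in> {x \<in> X. \<phi> x \<in> A}"
  hence "a \<in> P" using assms(3) by blast
  thus "inv a \<in> {x \<in> X. \<phi> x \<in> A}"
    using a F_inv[OF assms(1)] assms(2,4) by (simp add: subgroup.m_inv_closed)
  fix b assume b: "b \<in> {x \<in> X. \<phi> x \<in> A}"
  hence "b \<in> P" using assms(3) by blast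
  thus "a \<otimes> b \<in> {x \<in> X. \<phi> x \<in> A}"
    using a b \<open>a \<in> P\<close> F_mult[OF assms(1)] assms(2,4) by (simp add: subgroup.m_closed)
qed

context group
begin

text \<open>Relative to a subset \<open>W\<close> but computed with the conjugation of the ambient
  group, so that centralizers in \<open>E\<close>, \<open>T\<close> and \<open>S\<close> can be
  compared without changing the carrier.\<close>

definition cen :: "'a set \<Rightarrow> 'a set \<Rightarrow> 'a set" where
  "cen W P = {g \<in> W. \<forall>x\<in>P. cj G g x = x}"

definition nor :: "'a set \<Rightarrow> 'a set \<Rightarrow> 'a set" where
  "nor W P = {g \<in> W. cj G g ` P = P}"

lemma cen_subset_nor: "cen W P \<subseteq> nor W P"
  by (auto simp: cen_def nor_def image_iff)

end

lemma (in fusion_system) cen_image: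
  assumes \<beta>: "\<beta> \<in> F W W" and P: "P \<subseteq> W"
  shows "\<beta> ` cen W P = cen W (\<beta> ` P)"
proof (intro subset_antisym subsetI)
  fix g assume "g \<in> \<beta> ` cen W P"
  then obtain h where h: "h \<in> W" "\<forall>x\<in>P. cj S h x = x" "g = \<beta> h" by (auto simp: cen_def)
  have "cj S g (\<beta> x) = \<beta> x" if "x \<in> P" for x
    using F_cj[OF \<beta> h(1), of x] h that P by auto
  thus "g \<in> cen W (\<beta> ` P)" using F_mem[OF \<beta> h(1)] h(3) by (auto simp: cen_def)
next
  fix g assume g: "g \<in> cen W (\<beta> ` P)"
  hence "g \<in> \<beta> ` W" using F_Aut_image[OF \<beta>] by (simp add: cen_def)
  then obtain h where h: "h \<in> W" "g = \<beta> h" by blast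
  have "cj S h x = x" if x: "x \<in> P" for x
  proof -
    have xW: "x \<in> W" using x P by blast
    have "\<beta> (cj S h x) = \<beta> x" using F_cj[OF \<beta> h(1) xW] g h x by (simp add: cen_def)
    thus ?thesis using F_eq[OF \<beta>] subgroup_cj_closed[OF F_dom[OF \<beta>] h(1) xW] xW by simp
  qed
  thus "g \<in> \<beta> ` cen W P" using h by (auto simp: cen_def)
qed

lemma (in fusion_system) nor_image:
  assumes \<beta>: "\<beta> \<in> F W W" and P: "P \<subseteq> W"
  shows "\<beta> ` nor W P = nor W (\<beta> ` P)"
proof -
  have im: "cj S (\<beta> h) ` \<beta> ` P = \<beta> ` cj S h ` P" if "h \<in> W" for h
    using F_cj[OF \<beta> that] P by (auto simp: image_image subset_iff intro!: image_cong)
  have inj: "\<beta> ` cj S h ` P = \<beta> ` P \<longleftrightarrow> cj S h ` P = P" if "h \<in> W" for h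
    using P subgroup_cj_closed[OF F_dom[OF \<beta>] that]
    by (intro inj_on_image_eq_iff[OF F_inj[OF \<beta>]]) auto
  show ?thesis
  proof (intro subset_antisym subsetI)
    fix g assume "g \<in> \<beta> ` nor W P"
    then obtain h where h: "h \<in> W" "cj S h ` P = P" "g = \<beta> h" by (auto simp: nor_def)
    thus "g \<in> nor W (\<beta> ` P)" using im[OF h(1)] F_mem[OF \<beta>] by (simp add: nor_def)
  next
    fix g assume g: "g \<in> nor W (\<beta> ` P)"
    hence "g \<in> \<beta> ` W" using F_Aut_image[OF \<beta>] by (simp add: nor_def)
    then obtain h where h: "h \<in> W" "g = \<beta> h" by blast
    hence "cj S h ` P = P" using g im[OF h(1)] inj[OF h(1)] by (simp add: nor_def)
    thus "g \<in> \<beta> ` nor W P" using h by (auto simp: nor_def)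
  qed
qed

lemma (in fusion_system) card_cen_image:
  "\<beta> \<in> F W W \<Longrightarrow> P \<subseteq> W \<Longrightarrow> card (cen W (\<beta> ` P)) = card (cen W P)"
  using F_card_image[of \<beta> W W "cen W P"] by (simp add: cen_image[symmetric]) (auto simp: cen_def)

lemma (in fusion_system) card_nor_image:
  "\<beta> \<in> F W W \<Longrightarrow> P \<subseteq> W \<Longrightarrow> card (nor W (\<beta> ` P)) = card (nor W P)"
  using F_card_image[of \<beta> W W "nor W P"] by (simp add: nor_image[symmetric]) (auto simp: nor_def)

text \<open>\<open>i_pos\<close> places the normalizer of \<open>E\<close> inside \<open>T\<close>;
  \<open>i_less\<close> makes \<open>T\<close> fully normalized and leaves room for
  \<open>N (Suc i)\<close>, whose elements induce the p-automorphisms of \<open>T\<close>.\<close>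

locale pearl_subtower = pearl_tower p S F E m
  for p :: nat and S (structure) and F E m +
  fixes i :: nat
  assumes i_pos: "0 < i" and i_less: "i < m"
begin

definition T :: "'a set" where "T = N i"
definition K :: "'a set" where "K = Zs 1"

lemma m_pos: "0 < m" using i_less by simp

lemma T_subgroup: "subgroup T S" and E_T: "E \<subseteq> T" and N1_T: "N 1 \<subseteq> T"
  using N_subgroup[of i] E_subset_N[of i] N_mono[of 1 i] i_pos by (simp_all add: T_def)

lemma T_carrier: "x \<in> T \<Longrightarrow> x \<in> carrier S"
  by (rule subgroup.mem_carrier[OF T_subgroup])

lemma E_carrier: "x \<in> E \<Longrightarrow> x \<in> carrier S"
  by (rule subgroup.mem_carrier[OF E])

lemma T_closed: "x \<in> T \<Longrightarrow> y \<in> T \<Longrightarrow> x \<otimes> y \<in> T" "x \<in> T \<Longrightarrow> inv x \<in> T" "\<one> \<in> T"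
  "x \<in> T \<Longrightarrow> y \<in> T \<Longrightarrow> cj S x y \<in> T"
  using T_subgroup by (simp_all add: subgroup.m_closed subgroup.m_inv_closed subgroup.one_closed
      subgroup_cj_closed)

lemma E_finite: "finite E" and T_finite: "finite T"
  using finite_subgroup[OF E finite_carrier] finite_subgroup[OF T_subgroup finite_carrier] by auto

lemma mem_N1: "g \<in> N 1 \<longleftrightarrow> g \<in> carrier S \<and> cj S g ` E = E"
  using mem_N_Suc[of g 0] by simp

lemma normalizer_in_T: "g \<in> carrier S \<Longrightarrow> cj S g ` E \<subseteq> E \<Longrightarrow> g \<in> T"
  using mem_normalizerI[OF E_finite subgroup.subset[OF E]] N1_T by auto

lemma E_ne_T: "E \<noteq> T"
proof
  assume "E = T"
  hence "card (N i) = card E" by (simp add: T_def)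
  moreover have "1 < p ^ i" using prime_gt_1_nat[OF prime_p] i_pos by (intro one_less_power)
  ultimately show False using card_N[of i] i_less card_E_pos i_pos prime_gt_1_nat[OF prime_p] by auto
qed

lemma Z0_subgroup: "subgroup Z0 S" and Z0_normal: "Z0 \<lhd> S"
  using Zs_subgroup[of 0] Zs_normal[of 0] by (simp_all add: Zs_0)

lemma K_normal: "K \<lhd> S" and K_subgroup: "subgroup K S"
  using Zs_normal_Suc[OF m_pos] Zs_subgroup_Suc[OF m_pos] by (simp_all add: K_def)

lemma Z0_K: "Z0 \<subseteq> K" and K_E: "K \<subseteq> E" and card_K: "card K = p * card Z0" and card_E: "card E = p * card K"
  using Zs_step[OF m_pos] by (simp_all add: K_def Zs_0)

lemma Z0_E: "Z0 \<subseteq> E" using Z0_K K_E by blast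

lemma card_E_Z0: "card E = p ^ 2 * card Z0"
  by (simp add: card_E card_K power2_eq_square)

lemma K_commutator: "y \<in> K \<Longrightarrow> x \<in> carrier S \<Longrightarrow> inv y \<otimes> cj S x y \<in> Z0"
  using rel_centreD[of y Z0 x] by (simp add: K_def Zs_Suc Zs_0)

section \<open>Conjugation and p-automorphisms on subgroups of \<open>E\<close>\<close>

lemma self_centralizing:
  "x \<in> carrier S \<Longrightarrow> (\<And>y. y \<in> E \<Longrightarrow> inv y \<otimes> cj S x y \<in> Z0) \<Longrightarrow> x \<in> E"
  using sc_pairD(6)[OF tower[of 0]] by (simp add: Zs_0)

text \<open>All of \<open>S\<close> centralizes \<open>K\<close> modulo \<open>Z0\<close>, and
  \<open>K\<close> has index \<open>p\<close> in \<open>E\<close>, so commuting with one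
  \<open>w\<close> outside \<open>K\<close> already means centralizing \<open>E/Z0\<close>.\<close>

lemma self_centralizing_K:
  assumes x: "x \<in> carrier S" and w: "w \<in> E" "w \<notin> K" "inv w \<otimes> cj S x w \<in> Z0"
  shows "x \<in> E"
proof -
  define H where "H = {y \<in> E. inv y \<otimes> cj S x y \<in> Z0}"
  have "subgroup H S" unfolding H_def by (rule subgroup_fixed_mod[OF Z0_normal E x])
  moreover have "K \<subseteq> H" using K_E K_commutator x by (auto simp: H_def)
  ultimately have "H = E"
    using prime_index_eq[OF K_subgroup _ E _ _ card_E prime_p finite_carrier, of H w] w
    by (auto simp: H_def)
  thus ?thesis using self_centralizing[OF x] by (auto simp: H_def)
qed

lemma Aut_E_Z0: "\<alpha> \<in> F E E \<Longrightarrow> x \<in> Z0 \<Longrightarrow> \<alpha> x \<in> Z0"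
  using Z0_invariant[of \<alpha> 0 x] by simp

lemma conj_in_Aut_E: "g \<in> carrier S \<Longrightarrow> cj S g ` E \<subseteq> E \<Longrightarrow> (\<lambda>x\<in>E. cj S g x) \<in> F E E"
  by (rule F_conj[OF E E])

lemma conj_in_Aut_T: "g \<in> T \<Longrightarrow> (\<lambda>x\<in>T. cj S g x) \<in> F T T"
  by (rule F_conj[OF T_subgroup T_subgroup T_carrier]) (auto intro: T_closed)

text \<open>An element of \<open>S\<close> fixes \<open>Z0\<close> pointwise and moves
  \<open>k\<close> only within its coset of \<open>Z0\<close>. By \<open>Z0_conj\<close> every such
  move of \<open>k\<close> is made by an element of \<open>E\<close>, and \<open>k\<close> together
  with \<open>Z0\<close> determines the action on \<open>K\<close>.\<close>

lemma conj_on_K_by_E: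
  assumes t: "t \<in> carrier S" shows "\<exists>e\<in>E. \<forall>x\<in>K. cj S t x = cj S e x"
proof -
  have "card Z0 \<noteq> card K"
    using card_K prime_gt_1_nat[OF prime_p] subgroup.finite_imp_card_positive[OF Z0_subgroup finite_carrier]
    by simp
  hence "K \<noteq> Z0" by auto
  then obtain k where k: "k \<in> K" "k \<notin> Z0" using Z0_K by blast
  have ck: "k \<in> carrier S" using k(1) by (rule subgroup.mem_carrier[OF K_subgroup])
  have "k \<in> E" using k K_E by blast
  from Z0_conj[OF this k(2) K_commutator[OF k(1) t]] obtain e
    where e: "e \<in> E" "cj S e k = k \<otimes> (inv k \<otimes> cj S t k)" by blast
  have ce: "e \<in> carrier S" using e(1) by (rule E_carrier)
  define H where "H = {x \<in> K. cj S t x = cj S e x}"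
  have sH: "subgroup H S" unfolding H_def
    using t ce subgroup.mem_carrier[OF K_subgroup]
    by (intro subgroup_equalizer[OF K_subgroup]) (auto simp: cj_mult)
  have ZH: "Z0 \<subseteq> H" using Z0_K Z0_central t ce by (auto simp: H_def)
  have HK: "H \<subseteq> K" by (auto simp: H_def)
  have kH: "k \<in> H" using k e ck t by (simp add: H_def)
  have "H = K"
    by (rule prime_index_eq[OF Z0_subgroup sH K_subgroup ZH HK card_K prime_p finite_carrier kH k(2)])
  thus ?thesis using e(1) by (auto simp: H_def)
qed

text \<open>This is the control of fusion by automorphisms of \<open>E\<close>. On subgroups of
  \<open>K\<close> conjugation is induced by \<open>E\<close>. If \<open>X\<close> has an element
  \<open>w\<close> outside \<open>K\<close>, then \<open>v\<close> carries both \<open>w\<close> and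
  the normal subgroup \<open>K\<close> into \<open>E\<close>, hence normalizes
  \<open>E\<close>.\<close>

lemma conj_in_E_by_Aut:
  assumes X: "subgroup X S" "X \<subseteq> E" and v: "v \<in> carrier S" "cj S v ` X \<subseteq> E"
  shows "\<exists>\<alpha>\<in>F E E. \<forall>x\<in>X. cj S v x = \<alpha> x"
proof (cases "X \<subseteq> K")
  case True
  obtain e where e: "e \<in> E" "\<forall>x\<in>K. cj S v x = cj S e x" using conj_on_K_by_E[OF v(1)] by blast
  have "(\<lambda>x\<in>E. cj S e x) \<in> F E E"
    using cj_image_self[OF E e(1)] e(1) by (intro conj_in_Aut_E E_carrier) auto
  thus ?thesis using e True X by (intro bexI[of _ "\<lambda>x\<in>E. cj S e x"]) auto
next
  case False
  then obtain w where w: "w \<in> X" "w \<notin> K" by blast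
  define H where "H = {x \<in> E. cj S v x \<in> E}"
  have "(\<lambda>x\<in>E. cj S v x) \<in> F E (carrier S)"
    using v(1) E_carrier by (intro F_conj[OF E subgroup_self]) auto
  from F_preimage_subgroup[OF this E order_refl E]
  have "subgroup {x \<in> E. (\<lambda>x\<in>E. cj S v x) x \<in> E} S" .
  moreover have "{x \<in> E. (\<lambda>x\<in>E. cj S v x) x \<in> E} = H" by (auto simp: H_def)
  ultimately have sH: "subgroup H S" by simp
  have KH: "K \<subseteq> H" using K_E normal_cj[OF K_normal v(1)] by (auto simp: H_def)
  have wH: "w \<in> H" using w X v by (auto simp: H_def)
  have HE: "H \<subseteq> E" by (auto simp: H_def)
  have "H = E"
    by (rule prime_index_eq[OF K_subgroup sH E KH HE card_E prime_p finite_carrier wH w(2)])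
  hence "cj S v ` E \<subseteq> E" by (auto simp: H_def)
  from conj_in_Aut_E[OF v(1) this] show ?thesis
    using X by (intro bexI[of _ "\<lambda>x\<in>E. cj S v x"]) auto
qed

text \<open>If \<open>Z0\<close> is not contained in \<open>P\<close>, it has order \<open>p\<close>
  and meets \<open>P\<close> trivially, so \<open>P\<close> embeds into \<open>E/Z0\<close>. The
  point is that the embedding is not onto, which leaves order \<open>p\<close> for
  \<open>P\<close>.\<close>

lemma card_subgroup_E:
  assumes P: "subgroup P S" "P \<subseteq> E" "P \<noteq> E" "\<not> P \<subseteq> Z0"
  shows "card P = p * card (P \<inter> Z0)"
proof (cases "Z0 \<subseteq> P")
  case True
  have "P \<noteq> Z0" using P by blast
  from card_intermediate(1)[OF Z0_subgroup P(1) E True P(2) this P(3) card_E_Z0] show ?thesis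
    using True by (simp add: Int_absorb1)
next
  case False
  have cZ: "card Z0 = p * card {\<one>}"
  proof -
    have "Z0 = {\<one>}" if "card Z0 = 1"
      using that subgroup.one_closed[OF Z0_subgroup] by (auto simp: card_1_singleton_iff)
    thus ?thesis using card_Z0 False subgroup.one_closed[OF P(1)] by auto
  qed
  have sI: "subgroup (P \<inter> Z0) S" using P(1) Z0_subgroup by (rule subgroups_Inter_pair)
  have "P \<inter> Z0 = {\<one>} \<or> P \<inter> Z0 = Z0"
    using subgroup.one_closed[OF sI]
    by (intro prime_index_cases[OF triv_subgroup sI Z0_subgroup _ _ cZ prime_p finite_carrier]) auto
  hence I: "P \<inter> Z0 = {\<one>}" using False by blast
  have P1: "P \<noteq> {\<one>}" using P(4) subgroup.one_closed[OF Z0_subgroup] by blast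
  obtain w where w: "w \<in> P" "w \<notin> Z0" using P(4) by blast
  have cP: "x \<in> carrier S" if "x \<in> P" for x using that by (rule subgroup.mem_carrier[OF P(1)])
  define f where "f x = Z0 #> x" for x
  define A where "A = f ` E"
  have "card A * card Z0 = card E"
    unfolding A_def f_def by (rule card_rcosets_times_card[OF Z0_subgroup E Z0_E])
  hence cA: "card A = p ^ 2"
    using card_E_Z0 subgroup.finite_imp_card_positive[OF Z0_subgroup finite_carrier] by simp
  have finA: "finite A" using E_finite by (simp add: A_def)
  have sub: "f ` P \<subseteq> A" using P(2) by (auto simp: A_def)
  have coset: "\<exists>z\<in>Z0. a = z \<otimes> b" if "f a = f b" "a \<in> carrier S" for a b
    using rcos_self[OF that(2) Z0_subgroup] that(1) by (auto simp: f_def r_coset_def)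
  \<comment> \<open>If \<open>P\<close> covered \<open>E/Z0\<close>, the conjugates of
    \<open>w\<close> under \<open>E\<close> would already be conjugates under \<open>P\<close>, as
    \<open>Z0\<close> is central; by \<open>Z0_conj\<close> all of \<open>Z0\<close> would then lie
    in \<open>P\<close>.\<close>
  have ne: "f ` P \<noteq> A"
  proof
    assume eq: "f ` P = A"
    have "Z0 \<subseteq> P"
    proof
      fix z assume z: "z \<in> Z0"
      have "w \<in> E" using w P by blast
      then obtain e where e: "e \<in> E" "cj S e w = w \<otimes> z" using Z0_conj w z by blast
      have "f e \<in> f ` P" using eq e by (simp add: A_def)
      then obtain r where r: "r \<in> P" "f e = f r" by auto
      obtain z' where z': "z' \<in> Z0" "e = z' \<otimes> r" using coset[OF r(2) E_carrier[OF e(1)]] by blast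
      have c: "z' \<in> carrier S" "z \<in> carrier S" "w \<in> carrier S" "r \<in> carrier S"
        using z z' w r cP subgroup.mem_carrier[OF Z0_subgroup] by auto
      have "cj S z' w = w" using Z0_central[OF z'(1) c(3)] c by (simp add: cj_eq_self_iff)
      hence "cj S e w = cj S r w" using z' c by (simp flip: cj_cj)
      hence "w \<otimes> z \<in> P" using e subgroup_cj_closed[OF P(1) r(1) w(1)] by simp
      hence "inv w \<otimes> (w \<otimes> z) \<in> P" using w P(1) by (simp add: subgroup.m_closed subgroup.m_inv_closed)
      thus "z \<in> P" using c by simp
    qed
    thus False using False by blast
  qed
  have "card (f ` P) < p ^ 2" using psubset_card_mono[OF finA] sub ne cA by auto
  moreover have "card P \<le> card (f ` P) * card {\<one>}"
  proof (rule card_le_image_times_fibre[OF P(1) triv_subgroup finite_carrier])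
    fix h h' assume h: "h \<in> P" "h' \<in> P" "f h = f h'"
    obtain z where z: "z \<in> Z0" "h = z \<otimes> h'" using coset[OF h(3) cP[OF h(1)]] by blast
    hence "h \<otimes> inv h' = z" using cP h subgroup.mem_carrier[OF Z0_subgroup z(1)] by (simp add: m_assoc)
    moreover have "h \<otimes> inv h' \<in> P" using h P(1) by (simp add: subgroup.m_closed subgroup.m_inv_closed)
    ultimately show "h \<otimes> inv h' \<in> {\<one>}" using z I by auto
  qed
  ultimately have lt: "card P < p ^ 2" by simp
  obtain a where a: "card P = p ^ a" using subgroup_card_prime_power[OF P(1)] by blast
  have "a < 2" using lt a prime_gt_1_nat[OF prime_p] by (metis power_strict_increasing_iff)
  hence "card P \<le> p" using a prime_ge_1_nat[OF prime_p] power_increasing[of a 1 p] by simp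
  moreover have "p * card {\<one>} \<le> card P"
    using P1 subgroup.one_closed[OF P(1)] by (intro card_mult_le[OF triv_subgroup P(1)]) auto
  ultimately show ?thesis using I by simp
qed

text \<open>A p-element acts trivially on the quotient of order \<open>p\<close> of \<open>P\<close>
  by \<open>P \<inter> Z0\<close>. So \<open>n\<close> centralizes modulo \<open>Z0\<close> an
  element of \<open>P\<close> outside \<open>K\<close>, and \<open>self_centralizing_K\<close>
  applies.\<close>

lemma normalizer_in_E:
  assumes P: "subgroup P S" "P \<subseteq> E" "P \<noteq> E" "\<not> P \<subseteq> K" and n: "n \<in> carrier S" "cj S n ` P \<subseteq> P"
  shows "n \<in> E"
proof -
  obtain w where w: "w \<in> P" "w \<notin> K" using P by blast
  have "\<not> P \<subseteq> Z0" using P Z0_K by blast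
  hence card: "card P = p * card (P \<inter> Z0)" by (rule card_subgroup_E[OF P(1-3)])
  have sI: "subgroup (P \<inter> Z0) S" using P(1) Z0_subgroup by (rule subgroups_Inter_pair)
  have "inv w \<otimes> cj S n w \<in> P \<inter> Z0"
    using n normal_cj[OF Z0_normal n(1)] w
    by (intro cj_trivial_on_prime_index[OF sI P(1) _ card n(1)]) auto
  thus ?thesis using self_centralizing_K[OF n(1)] w P by blast
qed

lemma p_automorphism_trivial_in_Z0:
  assumes A: "subgroup A S" "A \<subseteq> Z0" and \<alpha>: "\<alpha> \<in> F E E" "\<And>x. x \<in> A \<Longrightarrow> \<alpha> x \<in> A"
    and pow: "\<And>x. x \<in> A \<Longrightarrow> (\<alpha> ^^ (p ^ k)) x = x" and x: "x \<in> A"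
  shows "\<alpha> x = x"
proof (cases "A = {\<one>}")
  case True
  thus ?thesis using x F_one[OF \<alpha>(1)] by simp
next
  case False
  have AE: "A \<subseteq> E" using A Z0_E by blast
  have "Z0 \<noteq> {\<one>}" using False A subgroup.one_closed[OF A(1)] by blast
  hence cZ: "card Z0 = p * card {\<one>}"
    using card_Z0 subgroup.one_closed[OF Z0_subgroup] by (auto simp: card_1_singleton_iff)
  have 1: "{\<one>} \<subseteq> A" using subgroup.one_closed[OF A(1)] by blast
  have "A = Z0"
    using prime_index_cases[OF triv_subgroup A(1) Z0_subgroup 1 A(2) cZ prime_p finite_carrier] False by blast
  hence cA: "card A = p * card {\<one>}" using cZ by simp
  have "inv x \<otimes> \<alpha> x \<in> {\<one>}"
    using \<alpha> F_mult[OF \<alpha>(1)] F_one[OF \<alpha>(1)] AE pow x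
    by (intro p_automorphism_trivial_on_prime_index[OF triv_subgroup A(1) 1 cA prime_p finite_carrier,
          where \<gamma> = \<alpha> and k = k]) auto
  moreover have "x \<in> carrier S" "\<alpha> x \<in> carrier S" using x \<alpha> subgroup.mem_carrier[OF A(1)] by auto
  ultimately show ?thesis by (metis inv_equality inv_inv inv_closed singletonD)
qed

text \<open>Such an automorphism is trivial on \<open>P \<inter> Z0\<close>, of order at most
  \<open>p\<close>, and on the quotient of order \<open>p\<close> above it. It is therefore
  determined by multiplying one \<open>w\<close> by an element of \<open>Z0\<close>, and
  \<open>E\<close> induces that.\<close>

lemma p_automorphism_by_E:
  assumes P: "subgroup P S" "P \<subseteq> E" "P \<noteq> E" and \<alpha>: "\<alpha> \<in> F E E" "\<And>x. x \<in> P \<Longrightarrow> \<alpha> x \<in> P"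
    and pow: "\<And>x. x \<in> P \<Longrightarrow> (\<alpha> ^^ (p ^ k)) x = x"
  shows "\<exists>e\<in>E. \<forall>x\<in>P. \<alpha> x = cj S e x"
proof (cases "P \<subseteq> Z0")
  case True
  have "\<alpha> x = cj S \<one> x" if "x \<in> P" for x
    using p_automorphism_trivial_in_Z0[OF P(1) True \<alpha> pow that] subgroup.mem_carrier[OF P(1) that] by simp
  thus ?thesis using subgroup.one_closed[OF E] by blast
next
  case False
  then obtain w where w: "w \<in> P" "w \<notin> Z0" by blast
  define A where "A = P \<inter> Z0"
  have sA: "subgroup A S" unfolding A_def using P(1) Z0_subgroup by (rule subgroups_Inter_pair)
  have AP: "A \<subseteq> P" by (auto simp: A_def)
  have card: "card P = p * card A" unfolding A_def by (rule card_subgroup_E[OF P False])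
  have \<alpha>A: "\<alpha> x \<in> A" if "x \<in> A" for x using that \<alpha> Aut_E_Z0 by (auto simp: A_def)
  have fixA: "\<alpha> x = x" if "x \<in> A" for x
    by (rule p_automorphism_trivial_in_Z0[OF sA _ \<alpha>(1) \<alpha>A pow that]) (auto simp: A_def)
  have cP: "x \<in> carrier S" if "x \<in> P" for x using that by (rule subgroup.mem_carrier[OF P(1)])
  have "inv w \<otimes> \<alpha> w \<in> A"
    using \<alpha> F_mult[OF \<alpha>(1)] P \<alpha>A pow w
    by (intro p_automorphism_trivial_on_prime_index[OF sA P(1) AP card prime_p finite_carrier,
          where \<gamma> = \<alpha> and k = k]) auto
  moreover have "w \<in> E" using w P by blast
  ultimately obtain e where e: "e \<in> E" "cj S e w = w \<otimes> (inv w \<otimes> \<alpha> w)"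
    using Z0_conj[of w] w by (auto simp: A_def)
  have ew: "\<alpha> w = cj S e w" using e cP[OF w(1)] cP[OF \<alpha>(2)[OF w(1)]] by simp
  define H where "H = {x \<in> P. \<alpha> x = cj S e x}"
  have "\<alpha> (x \<otimes> y) = \<alpha> x \<otimes> \<alpha> y" if "x \<in> P" "y \<in> P" for x y
    using F_mult[OF \<alpha>(1), of x y] that P(2) by blast
  hence sH: "subgroup H S" unfolding H_def
    using cP \<alpha>(2) E_carrier[OF e(1)]
    by (intro subgroup_equalizer[OF P(1)]) (auto simp: cj_mult)
  have AH: "A \<subseteq> H"
    using fixA Z0_central E_carrier[OF e(1)] by (auto simp: H_def A_def)
  have HP: "H \<subseteq> P" by (auto simp: H_def)
  have wH: "w \<in> H" "w \<notin> A" using w ew by (auto simp: H_def A_def)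
  have "H = P"
    by (rule prime_index_eq[OF sA sH P(1) AH HP card prime_p finite_carrier wH])
  thus ?thesis using e(1) by (auto simp: H_def)
qed

text \<open>If \<open>K\<alpha> \<noteq> K\<close>, some line of \<open>E/Z\<^sub>0\<close> differs from both \<open>K/Z\<^sub>0\<close> and \<open>K\<alpha>/Z\<^sub>0\<close>; it is moved to \<open>K\<alpha>/Z\<^sub>0\<close> by
  \<open>Aut\<^sub>S(E)\<close> and to \<open>K/Z\<^sub>0\<close> by the conjugate of \<open>Aut\<^sub>S(E)\<close> under \<open>\<alpha>\<close>, and both groups centralize \<open>Z\<^sub>0\<close>.\<close>

lemma modify_to_preserve_K:
  assumes \<alpha>: "\<alpha> \<in> F E E"
  shows "\<exists>\<delta>\<in>F E E. (\<forall>x\<in>K. \<delta> x \<in> K) \<and> (\<forall>x\<in>Z0. \<delta> x = \<alpha> x)"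
proof (cases "\<forall>x\<in>K. \<alpha> x \<in> K")
  case True
  thus ?thesis using \<alpha> by blast
next
  case False
  then obtain b where b: "b \<in> K" "\<alpha> b \<notin> K" by blast
  define y where "y = \<alpha> b"
  obtain \<alpha>' where a': "\<alpha>' \<in> F E E" "\<forall>x\<in>E. \<alpha>' (\<alpha> x) = x" "\<forall>x\<in>E. \<alpha> (\<alpha>' x) = x"
    using F_Aut_inverse[OF \<alpha>] by blast
  have bE: "b \<in> E" using b K_E by blast
  have y: "y \<in> E" "y \<notin> K" "\<alpha>' y = b" using b bE a' F_mem[OF \<alpha>] by (auto simp: y_def)
  have bZ: "b \<notin> Z0" using Aut_E_Z0[OF \<alpha>] Z0_K b by blast
  define H where "H = {x \<in> K. \<alpha>' x \<in> K}"
  have sH: "subgroup H S" unfolding H_def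
    by (rule F_preimage_subgroup[OF a'(1) K_subgroup K_E K_subgroup])
  have ZH: "Z0 \<subseteq> H" using Z0_K Aut_E_Z0[OF a'(1)] by (auto simp: H_def)
  have HK: "H \<subseteq> K" by (auto simp: H_def)
  have "H \<noteq> K"
  proof
    assume "H = K"
    hence "\<alpha>' ` K \<subseteq> K" by (auto simp: H_def)
    hence "\<alpha>' ` K = K" by (rule F_Aut_invariant[OF a'(1) K_E])
    then obtain k where k: "k \<in> K" "b = \<alpha>' k" using b by blast
    hence "y = k" using a'(3) K_E by (auto simp: y_def)
    thus False using y k by blast
  qed
  moreover have "K \<noteq> Z0" using bZ b by blast
  ultimately obtain k where k: "k \<in> K" "k \<notin> H" using HK by blast
  have kE: "k \<in> E" using k K_E by blast
  define a where "a = \<alpha>' k"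
  have a: "a \<in> E" "a \<notin> K" "\<alpha> a = k" using k kE a' F_mem[OF a'(1)] by (auto simp: H_def a_def)
  have cc: "a \<in> carrier S" "b \<in> carrier S" "y \<in> carrier S" "k \<in> carrier S"
    using a(1) bE y(1) kE E_carrier by auto
  note step = sc_pair_step(4)[OF tower[of 0] N_proper[OF m_pos], unfolded Zs_0]
  have K': "rel_centre Z0 = K" by (simp add: K_def Zs_Suc Zs_0)
  obtain n where n: "n \<in> N 1" "inv (y \<otimes> k) \<otimes> cj S n y \<in> Z0"
    using step[of y k] y k K' by auto
  obtain n' where n': "n' \<in> N 1" "inv (a \<otimes> b) \<otimes> cj S n' a \<in> Z0"
    using step[of a b] a b K' by auto
  have cn: "n \<in> carrier S" "n' \<in> carrier S" using n n' mem_N1 by blast+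
  have nE: "cj S n ` E \<subseteq> E" "cj S (inv n') ` E \<subseteq> E"
  proof -
    show "cj S n ` E \<subseteq> E" using n mem_N1[of n] by simp
    have "inv n' \<in> N 1" using n' N_subgroup by (simp add: subgroup.m_inv_closed del: iter_normalizer.simps)
    thus "cj S (inv n') ` E \<subseteq> E" using mem_N1[of "inv n'"] by simp
  qed
  \<comment> \<open>Modulo \<open>Z0\<close>, the element \<open>b\<close> travels through
    \<open>y\<close>, \<open>y \<otimes> k\<close>, \<open>b \<otimes> a\<close>, \<open>a\<close>
    and \<open>k\<close>, and so ends in \<open>K\<close>. Here \<open>n\<close> and
    \<open>n'\<close> were chosen to send \<open>y\<close> to \<open>y \<otimes> k\<close> and
    \<open>a\<close> to \<open>a \<otimes> b\<close>. On \<open>Z0\<close> both conjugations are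
    trivial and only the first \<open>\<alpha>\<close> survives.\<close>
  define \<delta> where "\<delta> = (\<lambda>x\<in>E. \<alpha> (cj S (inv n') (\<alpha>' (cj S n (\<alpha> x)))))"
  have \<delta>: "\<delta> \<in> F E E"
  proof -
    have "(\<lambda>x\<in>E. cj S n x) \<in> F E E" using cn nE by (intro conj_in_Aut_E) auto
    note 1 = F_comp[OF F_comp[OF \<alpha> this] a'(1)]
    have "(\<lambda>x\<in>E. cj S (inv n') x) \<in> F E E" using cn nE by (intro conj_in_Aut_E) auto
    from F_comp[OF F_comp[OF 1 this] \<alpha>] show ?thesis
      unfolding \<delta>_def
      by (rule F_cong) (use nE F_mem[OF \<alpha>] F_mem[OF a'(1)] in \<open>simp add: image_subset_iff\<close>)
  qed
  have \<delta>Z: "\<delta> x = \<alpha> x" if x: "x \<in> Z0" for x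
  proof -
    have "x \<in> E" "\<alpha> x \<in> Z0" using x Z0_E Aut_E_Z0[OF \<alpha>] by auto
    thus ?thesis using Z0_central x cn a'(2) by (simp add: \<delta>_def)
  qed
  have \<delta>b: "\<delta> b \<in> K"
  proof -
    define z1 where "z1 = inv (y \<otimes> k) \<otimes> cj S n y"
    define z2 where "z2 = inv (a \<otimes> b) \<otimes> cj S n' a"
    define z3 where "z3 = inv b \<otimes> cj S a b"
    have z: "z1 \<in> Z0" "z2 \<in> Z0" "z3 \<in> Z0"
      using n(2) n'(2) K_commutator[OF b(1) cc(1)] by (simp_all add: z1_def z2_def z3_def)
    have zE: "z1 \<in> E" "z2 \<in> E" "z3 \<in> E" using z Z0_E by auto
    have cz: "z1 \<in> carrier S" "z2 \<in> carrier S" "z3 \<in> carrier S" using zE E_carrier by auto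
    have e1: "cj S n y = y \<otimes> k \<otimes> z1" using cc cn by (simp add: z1_def)
    have e2: "a \<otimes> b = cj S n' a \<otimes> inv z2"
    proof -
      have "cj S n' a = a \<otimes> b \<otimes> z2" using cc cn by (simp add: z2_def)
      thus ?thesis using cc cz by (simp add: m_assoc)
    qed
    have e3: "b \<otimes> a = a \<otimes> b \<otimes> z3" using cc by (simp add: z3_def cj_def m_assoc)
    define z4 where "z4 = inv z2 \<otimes> z3 \<otimes> \<alpha>' z1"
    have "\<alpha>' z1 \<in> Z0" using Aut_E_Z0[OF a'(1)] z by blast
    hence z4: "z4 \<in> Z0" using z Z0_subgroup by (simp add: z4_def subgroup.m_closed subgroup.m_inv_closed)
    have c4: "z4 \<in> carrier S" "z4 \<in> E" "\<alpha>' z1 \<in> carrier S"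
      using z4 \<open>\<alpha>' z1 \<in> Z0\<close> Z0_E E_carrier by auto
    have "\<alpha>' (cj S n y) = b \<otimes> a \<otimes> \<alpha>' z1"
      using F_mult[OF a'(1)] y kE zE subgroup.m_closed[OF E] by (simp add: e1 a_def)
    also have "\<dots> = cj S n' a \<otimes> z4"
      using cc cz cn c4 by (simp add: e3 e2 z4_def m_assoc)
    finally have "cj S (inv n') (\<alpha>' (cj S n y)) = a \<otimes> z4"
      using cn cc c4 Z0_central[OF z4] by (simp add: cj_mult)
    hence "\<delta> b = k \<otimes> \<alpha> z4"
      using bE F_mult[OF \<alpha> a(1) c4(2)] a(3) by (simp add: \<delta>_def y_def)
    thus ?thesis
      using k Aut_E_Z0[OF \<alpha> z4] Z0_K K_subgroup by (auto simp: subgroup.m_closed)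
  qed
  define J where "J = {x \<in> K. \<delta> x \<in> K}"
  have sJ: "subgroup J S" unfolding J_def
    by (rule F_preimage_subgroup[OF \<delta> K_subgroup K_E K_subgroup])
  have ZJ: "Z0 \<subseteq> J" using Z0_K \<delta>Z Aut_E_Z0[OF \<alpha>] by (auto simp: J_def)
  have JK: "J \<subseteq> K" by (auto simp: J_def)
  have bJ: "b \<in> J" using b \<delta>b by (simp add: J_def)
  have "J = K"
    by (rule prime_index_eq[OF Z0_subgroup sJ K_subgroup ZJ JK card_K prime_p finite_carrier bJ bZ])
  thus ?thesis using \<delta> \<delta>Z by (auto simp: J_def)
qed

lemma extend_to_T:
  assumes "\<alpha> \<in> F E E" "\<And>x. x \<in> K \<Longrightarrow> \<alpha> x \<in> K"
  shows "\<exists>\<beta>\<in>F T T. \<beta> ` E = E \<and> (\<forall>x\<in>E. \<beta> x = \<alpha> x)"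
proof -
  obtain \<beta> where b: "\<beta> \<in> F T T" "\<forall>x\<in>E. \<beta> x = \<alpha> x"
    using extend_to_N[OF assms(1), of i] assms(2) i_less unfolding T_def K_def by fastforce
  have "\<beta> ` E = \<alpha> ` E" using b(2) by (auto simp: image_iff)
  hence "\<beta> ` E = E" using F_Aut_image[OF assms(1)] by simp
  thus ?thesis using b by blast
qed

section \<open>Centralizers in \<open>T\<close> and the extension of maps between subgroups of
  \<open>E\<close>\<close>

text \<open>Some \<open>e\<close> in \<open>E\<close> acts on \<open>K\<close> as does a
  \<open>t\<close> in \<open>T\<close> outside \<open>E\<close>; then
  \<open>t \<otimes> inv e\<close> centralizes \<open>K\<close>.\<close>

lemma cen_outside_E:
  assumes "X \<subseteq> K" shows "\<exists>g\<in>cen T X. g \<notin> E"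
proof -
  obtain t where t: "t \<in> T" "t \<notin> E" using E_ne_T E_T by blast
  obtain e where e: "e \<in> E" "\<forall>x\<in>K. cj S t x = cj S e x" using conj_on_K_by_E[OF T_carrier[OF t(1)]] by blast
  have c: "t \<in> carrier S" "e \<in> carrier S" using t T_carrier e E_carrier by auto
  define g where "g = t \<otimes> inv e"
  have "cj S g x = x" if "x \<in> X" for x
  proof -
    have "x \<in> K" using that assms by blast
    moreover have "x \<in> carrier S" using subgroup.mem_carrier[OF K_subgroup \<open>x \<in> K\<close>] .
    ultimately show ?thesis using e c by (simp add: g_def flip: cj_cj)
  qed
  moreover have "g \<in> T" using t e E_T by (auto simp: g_def intro: T_closed)
  moreover have "g \<notin> E"
  proof
    assume "g \<in> E"
    hence "g \<otimes> e \<in> E" using e E by (simp add: subgroup.m_closed)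
    thus False using t c by (simp add: g_def m_assoc)
  qed
  ultimately show ?thesis by (auto simp: cen_def)
qed

lemma cen_finite: "finite (cen T X)" and nor_finite: "finite (nor T X)"
  using T_finite by (simp_all add: cen_def nor_def)

text \<open>\<open>\<alpha>\<close> matches the centralizers taken in \<open>E\<close>, so any
  difference in order comes from elements outside \<open>E\<close>, which exist for subgroups of
  \<open>K\<close>.\<close>

lemma card_cen_le:
  assumes \<alpha>: "\<alpha> \<in> F E E" and X: "X \<subseteq> E" and sub: "cen T (\<alpha> ` X) \<subseteq> E"
  shows "card (cen T (\<alpha> ` X)) \<le> card (cen T X)" "X \<subseteq> K \<Longrightarrow> card (cen T (\<alpha> ` X)) < card (cen T X)"
proof -
  have eq: "card (cen T (\<alpha> ` X)) = card (cen E X)"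
  proof -
    have "cen T (\<alpha> ` X) = cen E (\<alpha> ` X)" using sub E_T by (auto simp: cen_def)
    thus ?thesis using card_cen_image[OF \<alpha> X] by simp
  qed
  have s: "cen E X \<subseteq> cen T X" using E_T by (auto simp: cen_def)
  thus "card (cen T (\<alpha> ` X)) \<le> card (cen T X)" using eq card_mono[OF cen_finite s] by simp
  assume "X \<subseteq> K"
  then obtain g where "g \<in> cen T X" "g \<notin> E" using cen_outside_E by blast
  hence "cen E X \<subset> cen T X" using s by (auto simp: cen_def)
  thus "card (cen T (\<alpha> ` X)) < card (cen T X)" using eq psubset_card_mono[OF cen_finite] by simp
qed

lemma card_nor_less:
  assumes \<alpha>: "\<alpha> \<in> F E E" and X: "X \<subseteq> E" and sub: "nor T X \<subseteq> E" and Y: "\<alpha> ` X \<subseteq> K"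
  shows "card (nor T X) < card (nor T (\<alpha> ` X))"
proof -
  have "nor T X = nor E X" using sub E_T by (auto simp: nor_def)
  hence eq: "card (nor T X) = card (nor E (\<alpha> ` X))" using card_nor_image[OF \<alpha> X] by simp
  have s: "nor E (\<alpha> ` X) \<subseteq> nor T (\<alpha> ` X)" using E_T by (auto simp: nor_def)
  obtain g where "g \<in> cen T (\<alpha> ` X)" "g \<notin> E" using cen_outside_E[OF Y] by blast
  hence "g \<in> nor T (\<alpha> ` X)" "g \<notin> E" using cen_subset_nor by blast+
  hence "nor E (\<alpha> ` X) \<subset> nor T (\<alpha> ` X)" using s by (auto simp: nor_def)
  thus ?thesis using eq psubset_card_mono[OF nor_finite] by simp
qed

lemma cen_E_subset: "cen T E \<subseteq> E"
proof
  fix g assume g: "g \<in> cen T E"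
  hence "g \<in> carrier S" using T_carrier by (simp add: cen_def)
  thus "g \<in> E"
    using g E_carrier subgroup.one_closed[OF Z0_subgroup] by (intro self_centralizing) (auto simp: cen_def)
qed

lemma nor_subset_E: "subgroup X S \<Longrightarrow> X \<subseteq> E \<Longrightarrow> X \<noteq> E \<Longrightarrow> \<not> X \<subseteq> K \<Longrightarrow> nor T X \<subseteq> E"
proof
  fix g assume X: "subgroup X S" "X \<subseteq> E" "X \<noteq> E" "\<not> X \<subseteq> K" and "g \<in> nor T X"
  thus "g \<in> E" using normalizer_in_E[OF X] T_carrier by (simp add: nor_def)
qed

text \<open>\<open>A\<close> is the domain to which \<open>\<alpha>\<close>, restricted to \<open>X\<close>, has to be extended.\<close>

lemma extension_in_E:
  assumes \<alpha>: "\<alpha> \<in> F E E" and X: "subgroup X S" "X \<subseteq> E"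
    and cen: "card (cen T X) \<le> card (cen T (\<alpha> ` X))"
    and A: "\<And>g. g \<in> A \<Longrightarrow> g \<in> T \<and> cj S g ` X = X \<and> (\<exists>h\<in>T. \<forall>x\<in>X. \<alpha> (cj S g x) = cj S h (\<alpha> x))"
  shows "A \<subseteq> E \<or> (\<exists>\<beta>\<in>F T T. \<beta> ` E = E \<and> (\<forall>x\<in>X. \<beta> x = \<alpha> x))"
proof (cases "A \<subseteq> E")
  case False
  then obtain g where g: "g \<in> A" "g \<notin> E" by blast
  then obtain h where gh: "g \<in> T" "cj S g ` X = X" "h \<in> T" "\<And>x. x \<in> X \<Longrightarrow> \<alpha> (cj S g x) = cj S h (\<alpha> x)"
    using A by blast
  have cg: "g \<in> carrier S" "h \<in> carrier S" using gh T_carrier by auto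
  have "\<exists>\<delta>\<in>F E E. (\<forall>x\<in>K. \<delta> x \<in> K) \<and> (\<forall>x\<in>X. \<delta> x = \<alpha> x)"
  proof (cases "X = E")
    case True
    \<comment> \<open>As \<open>g\<close> centralizes \<open>k\<close> modulo \<open>Z0\<close>, so
      does \<open>h\<close> with \<open>\<alpha> k\<close>. If \<open>\<alpha> k\<close> were
      outside \<open>K\<close>, this would put \<open>h\<close> into \<open>E\<close>; then
      \<open>g\<close> would act on \<open>E\<close> as the preimage \<open>e\<close> of
      \<open>h\<close>, and \<open>g \<otimes> inv e\<close> would centralize \<open>E\<close>,
      forcing \<open>g\<close> into \<open>E\<close>.\<close>
    have "\<alpha> k \<in> K" if k: "k \<in> K" for k
    proof (rule ccontr)
      assume not: "\<alpha> k \<notin> K"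
      have kE: "k \<in> E" using k K_E by blast
      define c where "c x = inv x \<otimes> cj S g x" for x
      have cE: "c x \<in> E" if "x \<in> E" for x
      proof -
        have "cj S g x \<in> E" using that gh(2) True by blast
        thus ?thesis using that E by (simp add: c_def subgroup.m_closed subgroup.m_inv_closed)
      qed
      have \<alpha>c: "\<alpha> (c x) = inv (\<alpha> x) \<otimes> cj S h (\<alpha> x)" if "x \<in> E" for x
      proof -
        have "cj S g x \<in> E" using that gh(2) True by blast
        thus ?thesis using that F_mult[OF \<alpha>] F_inv[OF \<alpha>] subgroup.m_inv_closed[OF E] gh(4) True
          by (simp add: c_def)
      qed
      have "c k \<in> Z0" unfolding c_def by (rule K_commutator[OF k cg(1)])
      hence "\<alpha> (c k) \<in> Z0" by (rule Aut_E_Z0[OF \<alpha>])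
      hence "inv (\<alpha> k) \<otimes> cj S h (\<alpha> k) \<in> Z0" by (simp only: \<alpha>c[OF kE])
      hence h: "h \<in> E" using self_centralizing_K[OF cg(2) F_mem[OF \<alpha> kE] not] by blast
      obtain \<alpha>' where a': "\<alpha>' \<in> F E E" "\<forall>x\<in>E. \<alpha>' (\<alpha> x) = x" "\<forall>x\<in>E. \<alpha> (\<alpha>' x) = x"
        using F_Aut_inverse[OF \<alpha>] by blast
      define e where "e = \<alpha>' h"
      have e: "e \<in> E" "\<alpha> e = h" using a' h F_mem[OF a'(1)] by (auto simp: e_def)
      have "cj S g x = cj S e x" if x: "x \<in> E" for x
      proof -
        have "\<alpha> (cj S g x) = \<alpha> (cj S e x)" using gh(4) x True F_cj[OF \<alpha> e(1) x] e(2) by simp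
        moreover have "cj S g x \<in> E" "cj S e x \<in> E"
          using gh(2) True x subgroup_cj_closed[OF E e(1) x] by blast+
        ultimately show ?thesis using F_eq[OF \<alpha>] by simp
      qed
      hence "cj S (g \<otimes> inv e) x = x" if "x \<in> E" for x
        using that cg E_carrier e by (simp flip: cj_cj)
      moreover have "g \<otimes> inv e \<in> T" by (rule T_closed(1)[OF gh(1) T_closed(2)[OF subsetD[OF E_T e(1)]]])
      ultimately have "g \<otimes> inv e \<in> E" using cen_E_subset by (auto simp: cen_def)
      hence "g \<otimes> inv e \<otimes> e \<in> E" using e E by (simp add: subgroup.m_closed)
      thus False using g cg E_carrier[OF e(1)] by (simp add: m_assoc)
    qed
    thus ?thesis using \<alpha> by blast
  next
    case XE: False
    have XK: "X \<subseteq> K"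
      using normalizer_in_E[OF X XE _ cg(1)] gh(2) g(2) by blast
    have YK: "\<alpha> ` X \<subseteq> K"
    proof (rule ccontr)
      assume not: "\<not> \<alpha> ` X \<subseteq> K"
      have "subgroup (\<alpha> ` X) S" "\<alpha> ` X \<subseteq> E"
        using F_subset_image[OF \<alpha> X] F_mem[OF \<alpha>] X by auto
      moreover have "\<alpha> ` X \<noteq> E"
        using F_card_image[OF \<alpha> X(2)] card_subset_eq[OF E_finite X(2)] XE by auto
      ultimately have "nor T (\<alpha> ` X) \<subseteq> E" using nor_subset_E not by blast
      hence "cen T (\<alpha> ` X) \<subseteq> E" using cen_subset_nor by blast
      thus False using card_cen_le(2)[OF \<alpha> X(2) _ XK] cen by simp
    qed
    \<comment> \<open>Only for \<open>X\<close> inside \<open>Z0\<close> may \<open>\<alpha>\<close>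
      move \<open>K\<close> and have to be replaced. Otherwise an element of \<open>X\<close>
      outside \<open>Z0\<close> goes from \<open>K\<close> to \<open>K\<close>, and with
      \<open>Z0\<close> this forces \<open>\<alpha>\<close> to preserve \<open>K\<close>.\<close>
    show ?thesis
    proof (cases "X \<subseteq> Z0")
      case True
      thus ?thesis using modify_to_preserve_K[OF \<alpha>] by blast
    next
      case False
      then obtain w where w: "w \<in> X" "w \<notin> Z0" by blast
      define H where "H = {x \<in> K. \<alpha> x \<in> K}"
      have sH: "subgroup H S" unfolding H_def
        by (rule F_preimage_subgroup[OF \<alpha> K_subgroup K_E K_subgroup])
      have ZH: "Z0 \<subseteq> H" using Z0_K Aut_E_Z0[OF \<alpha>] by (auto simp: H_def)
      have HK: "H \<subseteq> K" by (auto simp: H_def)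
      have wH: "w \<in> H" using w XK YK by (auto simp: H_def)
      have "H = K"
        by (rule prime_index_eq[OF Z0_subgroup sH K_subgroup ZH HK card_K prime_p finite_carrier wH w(2)])
      thus ?thesis using \<alpha> by (intro bexI[of _ \<alpha>]) (auto simp: H_def)
    qed
  qed
  then obtain \<delta> where d: "\<delta> \<in> F E E" "\<forall>x\<in>K. \<delta> x \<in> K" "\<forall>x\<in>X. \<delta> x = \<alpha> x" by blast
  then obtain \<beta> where "\<beta> \<in> F T T" "\<beta> ` E = E" "\<forall>x\<in>E. \<beta> x = \<delta> x" using extend_to_T[OF d(1)] by blast
  thus ?thesis using d(3) X by (intro disjI2 bexI[of _ \<beta>]) auto
qed simp

text \<open>If the image is not in \<open>K\<close>, its centralizer lies in \<open>E\<close> and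
  \<open>card_cen_le\<close> applies. If it is in \<open>K\<close>, the bound on normalizers puts
  \<open>X\<close> in \<open>K\<close> too. Then \<open>Z0\<close> is central, and centralizing one
  element of \<open>K\<close> outside \<open>Z0\<close> means centralizing all of
  \<open>K\<close>.\<close>

lemma card_cen_le_of_nor:
  assumes \<alpha>: "\<alpha> \<in> F E E" and X: "subgroup X S" "X \<subseteq> E"
    and nor: "card (nor T (\<alpha> ` X)) \<le> card (nor T X)"
  shows "card (cen T (\<alpha> ` X)) \<le> card (cen T X)"
proof (cases "\<alpha> ` X \<subseteq> K")
  case False
  have s: "subgroup (\<alpha> ` X) S" "\<alpha> ` X \<subseteq> E"
    using F_subset_image[OF \<alpha> X] F_mem[OF \<alpha>] X by auto
  have "cen T (\<alpha> ` X) \<subseteq> E"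
  proof (cases "\<alpha> ` X = E")
    case True
    thus ?thesis using cen_E_subset by simp
  next
    case ne: False
    have "nor T (\<alpha> ` X) \<subseteq> E" by (rule nor_subset_E[OF s ne False])
    thus ?thesis using cen_subset_nor by blast
  qed
  thus ?thesis by (rule card_cen_le(1)[OF \<alpha> X(2)])
next
  case YK: True
  have XE: "X \<noteq> E"
  proof
    assume "X = E"
    hence "E \<subseteq> K" using YK F_Aut_image[OF \<alpha>] by simp
    hence "card E \<le> card K" using card_mono[OF finite_subset[OF K_E E_finite]] by blast
    thus False using card_E card_E_pos prime_gt_1_nat[OF prime_p] by simp
  qed
  have XK: "X \<subseteq> K"
  proof (rule ccontr)
    assume "\<not> X \<subseteq> K"
    hence "nor T X \<subseteq> E" by (rule nor_subset_E[OF X XE])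
    from card_nor_less[OF \<alpha> X(2) this YK] nor show False by simp
  qed
  have "cen T (\<alpha> ` X) \<subseteq> cen T X"
  proof (cases "X \<subseteq> Z0")
    case True
    thus ?thesis using Z0_central T_carrier by (auto simp: cen_def)
  next
    case False
    then obtain w where w: "w \<in> X" "w \<notin> Z0" by blast
    have wE: "w \<in> E" using w X by blast
    obtain \<alpha>' where a': "\<alpha>' \<in> F E E" "\<forall>x\<in>E. \<alpha>' (\<alpha> x) = x" using F_Aut_inverse[OF \<alpha>] by blast
    have wZ: "\<alpha> w \<notin> Z0"
    proof
      assume "\<alpha> w \<in> Z0"
      hence "\<alpha>' (\<alpha> w) \<in> Z0" by (rule Aut_E_Z0[OF a'(1)])
      thus False using a'(2) wE w by simp
    qed
    show ?thesis
    proof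
      fix g assume g: "g \<in> cen T (\<alpha> ` X)"
      hence gT: "g \<in> T" "cj S g (\<alpha> w) = \<alpha> w" using w by (auto simp: cen_def)
      have cg: "g \<in> carrier S" using gT T_carrier by blast
      define H where "H = {x \<in> K. cj S g x = x}"
      have sH: "subgroup H S" unfolding H_def
        using cg subgroup.mem_carrier[OF K_subgroup]
        by (intro subgroup_equalizer[OF K_subgroup]) (auto simp: cj_mult)
      have ZH: "Z0 \<subseteq> H" using Z0_K Z0_central cg by (auto simp: H_def)
      have HK: "H \<subseteq> K" by (auto simp: H_def)
      have wH: "\<alpha> w \<in> H" using w YK gT by (auto simp: H_def)
      have "H = K"
        by (rule prime_index_eq[OF Z0_subgroup sH K_subgroup ZH HK card_K prime_p finite_carrier wH wZ])
      thus "g \<in> cen T X" using XK gT by (auto simp: cen_def H_def)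
    qed
  qed
  thus ?thesis by (rule card_mono[OF cen_finite])
qed

end

section \<open>The subsystem\<close>

context pearl_subtower
begin

text \<open>This predicate and \<open>from_E\<close> look only at values on \<open>P\<close>, so
  they apply to unrestricted formulas and composites; extensionality and codomain are added in
  \<open>D\<close>.\<close>

definition from_T :: "('a \<Rightarrow> 'a) \<Rightarrow> 'a set \<Rightarrow> bool" where
  "from_T \<phi> P \<longleftrightarrow> (\<exists>s\<in>T. \<exists>\<beta>\<in>F T T. \<beta> ` E = E \<and> (\<forall>x\<in>P. \<phi> x = cj S s (\<beta> x)))"

definition from_E :: "('a \<Rightarrow> 'a) \<Rightarrow> 'a set \<Rightarrow> bool" where
  "from_E \<phi> P \<longleftrightarrow> (\<exists>t\<in>T. \<exists>\<alpha>\<in>F E E. \<exists>u\<in>T. cj S t ` P \<subseteq> E \<and> (\<forall>x\<in>P. \<phi> x = cj S u (\<alpha> (cj S t x))))"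

definition D :: "'a fusion" where
  "D P Q = {\<phi> \<in> extensional P. subgroup P S \<and> subgroup Q S \<and> P \<subseteq> T \<and> Q \<subseteq> T \<and> \<phi> ` P \<subseteq> Q \<and>
     (from_T \<phi> P \<or> from_E \<phi> P)}"

lemma from_TI: "s \<in> T \<Longrightarrow> \<beta> \<in> F T T \<Longrightarrow> \<beta> ` E = E \<Longrightarrow> (\<And>x. x \<in> P \<Longrightarrow> \<phi> x = cj S s (\<beta> x)) \<Longrightarrow> from_T \<phi> P"
  unfolding from_T_def by blast

lemma from_TE:
  assumes "from_T \<phi> P"
  obtains s \<beta> where "s \<in> T" "\<beta> \<in> F T T" "\<beta> ` E = E" "\<And>x. x \<in> P \<Longrightarrow> \<phi> x = cj S s (\<beta> x)"
  using assms unfolding from_T_def by blast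

lemma from_EI: "t \<in> T \<Longrightarrow> \<alpha> \<in> F E E \<Longrightarrow> u \<in> T \<Longrightarrow> (\<And>x. x \<in> P \<Longrightarrow> cj S t x \<in> E) \<Longrightarrow>
    (\<And>x. x \<in> P \<Longrightarrow> \<phi> x = cj S u (\<alpha> (cj S t x))) \<Longrightarrow> from_E \<phi> P"
  unfolding from_E_def by blast

lemma from_EE:
  assumes "from_E \<phi> P"
  obtains t \<alpha> u where "t \<in> T" "\<alpha> \<in> F E E" "u \<in> T" "\<And>x. x \<in> P \<Longrightarrow> cj S t x \<in> E"
    "\<And>x. x \<in> P \<Longrightarrow> \<phi> x = cj S u (\<alpha> (cj S t x))"
  using assms unfolding from_E_def by blast

lemma DI:
  assumes "subgroup P S" "subgroup Q S" "P \<subseteq> T" "Q \<subseteq> T" "\<And>x. x \<in> P \<Longrightarrow> \<phi> x \<in> Q"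
    and "from_T \<phi> P \<or> from_E \<phi> P"
  shows "restrict \<phi> P \<in> D P Q"
proof -
  have "from_T (restrict \<phi> P) P \<longleftrightarrow> from_T \<phi> P" "from_E (restrict \<phi> P) P \<longleftrightarrow> from_E \<phi> P"
    by (simp_all add: from_T_def from_E_def)
  thus ?thesis using assms by (auto simp: D_def)
qed

lemma DD:
  assumes "\<phi> \<in> D P Q"
  shows "\<phi> \<in> extensional P" "subgroup P S" "subgroup Q S" "P \<subseteq> T" "Q \<subseteq> T" "\<And>x. x \<in> P \<Longrightarrow> \<phi> x \<in> Q"
    "from_T \<phi> P \<or> from_E \<phi> P"
  using assms by (auto simp: D_def)

lemma T_cj_cj: "s \<in> T \<Longrightarrow> t \<in> T \<Longrightarrow> x \<in> T \<Longrightarrow> cj S s (cj S t x) = cj S (t \<otimes> s) x"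
  by (rule cj_cj[OF T_carrier T_carrier T_carrier])

lemma T_cj_inv: "t \<in> T \<Longrightarrow> x \<in> T \<Longrightarrow> cj S (inv t) (cj S t x) = x" "t \<in> T \<Longrightarrow> x \<in> T \<Longrightarrow> cj S t (cj S (inv t) x) = x"
  using T_carrier by simp_all

lemma E_memT: "x \<in> E \<Longrightarrow> x \<in> T" using E_T by blast

lemma restrict_E: "\<beta> \<in> F T T \<Longrightarrow> \<beta> ` E = E \<Longrightarrow> restrict \<beta> E \<in> F E E"
  using F_codomain[OF F_restrict[OF _ E E_T] E] by (metis image_restrict_eq order_refl)

lemma from_T_imp_F:
  assumes "from_T \<phi> P" "subgroup P S" "P \<subseteq> T" shows "restrict \<phi> P \<in> F P T"
proof -
  obtain s \<beta> where b: "s \<in> T" "\<beta> \<in> F T T" "\<And>x. x \<in> P \<Longrightarrow> \<phi> x = cj S s (\<beta> x)"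
    using assms(1) by (rule from_TE) blast
  from F_comp[OF F_restrict[OF b(2) assms(2,3)] conj_in_Aut_T[OF b(1)]] show ?thesis
    by (rule F_cong) (use b F_mem[OF b(2)] assms(3) in auto)
qed

lemma from_E_imp_F:
  assumes "from_E \<phi> P" "subgroup P S" "P \<subseteq> T" shows "restrict \<phi> P \<in> F P T"
proof -
  obtain t \<alpha> u where a: "t \<in> T" "\<alpha> \<in> F E E" "u \<in> T" "\<And>x. x \<in> P \<Longrightarrow> cj S t x \<in> E"
    "\<And>x. x \<in> P \<Longrightarrow> \<phi> x = cj S u (\<alpha> (cj S t x))"
    using assms(1) by (rule from_EE) blast
  have 1: "(\<lambda>x\<in>P. cj S t x) \<in> F P E" using a(4) by (intro F_conj[OF assms(2) E T_carrier[OF a(1)]]) blast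
  have 2: "(\<lambda>x\<in>E. cj S u x) \<in> F E T"
    using E_T T_closed(4)[OF a(3)] by (intro F_conj[OF E T_subgroup T_carrier[OF a(3)]]) blast
  from F_comp[OF F_comp[OF 1 a(2)] 2] show ?thesis
    by (rule F_cong) (use a F_mem[OF a(2)] in auto)
qed

lemma D_subset_F: "\<phi> \<in> D P Q \<Longrightarrow> \<phi> \<in> F P Q"
proof -
  assume \<phi>: "\<phi> \<in> D P Q"
  note d = DD[OF \<phi>]
  have "restrict \<phi> P \<in> F P T" using d from_T_imp_F from_E_imp_F by blast
  hence "\<phi> \<in> F P T" using d(1) by (simp add: extensional_restrict)
  thus "\<phi> \<in> F P Q" using d(6) by (intro F_codomain[OF _ d(3), of \<phi> P T]) auto
qed

lemma F_T_comp:
  assumes "\<beta> \<in> F T T" "\<beta> ` E = E" "\<beta>' \<in> F T T" "\<beta>' ` E = E"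
  shows "(\<lambda>x\<in>T. \<beta>' (\<beta> x)) \<in> F T T" "(\<lambda>x\<in>T. \<beta>' (\<beta> x)) ` E = E"
proof -
  show "(\<lambda>x\<in>T. \<beta>' (\<beta> x)) \<in> F T T" using assms by (intro F_comp)
  have "(\<lambda>x\<in>T. \<beta>' (\<beta> x)) ` E = \<beta>' ` \<beta> ` E" using E_T by (auto simp: image_iff)
  thus "(\<lambda>x\<in>T. \<beta>' (\<beta> x)) ` E = E" using assms by simp
qed

lemma F_T_inverse:
  assumes "\<beta> \<in> F T T" "\<beta> ` E = E"
  obtains \<beta>' where "\<beta>' \<in> F T T" "\<beta>' ` E = E" "\<And>x. x \<in> T \<Longrightarrow> \<beta>' (\<beta> x) = x" "\<And>x. x \<in> T \<Longrightarrow> \<beta> (\<beta>' x) = x"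
proof -
  obtain \<beta>' where b: "\<beta>' \<in> F T T" "\<forall>x\<in>T. \<beta>' (\<beta> x) = x" "\<forall>x\<in>T. \<beta> (\<beta>' x) = x"
    using F_Aut_inverse[OF assms(1)] by blast
  have "\<beta>' ` \<beta> ` E = E" using b(2) E_memT by (simp add: image_image)
  hence "\<beta>' ` E = E" using assms by simp
  thus ?thesis using that b by blast
qed

text \<open>A map from \<open>T\<close> next to a map from \<open>E\<close> is absorbed: its
  restriction to \<open>E\<close> is an automorphism of \<open>E\<close>, and conjugations pass
  across it. Between two maps from \<open>E\<close> stands a conjugation that carries a subgroup of
  \<open>E\<close> into \<open>E\<close>; \<open>conj_in_E_by_Aut\<close> turns it into an
  automorphism of \<open>E\<close>, so there is again just one passage through
  \<open>E\<close>.\<close>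

lemma D_compose:
  assumes \<phi>: "\<phi> \<in> D P Q" and \<psi>: "\<psi> \<in> D Q R"
  shows "(\<lambda>x\<in>P. \<psi> (\<phi> x)) \<in> D P R"
proof -
  note d = DD[OF \<phi>] and d' = DD[OF \<psi>]
  have "from_T (\<lambda>x. \<psi> (\<phi> x)) P \<or> from_E (\<lambda>x. \<psi> (\<phi> x)) P"
    using d(7)
  proof
    assume "from_T \<phi> P"
    then obtain s \<beta> where b: "s \<in> T" "\<beta> \<in> F T T" "\<beta> ` E = E" "\<And>x. x \<in> P \<Longrightarrow> \<phi> x = cj S s (\<beta> x)"
      by (rule from_TE) blast
    have bT: "x \<in> T \<Longrightarrow> \<beta> x \<in> T" for x using F_mem[OF b(2)] .
    show ?thesis using d'(7)
    proof
      assume "from_T \<psi> Q"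
      then obtain s' \<beta>' where b': "s' \<in> T" "\<beta>' \<in> F T T" "\<beta>' ` E = E" "\<And>x. x \<in> Q \<Longrightarrow> \<psi> x = cj S s' (\<beta>' x)"
        by (rule from_TE) blast
      have bT': "x \<in> T \<Longrightarrow> \<beta>' x \<in> T" for x using F_mem[OF b'(2)] .
      have "from_T (\<lambda>x. \<psi> (\<phi> x)) P"
      proof (rule from_TI[OF _ F_T_comp[OF b(2,3) b'(2,3)]])
        show "\<beta>' s \<otimes> s' \<in> T" by (rule T_closed(1)[OF bT'[OF b(1)] b'(1)])
        fix x assume x: "x \<in> P"
        hence xT: "x \<in> T" using d by blast
        have "\<psi> (\<phi> x) = cj S s' (\<beta>' (cj S s (\<beta> x)))" using b'(4)[OF d(6)[OF x]] b(4)[OF x] by simp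
        also have "\<dots> = cj S s' (cj S (\<beta>' s) (\<beta>' (\<beta> x)))" using F_cj[OF b'(2) b(1) bT[OF xT]] by simp
        also have "\<dots> = cj S (\<beta>' s \<otimes> s') (\<beta>' (\<beta> x))" using b b' bT bT' xT by (simp add: T_cj_cj)
        finally show "\<psi> (\<phi> x) = cj S (\<beta>' s \<otimes> s') ((\<lambda>x\<in>T. \<beta>' (\<beta> x)) x)" using xT by simp
      qed
      thus ?thesis ..
    next
      assume "from_E \<psi> Q"
      then obtain t \<alpha> u where a: "t \<in> T" "\<alpha> \<in> F E E" "u \<in> T" "\<And>x. x \<in> Q \<Longrightarrow> cj S t x \<in> E"
        "\<And>x. x \<in> Q \<Longrightarrow> \<psi> x = cj S u (\<alpha> (cj S t x))" by (rule from_EE) blast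
      obtain \<beta>' where b': "\<beta>' \<in> F T T" "\<beta>' ` E = E" "\<And>x. x \<in> T \<Longrightarrow> \<beta>' (\<beta> x) = x"
        "\<And>x. x \<in> T \<Longrightarrow> \<beta> (\<beta>' x) = x" using b(2,3) by (rule F_T_inverse) blast
      \<comment> \<open>\<open>w\<close> moves the conjugation to the front: applying
        \<open>\<beta>\<close> and then conjugating by \<open>s \<otimes> t\<close> is conjugating
        by \<open>w\<close> and then applying \<open>\<beta>\<close>.\<close>
      define w where "w = \<beta>' (s \<otimes> t)"
      have st: "s \<otimes> t \<in> T" by (rule T_closed(1)[OF b(1) a(1)])
      have w: "w \<in> T" "\<beta> w = s \<otimes> t" using st b'(4) F_mem[OF b'(1)] by (auto simp: w_def)
      have key: "cj S t (\<phi> x) = \<beta> (cj S w x)" if x: "x \<in> P" for x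
      proof -
        have xT: "x \<in> T" using d x by blast
        have "cj S t (\<phi> x) = cj S (s \<otimes> t) (\<beta> x)" using b a x bT[OF xT] by (simp add: T_cj_cj)
        thus ?thesis using F_cj[OF b(2) w(1) xT] w(2) by simp
      qed
      have mem: "cj S w x \<in> E" if x: "x \<in> P" for x
      proof -
        have "\<beta> (cj S w x) \<in> E" using key[OF x] a(4)[OF d(6)[OF x]] by simp
        hence "\<beta>' (\<beta> (cj S w x)) \<in> E" using b'(2) by (metis imageI)
        moreover have "cj S w x \<in> T" by (rule T_closed(4)[OF w(1) subsetD[OF d(4) x]])
        ultimately show ?thesis using b'(3) by simp
      qed
      have "from_E (\<lambda>x. \<psi> (\<phi> x)) P"
      proof (rule from_EI[OF w(1) F_comp[OF restrict_E[OF b(2,3)] a(2)] a(3) mem])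
        fix x assume x: "x \<in> P"
        show "\<psi> (\<phi> x) = cj S u ((\<lambda>x\<in>E. \<alpha> (restrict \<beta> E x)) (cj S w x))"
          using a(5)[OF d(6)[OF x]] key[OF x] mem[OF x] by simp
      qed
      thus ?thesis ..
    qed
  next
    assume "from_E \<phi> P"
    then obtain t \<alpha> u where a: "t \<in> T" "\<alpha> \<in> F E E" "u \<in> T" "\<And>x. x \<in> P \<Longrightarrow> cj S t x \<in> E"
      "\<And>x. x \<in> P \<Longrightarrow> \<phi> x = cj S u (\<alpha> (cj S t x))" by (rule from_EE) blast
    have aE: "x \<in> P \<Longrightarrow> \<alpha> (cj S t x) \<in> E" for x using a(4) F_mem[OF a(2)] by blast
    have "from_E (\<lambda>x. \<psi> (\<phi> x)) P" using d'(7)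
    proof
      assume "from_T \<psi> Q"
      then obtain s \<beta> where b: "s \<in> T" "\<beta> \<in> F T T" "\<beta> ` E = E" "\<And>x. x \<in> Q \<Longrightarrow> \<psi> x = cj S s (\<beta> x)"
        by (rule from_TE) blast
      have bT: "x \<in> T \<Longrightarrow> \<beta> x \<in> T" for x using F_mem[OF b(2)] .
      show ?thesis
      proof (rule from_EI[OF a(1) F_comp[OF a(2) restrict_E[OF b(2,3)]] _ a(4)])
        show "\<beta> u \<otimes> s \<in> T" by (rule T_closed(1)[OF bT[OF a(3)] b(1)])
        fix x assume x: "x \<in> P"
        have yT: "\<alpha> (cj S t x) \<in> T" using aE[OF x] E_T by blast
        have "\<psi> (\<phi> x) = cj S s (\<beta> (cj S u (\<alpha> (cj S t x))))" using b(4)[OF d(6)[OF x]] a(5)[OF x] by simp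
        also have "\<dots> = cj S s (cj S (\<beta> u) (\<beta> (\<alpha> (cj S t x))))"
          using F_cj[OF b(2) a(3) yT] by simp
        also have "\<dots> = cj S (\<beta> u \<otimes> s) (\<beta> (\<alpha> (cj S t x)))" using b bT a yT by (simp add: T_cj_cj)
        finally show "\<psi> (\<phi> x) = cj S (\<beta> u \<otimes> s) ((\<lambda>x\<in>E. restrict \<beta> E (\<alpha> x)) (cj S t x))"
          using a(4)[OF x] aE[OF x] by simp
      qed
    next
      assume "from_E \<psi> Q"
      then obtain t' \<alpha>' u' where a': "t' \<in> T" "\<alpha>' \<in> F E E" "u' \<in> T" "\<And>x. x \<in> Q \<Longrightarrow> cj S t' x \<in> E"
        "\<And>x. x \<in> Q \<Longrightarrow> \<psi> x = cj S u' (\<alpha>' (cj S t' x))" by (rule from_EE) blast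
      define X where "X = \<alpha> ` cj S t ` P"
      have tP: "cj S t ` P \<subseteq> E" using a(4) by blast
      have sX: "subgroup X S" unfolding X_def
        by (rule F_subset_image[OF a(2) subgroup_cj_image[OF d(2) T_carrier[OF a(1)]] tP])
      have XE: "X \<subseteq> E" using aE by (auto simp: X_def)
      have ut: "u \<otimes> t' \<in> T" by (rule T_closed(1)[OF a(3) a'(1)])
      have mv: "cj S t' (\<phi> x) = cj S (u \<otimes> t') (\<alpha> (cj S t x))" if x: "x \<in> P" for x
        using a(3,5) a'(1) aE[OF x] x E_memT by (simp add: T_cj_cj)
      have "cj S (u \<otimes> t') ` X \<subseteq> E" using mv a'(4) d(6) by (auto simp: X_def simp flip: mv)
      from conj_in_E_by_Aut[OF sX XE T_carrier[OF ut] this] obtain \<gamma>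
        where g: "\<gamma> \<in> F E E" "\<forall>x\<in>X. cj S (u \<otimes> t') x = \<gamma> x" by blast
      show ?thesis
      proof (rule from_EI[OF a(1) F_comp[OF F_comp[OF a(2) g(1)] a'(2)] a'(3) a(4)])
        fix x assume x: "x \<in> P"
        have "\<psi> (\<phi> x) = cj S u' (\<alpha>' (cj S t' (\<phi> x)))" using a'(5)[OF d(6)[OF x]] .
        also have "cj S t' (\<phi> x) = \<gamma> (\<alpha> (cj S t x))" using mv[OF x] g(2) x by (auto simp: X_def)
        finally show "\<psi> (\<phi> x) = cj S u' ((\<lambda>x\<in>E. \<alpha>' ((\<lambda>x\<in>E. \<gamma> (\<alpha> x)) x)) (cj S t x))"
          using a(4)[OF x] by simp
      qed
    qed
    thus ?thesis ..
  qed
  thus ?thesis using d d' by (intro DI) auto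
qed

lemma D_inverse:
  assumes \<phi>: "\<phi> \<in> D P Q" and \<chi>: "\<And>x. x \<in> P \<Longrightarrow> \<chi> (\<phi> x) = x"
  shows "restrict \<chi> (\<phi> ` P) \<in> D (\<phi> ` P) P"
proof (rule DI)
  note d = DD[OF \<phi>]
  show "subgroup (\<phi> ` P) S" by (rule F_image_subgroup[OF D_subset_F[OF \<phi>]])
  show "subgroup P S" "P \<subseteq> T" "\<phi> ` P \<subseteq> T" using d by auto
  show "\<chi> y \<in> P" if "y \<in> \<phi> ` P" for y using that \<chi> by auto
  show "from_T \<chi> (\<phi> ` P) \<or> from_E \<chi> (\<phi> ` P)" using d(7)
  proof
    assume "from_T \<phi> P"
    then obtain s \<beta> where b: "s \<in> T" "\<beta> \<in> F T T" "\<beta> ` E = E" "\<And>x. x \<in> P \<Longrightarrow> \<phi> x = cj S s (\<beta> x)"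
      by (rule from_TE) blast
    obtain \<beta>' where b': "\<beta>' \<in> F T T" "\<beta>' ` E = E" "\<And>x. x \<in> T \<Longrightarrow> \<beta>' (\<beta> x) = x"
      using b(2,3) by (rule F_T_inverse) blast
    have isT: "inv s \<in> T" by (rule T_closed(2)[OF b(1)])
    have "from_T \<chi> (\<phi> ` P)"
    proof (rule from_TI[OF F_mem[OF b'(1) isT] b'(1,2)])
      fix y assume "y \<in> \<phi> ` P"
      then obtain x where x: "x \<in> P" "y = \<phi> x" by blast
      have xT: "x \<in> T" "\<beta> x \<in> T" using x d F_mem[OF b(2)] by auto
      have yT: "y \<in> T" using x(2) b(4)[OF x(1)] xT b(1) T_closed(4) by simp
      have "cj S (\<beta>' (inv s)) (\<beta>' y) = \<beta>' (cj S (inv s) y)" using F_cj[OF b'(1) isT yT] by simp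
      also have "\<dots> = x" using x(2) b(4)[OF x(1)] b(1) xT b'(3) by (simp add: T_cj_inv)
      finally show "\<chi> y = cj S (\<beta>' (inv s)) (\<beta>' y)" using x \<chi> by simp
    qed
    thus ?thesis ..
  next
    assume "from_E \<phi> P"
    then obtain t \<alpha> u where a: "t \<in> T" "\<alpha> \<in> F E E" "u \<in> T" "\<And>x. x \<in> P \<Longrightarrow> cj S t x \<in> E"
      "\<And>x. x \<in> P \<Longrightarrow> \<phi> x = cj S u (\<alpha> (cj S t x))" by (rule from_EE) blast
    obtain \<alpha>' where a': "\<alpha>' \<in> F E E" "\<forall>x\<in>E. \<alpha>' (\<alpha> x) = x" using F_Aut_inverse[OF a(2)] by blast
    have y: "cj S (inv u) (\<phi> x) = \<alpha> (cj S t x)" if x: "x \<in> P" for x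
      using a(3,5) x F_mem[OF a(2) a(4)[OF x]] E_memT by (simp add: T_cj_inv)
    have "from_E \<chi> (\<phi> ` P)"
    proof (rule from_EI[of "inv u" \<alpha>' "inv t"])
      show "inv u \<in> T" "inv t \<in> T" using a T_closed by auto
      fix v assume "v \<in> \<phi> ` P"
      then obtain x where x: "x \<in> P" "v = \<phi> x" by blast
      show "cj S (inv u) v \<in> E" using y[OF x(1)] x F_mem[OF a(2) a(4)[OF x(1)]] by simp
      have "x \<in> T" using x d by blast
      thus "\<chi> v = cj S (inv t) (\<alpha>' (cj S (inv u) v))"
        using y[OF x(1)] x a'(2) a(4)[OF x(1)] \<chi> a(1) by (simp add: T_cj_inv)
    qed (rule a'(1))
    thus ?thesis ..
  qed
qed

section \<open>\<open>D\<close> as the smallest subsystem\<close>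

abbreviation ST :: "('a, 'b) monoid_scheme" where "ST \<equiv> S\<lparr>carrier := T\<rparr>"

lemma cj_ST: "g \<in> T \<Longrightarrow> cj ST g x = cj S g x"
  by (simp add: cj_def m_inv_consistent[OF T_subgroup])

lemma subgroup_ST: "subgroup P ST \<longleftrightarrow> subgroup P S \<and> P \<subseteq> T"
  using incl_subgroup[OF T_subgroup] subgroup_incl[OF _ T_subgroup] subgroup.subset[of P ST] by auto

sublocale DF: fusion_system p ST D
proof -
  interpret ST: p_group p ST by (rule p_group_subgroup[OF T_subgroup])
  show "fusion_system p ST D"
  proof unfold_locales
    fix \<phi> P Q assume \<phi>: "\<phi> \<in> D P Q"
    note d = DD[OF \<phi>] and f = D_subset_F[OF \<phi>]
    show "subgroup P ST \<and> subgroup Q ST" using d by (simp add: subgroup_ST)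
    show "\<phi> \<in> mon (ST\<lparr>carrier := P\<rparr>) (ST\<lparr>carrier := Q\<rparr>) \<inter> extensional P"
      using injective_hom[OF f] by simp
    show "\<phi> \<in> D P (\<phi> ` P)"
      using d F_image_subgroup[OF f] by (auto simp: D_def)
    show "restrict (inv_into P \<phi>) (\<phi> ` P) \<in> D (\<phi> ` P) P"
      using F_inj[OF f] by (intro D_inverse[OF \<phi>]) auto
    fix \<psi> R assume "\<psi> \<in> D Q R"
    from D_compose[OF \<phi> this] show "compose P \<psi> \<phi> \<in> D P R" by (simp add: compose_def)
  next
    fix P Q assume "subgroup P ST" "subgroup Q ST"
    hence PQ: "subgroup P S" "P \<subseteq> T" "subgroup Q S" "Q \<subseteq> T" by (simp_all add: subgroup_ST)
    show "conj_hom ST P Q \<subseteq> D P Q"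
    proof
      fix \<phi> assume "\<phi> \<in> conj_hom ST P Q"
      then obtain g where g: "g \<in> T" "\<phi> = (\<lambda>x\<in>P. cj ST g x)" "cj ST g ` P \<subseteq> Q"
        by (auto simp: conj_hom_cj)
      have id: "(\<lambda>x\<in>T. x) \<in> F T T" by (rule F_incl[OF T_subgroup T_subgroup order_refl])
      have "from_T (cj S g) P"
        using E_T PQ(2) by (intro from_TI[OF g(1) id]) auto
      hence "restrict (cj S g) P \<in> D P Q"
        using PQ g by (intro DI) (auto simp: cj_ST)
      moreover have "restrict (cj S g) P = \<phi>" using g by (simp add: cj_ST)
      ultimately show "\<phi> \<in> D P Q" by simp
    qed
  qed
qed

lemma D_fusion_subsystem: "fusion_subsystem p S T D F"
  using T_subgroup DF.fusion_system_axioms D_subset_F by (auto simp: fusion_subsystem_def)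

lemma D_E: "D E E = F E E"
proof (intro subset_antisym subsetI)
  fix \<alpha> assume a: "\<alpha> \<in> F E E"
  have "from_E \<alpha> E"
    using F_carrier[OF a] E_carrier by (intro from_EI[OF T_closed(3) a T_closed(3)]) auto
  hence "restrict \<alpha> E \<in> D E E" using E E_T F_mem[OF a] by (intro DI) auto
  thus "\<alpha> \<in> D E E" using F_ext[OF a] by (simp add: extensional_restrict)
qed (rule D_subset_F)

text \<open>A map from \<open>E\<close> requires a conjugate of its domain to lie in
  \<open>E\<close>, which is impossible for \<open>T\<close>.\<close>

lemma D_T: "\<phi> \<in> D T T \<longleftrightarrow> \<phi> \<in> extensional T \<and> from_T \<phi> T"
proof
  assume \<phi>: "\<phi> \<in> D T T"
  note d = DD[OF \<phi>]
  have "\<not> from_E \<phi> T"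
  proof
    assume "from_E \<phi> T"
    then obtain t where t: "t \<in> T" "cj S t ` T \<subseteq> E" by (auto simp: from_E_def)
    have "cj S t ` T = T" by (rule cj_image_self[OF T_subgroup t(1)])
    thus False using t E_T E_ne_T by auto
  qed
  thus "\<phi> \<in> extensional T \<and> from_T \<phi> T" using d by blast
next
  assume \<phi>: "\<phi> \<in> extensional T \<and> from_T \<phi> T"
  hence "restrict \<phi> T \<in> F T T" by (intro from_T_imp_F[OF _ T_subgroup order_refl]) blast
  hence "\<phi> \<in> F T T" using \<phi> extensional_restrict[of \<phi> T] by simp
  hence "restrict \<phi> T \<in> D T T" using \<phi> T_subgroup F_mem by (intro DI) auto
  thus "\<phi> \<in> D T T" using \<phi> by (simp add: extensional_restrict)
qed

lemma D_T_eq: "D T T = Inn S T <#>\<^bsub>Aut_group S F T\<^esub> Aut_normalizer F T E"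
proof (intro subset_antisym subsetI)
  fix \<phi> assume "\<phi> \<in> D T T"
  hence \<phi>: "\<phi> \<in> extensional T" "from_T \<phi> T" by (simp_all add: D_T)
  obtain s \<beta> where b: "s \<in> T" "\<beta> \<in> F T T" "\<beta> ` E = E" "\<And>x. x \<in> T \<Longrightarrow> \<phi> x = cj S s (\<beta> x)"
    using \<phi>(2) by (rule from_TE) blast
  have "\<phi> = (\<lambda>x\<in>T. (\<lambda>x\<in>T. cj S s x) (\<beta> x))"
    using \<phi>(1) b(4) F_mem[OF b(2)] by (intro extensionalityI[of _ T]) auto
  also have "\<dots> = (\<lambda>x\<in>T. cj S s x) \<otimes>\<^bsub>Aut_group S F T\<^esub> \<beta>"
    by (rule Aut_group_simps(3)[OF T_subgroup conj_in_Aut_T[OF b(1)] b(2), symmetric])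
  also have "\<dots> \<in> Inn S T <#>\<^bsub>Aut_group S F T\<^esub> Aut_normalizer F T E"
    using b by (auto simp: set_mult_def Inn_def conj_map_cj Aut_normalizer_def)
  finally show "\<phi> \<in> Inn S T <#>\<^bsub>Aut_group S F T\<^esub> Aut_normalizer F T E" .
next
  fix \<phi> assume "\<phi> \<in> Inn S T <#>\<^bsub>Aut_group S F T\<^esub> Aut_normalizer F T E"
  then obtain s \<beta> where b: "s \<in> T" "\<beta> \<in> F T T" "\<beta> ` E = E"
    "\<phi> = (\<lambda>x\<in>T. cj S s x) \<otimes>\<^bsub>Aut_group S F T\<^esub> \<beta>"
    by (auto simp: set_mult_def Inn_def conj_map_cj Aut_normalizer_def)
  hence "\<phi> = (\<lambda>x\<in>T. (\<lambda>x\<in>T. cj S s x) (\<beta> x))"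
    using Aut_group_simps(3)[OF T_subgroup conj_in_Aut_T[OF b(1)] b(2)] by simp
  thus "\<phi> \<in> D T T"
    unfolding D_T using b F_mem[OF b(2)] by (auto intro!: from_TI[OF b(1-3)])
qed

text \<open>A competitor contains the given automorphisms of \<open>T\<close> and \<open>E\<close>
  and the conjugations by \<open>T\<close>, hence also their restrictions and composites.
  \<open>D\<close> being one of the candidates, it is the value of \<open>LEAST\<close>.\<close>

lemma D_least:
  assumes D': "fusion_subsystem p S T D' F" "D' E E = F E E"
    "D' T T = Inn S T <#>\<^bsub>Aut_group S F T\<^esub> Aut_normalizer F T E"
  shows "D \<le> D'"
proof (intro le_funI subsetI)
  fix P Q \<phi> assume \<phi>: "\<phi> \<in> D P Q"
  note d = DD[OF \<phi>]
  interpret D': fusion_system p ST D' using D'(1) by (simp add: fusion_subsystem_def)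
  have P: "subgroup P ST" "subgroup Q ST" "subgroup E ST" "subgroup T ST"
    using d E E_T T_subgroup by (simp_all add: subgroup_ST)
  have "\<phi> \<in> D' P T" using d(7)
  proof
    assume "from_T \<phi> P"
    then obtain s \<beta> where b: "s \<in> T" "\<beta> \<in> F T T" "\<beta> ` E = E" "\<And>x. x \<in> P \<Longrightarrow> \<phi> x = cj S s (\<beta> x)"
      by (rule from_TE) blast
    have "(\<lambda>x\<in>T. cj S s (\<beta> x)) \<in> D T T"
      unfolding D_T by (auto intro!: from_TI[OF b(1-3)])
    hence "(\<lambda>x\<in>T. cj S s (\<beta> x)) \<in> D' T T" using D'(3) D_T_eq by simp
    from D'.F_restrict[OF this P(1) d(4)] show ?thesis
      by (rule D'.F_eqI) (use d b in auto)
  next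
    assume "from_E \<phi> P"
    then obtain t \<alpha> u where a: "t \<in> T" "\<alpha> \<in> F E E" "u \<in> T" "\<And>x. x \<in> P \<Longrightarrow> cj S t x \<in> E"
      "\<And>x. x \<in> P \<Longrightarrow> \<phi> x = cj S u (\<alpha> (cj S t x))" by (rule from_EE) blast
    have 1: "(\<lambda>x\<in>P. cj ST t x) \<in> D' P E"
      using a(1,4) by (intro D'.F_conj[OF P(1,3)]) (auto simp: cj_ST)
    have 2: "\<alpha> \<in> D' E E" using a(2) D'(2) by simp
    have 3: "(\<lambda>x\<in>E. cj ST u x) \<in> D' E T"
      using a(3) T_closed(4)[OF a(3)] E_T by (intro D'.F_conj[OF P(3,4)]) (auto simp: cj_ST)
    from D'.F_comp[OF D'.F_comp[OF 1 2] 3] show ?thesis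
      by (rule D'.F_eqI) (use d(1) a F_mem[OF a(2)] in \<open>auto simp: cj_ST\<close>)
  qed
  thus "\<phi> \<in> D' P Q" using d(6) by (intro D'.F_codomain[OF _ P(2)]) auto
qed

lemma pearl_subsystem_eq: "pearl_subsystem p S F E i = D"
  unfolding pearl_subsystem_def Let_def T_def[symmetric]
  using D_fusion_subsystem D_E D_T_eq D_least by (intro Least_equality) auto

section \<open>Saturation: the extension axiom and full centralization\<close>

lemma normalizer_ST: "P \<subseteq> T \<Longrightarrow> normalizer ST P = nor T P"
proof (rule Set.set_eqI)
  fix g assume P: "P \<subseteq> T"
  have "cj ST g ` P = cj S g ` P" if "g \<in> T" using that by (simp add: cj_ST)
  thus "g \<in> normalizer ST P \<longleftrightarrow> g \<in> nor T P"
    using DF.mem_normalizer_iff[of P g] P by (cases "g \<in> T") (simp_all add: nor_def)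
qed

lemma centralizer_ST: "P \<subseteq> T \<Longrightarrow> centralizer ST P = cen T P"
proof (rule Set.set_eqI)
  fix g assume P: "P \<subseteq> T"
  have "cj S g x = x \<longleftrightarrow> g \<otimes> x = x \<otimes> g" if "g \<in> T" "x \<in> P" for x
    using that P T_carrier by (intro cj_eq_self_iff) auto
  thus "g \<in> centralizer ST P \<longleftrightarrow> g \<in> cen T P"
    by (auto simp: centralizer_def cen_def)
qed

lemma image_restrict_subset: "P \<subseteq> A \<Longrightarrow> restrict f A ` P = f ` P"
  by (rule image_cong) auto

lemma card_cen_conj: "t \<in> T \<Longrightarrow> P \<subseteq> T \<Longrightarrow> card (cen T (cj S t ` P)) = card (cen T P)"
  using card_cen_image[OF conj_in_Aut_T, of t P] by (simp only: image_restrict_subset)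

lemma card_nor_conj: "t \<in> T \<Longrightarrow> P \<subseteq> T \<Longrightarrow> card (nor T (cj S t ` P)) = card (nor T P)"
  using card_nor_image[OF conj_in_Aut_T, of t P] by (simp only: image_restrict_subset)

lemma from_E_image:
  assumes \<phi>: "\<phi> \<in> D P Q" and "from_E \<phi> P"
  obtains t \<alpha> u where "t \<in> T" "\<alpha> \<in> F E E" "u \<in> T" "\<And>x. x \<in> P \<Longrightarrow> cj S t x \<in> E"
    "\<And>x. x \<in> P \<Longrightarrow> \<phi> x = cj S u (\<alpha> (cj S t x))"
    "subgroup (cj S t ` P) S" "cj S t ` P \<subseteq> E" "\<alpha> ` cj S t ` P \<subseteq> E" "\<phi> ` P = cj S u ` \<alpha> ` cj S t ` P"
proof -
  obtain t \<alpha> u where a: "t \<in> T" "\<alpha> \<in> F E E" "u \<in> T" "\<And>x. x \<in> P \<Longrightarrow> cj S t x \<in> E"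
    "\<And>x. x \<in> P \<Longrightarrow> \<phi> x = cj S u (\<alpha> (cj S t x))" using assms(2) by (rule from_EE) blast
  show ?thesis
  proof (rule that[OF a])
    show "subgroup (cj S t ` P) S" by (rule subgroup_cj_image[OF DD(2)[OF \<phi>] T_carrier[OF a(1)]])
    show "cj S t ` P \<subseteq> E" "\<alpha> ` cj S t ` P \<subseteq> E" using a(4) F_mem[OF a(2)] by auto
    show "\<phi> ` P = cj S u ` \<alpha> ` cj S t ` P" using a(5) by (auto simp: image_image)
  qed
qed

lemma from_T_image:
  assumes \<phi>: "\<phi> \<in> D P Q" and "from_T \<phi> P"
  shows "\<exists>\<beta>\<in>F T T. \<phi> ` P = \<beta> ` P"
proof -
  obtain s \<beta> where b: "s \<in> T" "\<beta> \<in> F T T" "\<beta> ` E = E" "\<And>x. x \<in> P \<Longrightarrow> \<phi> x = cj S s (\<beta> x)"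
    using assms(2) by (rule from_TE) blast
  have "\<phi> ` P = (\<lambda>x\<in>T. (\<lambda>x\<in>T. cj S s x) (\<beta> x)) ` P"
    using b(4) DD(4)[OF \<phi>] F_mem[OF b(2)] by (intro image_cong) auto
  thus ?thesis using F_comp[OF b(2) conj_in_Aut_T[OF b(1)]] by blast
qed

text \<open>A map from \<open>T\<close> is a formula valid on all of \<open>T\<close>. A map from
  \<open>E\<close> is conjugated to \<open>\<alpha>\<close> on a subgroup \<open>X\<close> of
  \<open>E\<close>; by \<open>extension_in_E\<close> either the domain of the extension stays in
  \<open>E\<close>, where \<open>\<alpha>\<close> is defined, or \<open>\<alpha>\<close> agrees on
  \<open>X\<close> with an automorphism of \<open>T\<close> that preserves \<open>E\<close>.\<close>

lemma D_extension:
  assumes \<phi>: "\<phi> \<in> D P T" and full: "fully_centralized ST D (\<phi> ` P)"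
  shows "\<exists>\<psi>\<in>D (extension_domain ST P \<phi>) T. \<forall>x\<in>P. \<psi> x = \<phi> x"
proof -
  note d = DD[OF \<phi>]
  define A where "A = extension_domain ST P \<phi>"
  have A: "g \<in> A \<longleftrightarrow> g \<in> T \<and> cj S g ` P = P \<and> (\<exists>h\<in>T. \<forall>x\<in>P. \<phi> (cj S g x) = cj S h (\<phi> x))" for g
    unfolding A_def DF.mem_extension_domain[OF \<phi>] by (auto simp: cj_ST)
  have sA: "subgroup A S" "A \<subseteq> T"
    using DF.subgroup_extension_domain[OF \<phi>] by (simp_all add: A_def subgroup_ST)
  have PA: "P \<subseteq> A"
  proof
    fix g assume g: "g \<in> P"
    have "\<phi> (cj S g x) = cj S (\<phi> g) (\<phi> x)" if "x \<in> P" for x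
      using F_cj[OF D_subset_F[OF \<phi>] g that] .
    thus "g \<in> A" unfolding A using g d(4) d(6)[OF g] cj_image_self[OF d(2) g] by blast
  qed
  have ext: ?thesis
    if "from_T \<psi> A \<or> from_E \<psi> A" "\<And>x. x \<in> A \<Longrightarrow> \<psi> x \<in> T" "\<And>x. x \<in> P \<Longrightarrow> \<psi> x = \<phi> x" for \<psi>
  proof -
    have "restrict \<psi> A \<in> D A T" using that sA T_subgroup by (intro DI) auto
    thus ?thesis using that PA unfolding A_def by (intro bexI[of _ "restrict \<psi> A"]) (auto simp: A_def)
  qed
  show ?thesis using d(7)
  proof
    assume "from_T \<phi> P"
    then obtain s \<beta> where b: "s \<in> T" "\<beta> \<in> F T T" "\<beta> ` E = E" "\<And>x. x \<in> P \<Longrightarrow> \<phi> x = cj S s (\<beta> x)"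
      by (rule from_TE) blast
    have "from_T (\<lambda>x. cj S s (\<beta> x)) A" by (rule from_TI[OF b(1-3)]) simp
    moreover have "cj S s (\<beta> x) \<in> T" if "x \<in> A" for x
      by (rule T_closed(4)[OF b(1) F_mem[OF b(2) subsetD[OF sA(2) that]]])
    ultimately show ?thesis using b(4) by (intro ext[of "\<lambda>x. cj S s (\<beta> x)"]) auto
  next
    assume "from_E \<phi> P"
    with \<phi> obtain t \<alpha> u where a: "t \<in> T" "\<alpha> \<in> F E E" "u \<in> T" "\<And>x. x \<in> P \<Longrightarrow> cj S t x \<in> E"
      "\<And>x. x \<in> P \<Longrightarrow> \<phi> x = cj S u (\<alpha> (cj S t x))"
      "subgroup (cj S t ` P) S" "cj S t ` P \<subseteq> E" "\<alpha> ` cj S t ` P \<subseteq> E" "\<phi> ` P = cj S u ` \<alpha> ` cj S t ` P"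
      by (rule from_E_image) blast
    define X where "X = cj S t ` P"
    have itu: "inv t \<in> T" "inv u \<in> T" using a(1,3) T_closed(2) by auto
    obtain \<alpha>' where a': "\<alpha>' \<in> F E E" "\<forall>x\<in>E. \<alpha>' (\<alpha> x) = x" using F_Aut_inverse[OF a(2)] by blast
    have aT: "\<alpha> (cj S t x) \<in> T" if "x \<in> P" for x
      by (rule E_memT[OF F_mem[OF a(2) a(4)[OF that]]])
    \<comment> \<open>\<open>\<chi>\<close> is a morphism of \<open>D\<close> from the image of
      \<open>P\<close> onto \<open>X\<close>, so full centralization of that image bounds the
      centralizer of \<open>X\<close>; conjugation by \<open>u\<close> does not change the
      order.\<close>
    have "card (cen T X) \<le> card (cen T (\<alpha> ` X))"
    proof -
      define \<chi> where "\<chi> y = \<alpha>' (cj S (inv u) y)" for y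
      have y: "cj S (inv u) (\<phi> x) = \<alpha> (cj S t x)" if x: "x \<in> P" for x
        using a(3) a(5)[OF x] aT[OF x] by (simp add: T_cj_inv)
      have \<chi>\<phi>: "\<chi> (\<phi> x) = cj S t x" if x: "x \<in> P" for x
        using y[OF x] a'(2) a(4)[OF x] by (simp add: \<chi>_def)
      have "from_E \<chi> (\<phi> ` P)"
      proof (rule from_EI[OF itu(2) a'(1) T_closed(3)])
        fix v assume "v \<in> \<phi> ` P"
        then obtain x where x: "x \<in> P" "v = \<phi> x" by blast
        show "cj S (inv u) v \<in> E" using y[OF x(1)] x(2) F_mem[OF a(2) a(4)[OF x(1)]] by simp
        show "\<chi> v = cj S \<one> (\<alpha>' (cj S (inv u) v))"
          using y[OF x(1)] x(2) a'(2) a(4)[OF x(1)] E_carrier by (simp add: \<chi>_def)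
      qed
      moreover have "\<chi> v \<in> T" if "v \<in> \<phi> ` P" for v using that \<chi>\<phi> a(4) E_memT by auto
      moreover have "\<phi> ` P \<subseteq> T" using d(6) by blast
      ultimately have "restrict \<chi> (\<phi> ` P) \<in> D (\<phi> ` P) T"
        using F_image_subgroup[OF D_subset_F[OF \<phi>]] T_subgroup by (intro DI) auto
      moreover have "restrict \<chi> (\<phi> ` P) ` \<phi> ` P = X" using \<chi>\<phi> by (auto simp: X_def image_image)
      ultimately have "card (centralizer ST X) \<le> card (centralizer ST (\<phi> ` P))"
        using full by (auto simp: fully_centralized_def)
      moreover have "X \<subseteq> T" "\<alpha> ` X \<subseteq> T" using a(7,8) E_T by (auto simp: X_def)
      ultimately show ?thesis
        using \<open>\<phi> ` P \<subseteq> T\<close> a(9) card_cen_conj[OF a(3), of "\<alpha> ` X"] by (simp add: centralizer_ST X_def)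
    qed
    \<comment> \<open>The domain for \<open>\<phi>\<close>, conjugated by \<open>t\<close>,
      satisfies the conditions for extending \<open>\<alpha>\<close> from \<open>X\<close>: the
      partner \<open>h\<close> is carried back by \<open>inv u\<close>.\<close>
    moreover have "g \<in> T \<and> cj S g ` X = X \<and> (\<exists>h\<in>T. \<forall>x\<in>X. \<alpha> (cj S g x) = cj S h (\<alpha> x))"
      if g: "g \<in> cj S t ` A" for g
    proof -
      obtain g0 where g0: "g0 \<in> A" "g = cj S t g0" using g by blast
      then obtain h where h: "g0 \<in> T" "cj S g0 ` P = P" "h \<in> T"
        "\<And>x. x \<in> P \<Longrightarrow> \<phi> (cj S g0 x) = cj S h (\<phi> x)" using A by blast
      have mem: "cj S g0 x \<in> P" if "x \<in> P" for x using h(2) that by blast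
      have gt: "cj S g (cj S t x) = cj S t (cj S g0 x)" if x: "x \<in> P" for x
        using g0(2) a(1) h(1) T_carrier d(4) x by (simp add: cj_def m_assoc inv_mult_group subset_iff)
      have "cj S g ` X = cj S t ` cj S g0 ` P" using gt by (auto simp: X_def image_image)
      hence 1: "cj S g ` X = X" using h(2) by (simp add: X_def)
      have 2: "\<alpha> (cj S g (cj S t x)) = cj S (u \<otimes> h \<otimes> inv u) (\<alpha> (cj S t x))" if x: "x \<in> P" for x
      proof -
        have "cj S u (\<alpha> (cj S t (cj S g0 x))) = cj S h (cj S u (\<alpha> (cj S t x)))"
          using h(4)[OF x] a(5)[OF x] a(5)[OF mem[OF x]] by simp
        hence "\<alpha> (cj S t (cj S g0 x)) = cj S (inv u) (cj S h (cj S u (\<alpha> (cj S t x))))"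
          using T_cj_inv(1)[OF a(3) aT[OF mem[OF x]]] by simp
        also have "\<dots> = cj S (u \<otimes> h \<otimes> inv u) (\<alpha> (cj S t x))"
          using a(3) h(3) aT[OF x] T_carrier by (simp add: cj_cj m_assoc)
        finally show ?thesis using gt[OF x] by simp
      qed
      have "g \<in> T" using g0(2) a(1) h(1) T_closed(4) by simp
      moreover have "u \<otimes> h \<otimes> inv u \<in> T" by (rule T_closed(1)[OF T_closed(1)[OF a(3) h(3)] itu(2)])
      ultimately show ?thesis using 1 2 by (auto simp: X_def)
    qed
    ultimately have "cj S t ` A \<subseteq> E \<or> (\<exists>\<beta>\<in>F T T. \<beta> ` E = E \<and> (\<forall>x\<in>X. \<beta> x = \<alpha> x))"
      using extension_in_E[OF a(2), of X "cj S t ` A"] a(6,7) by (simp add: X_def)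
    thus ?thesis
    proof
      assume sub: "cj S t ` A \<subseteq> E"
      have "from_E (\<lambda>x. cj S u (\<alpha> (cj S t x))) A"
        using sub by (intro from_EI[OF a(1-3)]) auto
      moreover have "cj S u (\<alpha> (cj S t x)) \<in> T" if "x \<in> A" for x
        using sub that by (intro T_closed(4)[OF a(3)] E_memT F_mem[OF a(2)]) blast
      ultimately show ?thesis using a(5) by (intro ext[of "\<lambda>x. cj S u (\<alpha> (cj S t x))"]) auto
    next
      assume "\<exists>\<beta>\<in>F T T. \<beta> ` E = E \<and> (\<forall>x\<in>X. \<beta> x = \<alpha> x)"
      then obtain \<beta> where b: "\<beta> \<in> F T T" "\<beta> ` E = E" "\<forall>x\<in>X. \<beta> x = \<alpha> x" by blast
      define \<psi> where "\<psi> x = cj S u (\<beta> (cj S t x))" for x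
      have tT: "cj S t x \<in> T" if "x \<in> A" for x by (rule T_closed(4)[OF a(1) subsetD[OF sA(2) that]])
      have bt: "\<beta> t \<in> T" by (rule F_mem[OF b(1) a(1)])
      have "from_T \<psi> A"
      proof (rule from_TI[OF T_closed(1)[OF bt a(3)] b(1,2)])
        fix x assume x: "x \<in> A"
        hence xT: "x \<in> T" using sA by blast
        have "\<psi> x = cj S u (cj S (\<beta> t) (\<beta> x))" using F_cj[OF b(1) a(1) xT] by (simp add: \<psi>_def)
        thus "\<psi> x = cj S (\<beta> t \<otimes> u) (\<beta> x)" using T_cj_cj[OF a(3) bt F_mem[OF b(1) xT]] by simp
      qed
      moreover have "\<psi> x \<in> T" if "x \<in> A" for x
        unfolding \<psi>_def by (rule T_closed(4)[OF a(3) F_mem[OF b(1) tT[OF that]]])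
      moreover have "\<psi> x = \<phi> x" if "x \<in> P" for x using a(5)[OF that] b(3) that by (simp add: \<psi>_def X_def)
      ultimately show ?thesis by (intro ext[of \<psi>]) auto
    qed
  qed
qed

text \<open>Automorphisms of \<open>T\<close> preserve the orders of centralizers. A map from
  \<open>E\<close> reduces, after conjugation, to \<open>card_cen_le_of_nor\<close>, with full
  normalization supplying its premise.\<close>

lemma D_fully_centralized:
  assumes P: "subgroup P S" "P \<subseteq> T" and full: "fully_normalized ST D P"
  shows "fully_centralized ST D P"
  unfolding fully_centralized_def
proof
  fix \<phi> assume "\<phi> \<in> D P (carrier ST)"
  hence \<phi>: "\<phi> \<in> D P T" by simp
  note d = DD[OF \<phi>]
  have im: "\<phi> ` P \<subseteq> T" using d(6) by blast
  have "card (cen T (\<phi> ` P)) \<le> card (cen T P)" using d(7)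
  proof
    assume "from_T \<phi> P"
    then obtain \<beta> where "\<beta> \<in> F T T" "\<phi> ` P = \<beta> ` P" using from_T_image[OF \<phi>] by blast
    thus ?thesis using card_cen_image P by simp
  next
    assume "from_E \<phi> P"
    with \<phi> obtain t \<alpha> u where a: "t \<in> T" "\<alpha> \<in> F E E" "u \<in> T" "\<And>x. x \<in> P \<Longrightarrow> cj S t x \<in> E"
      "\<And>x. x \<in> P \<Longrightarrow> \<phi> x = cj S u (\<alpha> (cj S t x))"
      "subgroup (cj S t ` P) S" "cj S t ` P \<subseteq> E" "\<alpha> ` cj S t ` P \<subseteq> E" "\<phi> ` P = cj S u ` \<alpha> ` cj S t ` P"
      by (rule from_E_image) blast
    have Y: "\<alpha> ` cj S t ` P \<subseteq> T" using a(8) E_T by blast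
    have "card (normalizer ST (\<phi> ` P)) \<le> card (normalizer ST P)"
      using full \<phi> by (simp add: fully_normalized_def)
    hence "card (nor T (\<alpha> ` cj S t ` P)) \<le> card (nor T (cj S t ` P))"
      using im P(2) a(9) card_nor_conj[OF a(3) Y] card_nor_conj[OF a(1) P(2)] by (simp add: normalizer_ST)
    from card_cen_le_of_nor[OF a(2,6,7) this] show ?thesis
      using a(9) card_cen_conj[OF a(3) Y] card_cen_conj[OF a(1) P(2)] by simp
  qed
  thus "card (centralizer ST (\<phi> ` P)) \<le> card (centralizer ST P)"
    using im P(2) by (simp add: centralizer_ST)
qed

section \<open>Saturation: the Sylow axiom\<close>

text \<open>\<open>\<gamma>\<close> is conjugation by some \<open>g\<close> in
  \<open>N (Suc i)\<close>, and also an automorphism preserving \<open>E\<close> followed by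
  conjugation by \<open>s\<close> in \<open>T\<close>. So \<open>g \<otimes> inv s\<close>
  normalizes \<open>E\<close>, and the normalizer of \<open>E\<close> is contained in
  \<open>T\<close>.\<close>

lemma T_p_automorphism_inner:
  assumes \<gamma>: "\<gamma> \<in> F T T" "from_T \<gamma> T" and pow: "\<And>x. x \<in> T \<Longrightarrow> (\<gamma> ^^ (p ^ k)) x = x"
  shows "\<exists>s\<in>T. \<forall>x\<in>T. \<gamma> x = cj S s x"
proof -
  obtain g where g: "g \<in> N (Suc i)" "\<forall>x\<in>T. \<gamma> x = cj S g x"
    using p_automorphism_conj[OF i_less i_pos, of \<gamma> k] \<gamma>(1) pow unfolding T_def by blast
  have cg: "g \<in> carrier S" by (rule subgroup.mem_carrier[OF N_subgroup g(1)])
  obtain s \<beta> where b: "s \<in> T" "\<beta> \<in> F T T" "\<beta> ` E = E" "\<And>x. x \<in> T \<Longrightarrow> \<gamma> x = cj S s (\<beta> x)"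
    using \<gamma>(2) by (rule from_TE) blast
  have cs: "s \<in> carrier S" "inv s \<in> carrier S" using b(1) T_carrier by auto
  have "cj S (g \<otimes> inv s) x \<in> E" if x: "x \<in> E" for x
  proof -
    have xT: "x \<in> T" by (rule E_memT[OF x])
    have "cj S (g \<otimes> inv s) x = cj S (inv s) (cj S g x)"
      using cg cs T_carrier[OF xT] by (simp add: cj_cj)
    also have "\<dots> = \<beta> x" using g(2) b(4)[OF xT] xT T_cj_inv(1)[OF b(1) F_mem[OF b(2) xT]] by simp
    finally show ?thesis using b(3) x by auto
  qed
  hence "g \<otimes> inv s \<in> T" using cg cs by (intro normalizer_in_T) auto
  hence "g \<otimes> inv s \<otimes> s \<in> T" by (rule T_closed(1)[OF _ b(1)])
  hence "g \<in> T" using cg cs by (simp add: m_assoc)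
  thus ?thesis using g(2) by blast
qed

text \<open>The passage to the p-part: \<open>n\<close> is a multiple of the part \<open>q\<close>
  of the group order prime to \<open>p\<close>, so the power has p-power order on \<open>W\<close>;
  and \<open>n\<close> is 1 modulo \<open>p ^ k\<close>, so nothing changes on
  \<open>P\<close>.\<close>

lemma p_part_restricts:
  assumes \<beta>: "\<beta> \<in> F W W" and P: "P \<subseteq> W" and pow: "\<And>x. x \<in> P \<Longrightarrow> (\<beta> ^^ (p ^ k)) x = x"
  shows "\<exists>n l. (\<forall>x\<in>W. ((\<beta> ^^ n) ^^ (p ^ l)) x = x) \<and> (\<forall>x\<in>P. (\<beta> ^^ n) x = \<beta> x)"
proof -
  have W: "subgroup W S" by (rule F_dom[OF \<beta>])
  interpret A: group "Aut_group S F W" by (rule Aut_group_simps(4)[OF W])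
  define r where "r = order (Aut_group S F W)"
  have fin: "finite (carrier (Aut_group S F W))" by (simp add: Aut_group_simps[OF W] finite_Aut)
  hence r: "r \<noteq> 0" by (simp add: r_def A.order_gt_0_iff_finite[symmetric])
  have "\<beta> [^]\<^bsub>Aut_group S F W\<^esub> r = \<one>\<^bsub>Aut_group S F W\<^esub>"
    using \<beta> by (simp add: r_def Aut_group_simps[OF W] A.pow_order_eq_1)
  hence br: "(\<beta> ^^ r) x = x" if "x \<in> W" for x using Aut_group_pow_one[OF W \<beta>] that by blast
  obtain q l where q: "r = p ^ l * q" "\<not> p dvd q"
    using multiplicity_decompose'[of r p] r prime_p by (metis not_prime_unit)
  have q0: "q \<noteq> 0" using q r by auto
  have "coprime q (p ^ k)"
    using q(2) prime_p prime_imp_coprime[of p q] by (auto simp: coprime_commute)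
  moreover obtain u v where "q * u = p ^ k * v + gcd q (p ^ k)" using bezout_nat[OF q0] by blast
  ultimately have uv: "q * u = p ^ k * v + 1" by simp
  have "((\<beta> ^^ (q * u)) ^^ (p ^ l)) x = x" if x: "x \<in> W" for x
  proof -
    have "((\<beta> ^^ (q * u)) ^^ (p ^ l)) x = (\<beta> ^^ (r * u)) x" by (simp add: funpow_mult q mult_ac)
    thus ?thesis using funpow_fixed_mult[OF br[OF x]] by simp
  qed
  moreover have "(\<beta> ^^ (q * u)) x = \<beta> x" if "x \<in> P" for x
    using funpow_fixed_mult[OF pow[OF that]] unfolding uv by simp
  ultimately show ?thesis by blast
qed

text \<open>\<open>\<phi>\<close> extends to an automorphism of \<open>T\<close> in
  \<open>D\<close>; the p-part of the extension has the same restriction to \<open>P\<close> and is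
  inner.\<close>

lemma from_T_p_automorphism:
  assumes \<phi>: "\<phi> \<in> D P P" "from_T \<phi> P" and pow: "\<And>x. x \<in> P \<Longrightarrow> (\<phi> ^^ (p ^ k)) x = x"
  shows "\<exists>s\<in>T. \<forall>x\<in>P. \<phi> x = cj S s x"
proof -
  note d = DD[OF \<phi>(1)]
  obtain s \<beta> where b: "s \<in> T" "\<beta> \<in> F T T" "\<beta> ` E = E" "\<And>x. x \<in> P \<Longrightarrow> \<phi> x = cj S s (\<beta> x)"
    using \<phi>(2) by (rule from_TE) blast
  define \<gamma> where "\<gamma> = (\<lambda>x\<in>T. cj S s (\<beta> x))"
  have \<gamma>: "\<gamma> \<in> D T T" unfolding D_T \<gamma>_def by (auto intro!: from_TI[OF b(1-3)])
  have \<gamma>F: "\<gamma> \<in> F T T" by (rule D_subset_F[OF \<gamma>])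
  have eq: "\<gamma> x = \<phi> x" if "x \<in> P" for x using b(4)[OF that] d(4) that by (auto simp: \<gamma>_def)
  have it: "(\<gamma> ^^ n) x = (\<phi> ^^ n) x \<and> (\<phi> ^^ n) x \<in> P" if "x \<in> P" for x n
    using that by (induction n) (auto simp: eq d(6))
  have "(\<gamma> ^^ (p ^ k)) x = x" if "x \<in> P" for x using it[OF that] pow[OF that] by simp
  from p_part_restricts[OF \<gamma>F d(4) this] obtain n l
    where n: "\<forall>x\<in>T. ((\<gamma> ^^ n) ^^ (p ^ l)) x = x" "\<forall>x\<in>P. (\<gamma> ^^ n) x = \<gamma> x" by blast
  define \<delta> where "\<delta> = restrict (\<gamma> ^^ n) T"
  have \<delta>: "\<delta> \<in> D T T" unfolding \<delta>_def by (rule DF.F_funpow[OF \<gamma>])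
  have \<delta>T: "\<delta> x \<in> T" if "x \<in> T" for x by (rule F_mem[OF D_subset_F[OF \<delta>] that])
  have it': "(\<delta> ^^ j) x = ((\<gamma> ^^ n) ^^ j) x \<and> (\<delta> ^^ j) x \<in> T" if "x \<in> T" for x j
    using that
  proof (induction j)
    case (Suc j)
    hence IH: "(\<delta> ^^ j) x = ((\<gamma> ^^ n) ^^ j) x" "(\<delta> ^^ j) x \<in> T" by auto
    hence "\<delta> ((\<delta> ^^ j) x) = (\<gamma> ^^ n) ((\<delta> ^^ j) x)" by (simp add: \<delta>_def)
    thus ?case using IH(1) \<delta>T[OF IH(2)] by simp
  qed simp
  have "(\<delta> ^^ (p ^ l)) x = x" if "x \<in> T" for x using it'[OF that] n(1) that by simp
  from T_p_automorphism_inner[OF D_subset_F[OF \<delta>] _ this] obtain g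
    where g: "g \<in> T" "\<forall>x\<in>T. \<delta> x = cj S g x" using \<delta> D_T by blast
  have "\<phi> x = cj S g x" if x: "x \<in> P" for x
  proof -
    have xT: "x \<in> T" using x d(4) by blast
    have "\<phi> x = \<delta> x" using eq[OF x] n(2) x xT by (simp add: \<delta>_def)
    thus ?thesis using g(2) xT by simp
  qed
  thus ?thesis using g(1) by blast
qed

text \<open>Conjugated into \<open>E\<close>, \<open>\<phi>\<close> becomes the restriction of an
  automorphism of \<open>E\<close> to a proper subgroup, so \<open>p_automorphism_by_E\<close> gives
  an element of \<open>E\<close>, which is conjugated back by \<open>t\<close>.\<close>

lemma from_E_p_automorphism:
  assumes \<phi>: "\<phi> \<in> D P P" "from_E \<phi> P" and pow: "\<And>x. x \<in> P \<Longrightarrow> (\<phi> ^^ (p ^ k)) x = x"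
    and card: "card P \<noteq> card E"
  shows "\<exists>s\<in>T. \<forall>x\<in>P. \<phi> x = cj S s x"
proof -
  note d = DD[OF \<phi>(1)]
  obtain t \<alpha> u where a: "t \<in> T" "\<alpha> \<in> F E E" "u \<in> T" "\<And>x. x \<in> P \<Longrightarrow> cj S t x \<in> E"
    "\<And>x. x \<in> P \<Longrightarrow> \<phi> x = cj S u (\<alpha> (cj S t x))"
    "subgroup (cj S t ` P) S" "cj S t ` P \<subseteq> E" "\<alpha> ` cj S t ` P \<subseteq> E" "\<phi> ` P = cj S u ` \<alpha> ` cj S t ` P"
    using \<phi> by (rule from_E_image) blast
  have PT: "x \<in> T" if "x \<in> P" for x using that d(4) by blast
  define X where "X = cj S t ` P"
  have XE: "X \<noteq> E"
    using card card_cj_image[OF T_carrier[OF a(1)] subgroup.subset[OF d(2)]] by (auto simp: X_def)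
  have ut: "u \<otimes> t \<in> T" by (rule T_closed(1)[OF a(3,1)])
  have key: "cj S (u \<otimes> t) (\<alpha> (cj S t x)) = cj S t (\<phi> x)" if x: "x \<in> P" for x
    using a(5)[OF x] T_cj_cj[OF a(1,3) E_memT[OF F_mem[OF a(2) a(4)[OF x]]]] by simp
  have "cj S (u \<otimes> t) ` \<alpha> ` X \<subseteq> E"
  proof safe
    fix y assume "y \<in> X"
    then obtain x where x: "x \<in> P" "y = cj S t x" by (auto simp: X_def)
    show "cj S (u \<otimes> t) (\<alpha> y) \<in> E" using key[OF x(1)] x(2) a(4)[OF d(6)[OF x(1)]] by simp
  qed
  from conj_in_E_by_Aut[OF F_subset_image[OF a(2,6,7)] a(8) T_carrier[OF ut] this[unfolded X_def]]
  obtain \<gamma> where g: "\<gamma> \<in> F E E" "\<forall>y\<in>\<alpha> ` cj S t ` P. cj S (u \<otimes> t) y = \<gamma> y" by blast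
  define \<delta> where "\<delta> = (\<lambda>x\<in>E. \<gamma> (\<alpha> x))"
  have \<delta>: "\<delta> \<in> F E E" unfolding \<delta>_def by (rule F_comp[OF a(2) g(1)])
  have \<delta>t: "\<delta> (cj S t x) = cj S t (\<phi> x)" if x: "x \<in> P" for x
    using key[OF x] g(2) a(4)[OF x] x by (auto simp: \<delta>_def)
  have it: "(\<delta> ^^ n) (cj S t x) = cj S t ((\<phi> ^^ n) x) \<and> (\<phi> ^^ n) x \<in> P" if "x \<in> P" for x n
    using that by (induction n) (auto simp: \<delta>t d(6))
  have "\<exists>e\<in>E. \<forall>x\<in>X. \<delta> x = cj S e x"
  proof (rule p_automorphism_by_E[OF a(6,7)[folded X_def] XE \<delta>, where k = k])
    fix y assume "y \<in> X"
    then obtain x where x: "x \<in> P" "y = cj S t x" by (auto simp: X_def)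
    show "\<delta> y \<in> X" using \<delta>t[OF x(1)] d(6)[OF x(1)] x(2) by (simp add: X_def)
    show "(\<delta> ^^ (p ^ k)) y = y" using it[OF x(1)] pow[OF x(1)] x(2) by simp
  qed
  then obtain e where e: "e \<in> E" "\<forall>x\<in>X. \<delta> x = cj S e x" by blast
  have eT: "e \<in> T" by (rule E_memT[OF e(1)])
  have it': "inv t \<in> T" by (rule T_closed(2)[OF a(1)])
  have "\<phi> x = cj S (t \<otimes> e \<otimes> inv t) x" if x: "x \<in> P" for x
  proof -
    have "cj S t (\<phi> x) = cj S e (cj S t x)" using \<delta>t[OF x] e(2) x by (simp add: X_def)
    hence "\<phi> x = cj S (inv t) (cj S e (cj S t x))" using T_cj_inv(1)[OF a(1) PT[OF d(6)[OF x]]] by simp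
    thus ?thesis using a(1) eT it' PT[OF x] T_carrier by (simp add: cj_cj m_assoc)
  qed
  moreover have "t \<otimes> e \<otimes> inv t \<in> T" by (rule T_closed(1)[OF T_closed(1)[OF a(1) eT] it'])
  ultimately show ?thesis by blast
qed

text \<open>A \<open>T\<close>-conjugate \<open>P\<close> of \<open>E\<close> is fully normalized in \<open>\<F>\<close> too, and \<open>Aut\<^sub>D(P) = Aut\<^sub>\<F>(P)\<close>.\<close>

lemma sylow_conjugate_of_E:
  assumes P: "subgroup P S" "P \<subseteq> T" and t: "t \<in> T" "cj S t ` P = E"
  shows "sylow_subgroup p (conj_hom ST P P) (Aut_group ST D P)"
proof -
  have ct: "t \<in> carrier S" "inv t \<in> carrier S" "inv t \<in> T" using t T_carrier T_closed(2) by auto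
  have cP: "x \<in> carrier S" if "x \<in> P" for x by (rule subgroup.mem_carrier[OF P(1) that])
  have tE: "cj S t x \<in> E" if "x \<in> P" for x using t that by blast
  have tP: "cj S (inv t) y \<in> P" if y: "y \<in> E" for y
  proof -
    obtain x where "x \<in> P" "y = cj S t x" using t(2) y by blast
    thus ?thesis using ct cP by simp
  qed
  have imE: "cj S (inv t) ` E = P" using tP tE ct cP by (force simp: image_iff)
  have PF: "(\<lambda>x\<in>P. cj S t x) \<in> F P E" using t(2) by (intro F_conj[OF P(1) E ct(1)]) auto
  have EF: "(\<lambda>x\<in>E. cj S (inv t) x) \<in> F E P" using imE by (intro F_conj[OF E P(1) ct(2)]) auto
  have DP: "D P P = F P P"
  proof (intro subset_antisym subsetI)
    fix \<phi> assume \<phi>: "\<phi> \<in> F P P"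
    have "from_E \<phi> P"
    proof (rule from_EI[OF t(1) F_comp[OF F_comp[OF EF \<phi>] PF] ct(3) tE])
      fix x assume x: "x \<in> P"
      show "\<phi> x = cj S (inv t) ((\<lambda>x\<in>E. (\<lambda>x\<in>P. cj S t x) ((\<lambda>x\<in>E. \<phi> ((\<lambda>x\<in>E. cj S (inv t) x) x)) x)) (cj S t x))"
        using tE[OF x] ct cP[OF x] x F_mem[OF \<phi> x] cP[OF F_mem[OF \<phi> x]] by simp
    qed
    hence "restrict \<phi> P \<in> D P P" using P F_mem[OF \<phi>] by (intro DI) auto
    thus "\<phi> \<in> D P P" using extensional_restrict[OF F_ext[OF \<phi>]] by simp
  qed (rule D_subset_F)
  \<comment> \<open>\<open>T\<close> and all of \<open>S\<close> induce the same automorphisms of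
    \<open>P\<close>: if \<open>g\<close> normalizes \<open>P\<close>, then its conjugate by
    \<open>t\<close> normalizes \<open>E\<close>, and that normalizer lies in
    \<open>T\<close>.\<close>
  have "g \<in> T" if g: "g \<in> carrier S" "cj S g ` P \<subseteq> P" for g
  proof -
    have "cj S (cj S t g) y \<in> E" if y: "y \<in> E" for y
    proof -
      obtain x where x: "x \<in> P" "y = cj S t x" using t(2) y by blast
      have "cj S (cj S t g) y = cj S t (cj S g x)"
        using x ct g(1) cP by (simp add: cj_def m_assoc inv_mult_group)
      thus ?thesis using tE g(2) x(1) by auto
    qed
    hence "cj S t g \<in> T" using g ct by (intro normalizer_in_T) auto
    hence "cj S (inv t) (cj S t g) \<in> T" by (rule T_closed(4)[OF ct(3)])
    thus ?thesis using g(1) ct by simp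
  qed
  moreover have "cj ST g = cj S g" if "g \<in> T" for g using cj_ST[OF that] by (rule ext)
  ultimately have "\<phi> \<in> conj_hom ST P P \<longleftrightarrow> \<phi> \<in> conj_hom S P P" for \<phi>
    unfolding conj_hom_cj using T_carrier by (simp del: image_subset_iff) metis
  hence hom: "conj_hom ST P P = conj_hom S P P" by (rule Set.set_eqI)
  have "fully_normalized S F P"
    unfolding fully_normalized_def
  proof
    fix \<phi> assume \<phi>: "\<phi> \<in> F P (carrier S)"
    have "(\<lambda>x\<in>E. \<phi> ((\<lambda>x\<in>E. cj S (inv t) x) x)) ` E = \<phi> ` P" using imE by (auto simp: image_image)
    hence "card (normalizer S (\<phi> ` P)) \<le> card (normalizer S E)"
      using N_fully_normalized[OF m_pos] F_comp[OF EF \<phi>] by (auto simp: fully_normalized_def)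
    also have "normalizer S E = nor (carrier S) E" using mem_N1 by (auto simp: nor_def)
    also have "card \<dots> = card (nor (carrier S) P)"
    proof -
      have "(\<lambda>x\<in>carrier S. cj S t x) \<in> F (carrier S) (carrier S)"
        using ct by (intro F_conj[OF subgroup_self subgroup_self]) auto
      from card_nor_image[OF this, of P] show ?thesis
        using t(2) subgroup.subset[OF P(1)] by (simp only: image_restrict_subset)
    qed
    also have "nor (carrier S) P = normalizer S P"
      using mem_normalizer_iff[OF subgroup.subset[OF P(1)]] by (auto simp: nor_def)
    finally show "card (normalizer S (\<phi> ` P)) \<le> card (normalizer S P)" .
  qed
  hence "sylow_subgroup p (conj_hom S P P) (Aut_group S F P)" using fully_normalized_imp[OF P(1)] by blast
  moreover have "Aut_group ST D P = Aut_group S F P" by (simp add: Aut_group_def DP)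
  ultimately show ?thesis using hom by simp
qed

text \<open>In \<open>D\<close> this holds for every \<open>P\<close>, fully normalized or not: away
  from the conjugates of \<open>E\<close> all automorphisms of p-power order are conjugations by
  elements of \<open>T\<close>.\<close>

lemma D_sylow:
  assumes P: "subgroup P S" "P \<subseteq> T"
  shows "sylow_subgroup p (conj_hom ST P P) (Aut_group ST D P)"
proof (cases "\<exists>t\<in>T. cj S t ` P = E")
  case True
  thus ?thesis using sylow_conjugate_of_E[OF P] by blast
next
  case False
  have sP: "subgroup P ST" using P by (simp add: subgroup_ST)
  show ?thesis
  proof (rule DF.sylow_conj_homI[OF sP])
    fix \<phi> k assume \<phi>: "\<phi> \<in> D P P" and pow: "\<And>x. x \<in> P \<Longrightarrow> (\<phi> ^^ (p ^ k)) x = x"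
    have "\<exists>s\<in>T. \<forall>x\<in>P. \<phi> x = cj S s x" using DD(7)[OF \<phi>]
    proof
      assume "from_T \<phi> P"
      thus ?thesis by (rule from_T_p_automorphism[OF \<phi> _ pow])
    next
      assume fE: "from_E \<phi> P"
      then obtain t where t: "t \<in> T" "cj S t ` P \<subseteq> E" by (auto simp: from_E_def)
      have card: "card P \<noteq> card E"
        using False t card_subset_eq[OF E_finite t(2)]
          card_cj_image[OF T_carrier[OF t(1)] subgroup.subset[OF P(1)]] by auto
      show ?thesis by (rule from_E_p_automorphism[OF \<phi> fE _ card]) (rule pow)
    qed
    thus "\<exists>g\<in>carrier ST. \<forall>x\<in>P. \<phi> x = cj ST g x" by (auto simp: cj_ST)
  qed
qed

lemma D_saturated: "saturated_fusion_system p ST D"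
proof unfold_locales
  fix P assume "subgroup P ST" "fully_normalized ST D P"
  thus "fully_centralized ST D P \<and> sylow_subgroup p (conj_hom ST P P) (Aut_group ST D P)"
    using D_fully_centralized D_sylow by (simp add: subgroup_ST)
next
  fix \<phi> P assume "\<phi> \<in> D P (carrier ST)" "fully_centralized ST D (\<phi> ` P)"
  thus "\<exists>\<psi>\<in>D (extension_domain ST P \<phi>) (carrier ST). \<forall>x\<in>P. \<psi> x = \<phi> x"
    using D_extension by simp
qed

section \<open>The pearl in the subsystem\<close>

text \<open>\<open>D\<close> has the same automorphisms of \<open>E\<close> as \<open>F\<close>, so
  the strongly embedded subgroup carries over. The normalizer of \<open>E\<close> in
  \<open>S\<close> lies in \<open>T\<close>, so full normalization does as well.\<close>

lemma D_pearl:
  assumes pearl: "E \<in> pearls p S F"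
  shows "E \<in> pearls p ST D"
proof -
  have ess: "essential p S F E" using pearl by (simp add: pearls_def)
  have DF_S: "\<phi> \<in> F E (carrier S)" if "\<phi> \<in> D E (carrier ST)" for \<phi>
    using that F_codomain[OF D_subset_F subgroup_self, of \<phi> E T] F_carrier[OF D_subset_F, of \<phi> E T]
    by (simp add: image_subset_iff)
  have imT: "\<phi> ` E \<subseteq> T" if "\<phi> \<in> D E (carrier ST)" for \<phi> using DD(6) that by auto
  have "centric ST D E"
    unfolding centric_def
  proof
    fix \<phi> assume \<phi>: "\<phi> \<in> D E (carrier ST)"
    have "centralizer ST (\<phi> ` E) \<subseteq> centralizer S (\<phi> ` E)" by (auto simp: centralizer_def T_carrier)
    thus "centralizer ST (\<phi> ` E) \<subseteq> \<phi> ` E" using centric_E DF_S[OF \<phi>] by (auto simp: centric_def)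
  qed
  moreover have "fully_normalized ST D E"
    unfolding fully_normalized_def
  proof
    fix \<phi> assume \<phi>: "\<phi> \<in> D E (carrier ST)"
    have sub: "nor T (\<phi> ` E) \<subseteq> normalizer S (\<phi> ` E)"
      using mem_normalizer_iff[of "\<phi> ` E"] imT[OF \<phi>] T_carrier by (auto simp: nor_def)
    have "finite (normalizer S (\<phi> ` E))"
      using subgroup_normalizer[of "\<phi> ` E"] imT[OF \<phi>] T_carrier
      by (intro finite_subgroup[OF _ finite_carrier]) auto
    hence "card (nor T (\<phi> ` E)) \<le> card (normalizer S (\<phi> ` E))" using sub by (rule card_mono)
    also have "\<dots> \<le> card (normalizer S E)"
      using N_fully_normalized[OF m_pos] DF_S[OF \<phi>] by (simp add: fully_normalized_def)
    also have "normalizer S E = nor T E"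
      using mem_N1 N1_T T_carrier by (auto simp: nor_def)
    finally show "card (normalizer ST (\<phi> ` E)) \<le> card (normalizer ST E)"
      using imT[OF \<phi>] E_T by (simp add: normalizer_ST)
  qed
  moreover have "Out_group ST D E = Out_group S F E"
  proof -
    have "Inn ST E = Inn S E"
      unfolding Inn_def conj_map_cj using E_memT by (intro image_cong restrict_ext) (simp_all add: cj_ST)
    moreover have "Aut_group ST D E = Aut_group S F E" by (simp add: Aut_group_def D_E)
    ultimately show ?thesis by (simp add: Out_group_def)
  qed
  ultimately have "essential p ST D E"
    using ess E E_T by (simp add: essential_def subgroup_ST)
  thus ?thesis using pearl by (simp add: pearls_def)
qed

end

theorem lemma3p7:
  fixes S :: "('a, 'b) monoid_scheme" and F :: "'a fusion" and E :: "'a set" and p m :: nat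
  assumes "Factorial_Ring.prime p" and "odd p"
    and "p_group p S"
    and "saturated_fusion_system p S F"
    and "E \<in> pearls p S F"
    and "card (rcosets\<^bsub>S\<^esub> E) = p ^ m"
  shows "\<forall>i. 1 \<le> i \<and> i \<le> m - 1 \<longrightarrow>
           fusion_subsystem p S (iter_normalizer S E i) (pearl_subsystem p S F E i) F \<and>
           saturated_fusion_system p (S\<lparr>carrier := iter_normalizer S E i\<rparr>) (pearl_subsystem p S F E i) \<and>
           E \<in> pearls p (S\<lparr>carrier := iter_normalizer S E i\<rparr>) (pearl_subsystem p S F E i)"
proof (intro allI impI)
  fix i assume i: "1 \<le> i \<and> i \<le> m - 1"
  interpret saturated_fusion_system p S F by fact
  have ess: "subgroup E S" "centric S F E"
    using assms(5) by (simp_all add: pearls_def essential_def)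
  have "order S = p ^ m * card E"
    using lagrange[OF ess(1)] assms(6) by simp
  hence "pearl_tower p S F E m"
    using assms(4,5) ess by (auto simp: pearl_tower_def pearl_tower_axioms_def pearls_def)
  then interpret pearl_subtower p S F E m i
    using i by (auto simp: pearl_subtower_def pearl_subtower_axioms_def)
  show "fusion_subsystem p S (N i) (pearl_subsystem p S F E i) F \<and>
      saturated_fusion_system p (S\<lparr>carrier := N i\<rparr>) (pearl_subsystem p S F E i) \<and>
      E \<in> pearls p (S\<lparr>carrier := N i\<rparr>) (pearl_subsystem p S F E i)"
    unfolding pearl_subsystem_eq T_def[symmetric]
    using D_fusion_subsystem D_saturated D_pearl[OF assms(5)] by blast
qed

end
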